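(* Let $E$ and $F$ be complex Banach spaces, let $U$ be an open subset of $E$, let $p\in[1,\infty)$ and let $f\in\mathcal{H}^\infty(U,F)$. The following conditions are equivalent: (i) $f\colon U\to F$ is a right $p$-nuclear holomorphic mapping. (ii) The linearisation $T_f\colon\mathcal{G}^\infty(U)\to F$ is a right $p$-nuclear operator. In this case, $\nu^{p\mathcal{H}^\infty}(f)=\nu^p(T_f)$. Furthermore, the mapping $f\mapsto T_f$ is an isometric isomorphism from $(\mathcal{H}^\infty_{\mathcal{N}^p}(U,F),\nu^{p\mathcal{H}^\infty})$ onto $(\mathcal{N}^p(\mathcal{G}^\infty(U),F),\nu^p)$.
   Context: $\mathcal{L}(X,Y)$ is the Banach space of bounded linear operators between Banach spaces $X,Y$; $B_X$ is the closed unit ball of $X$. $\mathcal{H}^\infty(U,F)$ is the Banach space of all bounded holomorphic mappings $f\colon U\to F$ with the supremum norm $\|\cdot\|_\infty$, and $\mathcal{H}^\infty(U)=\mathcal{H}^\infty(U,\mathbb{C})$. Let $p^*=p/(p-1)$ for $1<p<\infty$ and $p^*=\infty$ for $p=1$. $\ell_p(X)$ is the space of absolutely $p$-summable sequences in $X$ with norm $\|(x_n)\|_p=(\sum_n\|x_n\|^p)^{1/p}$. For $1\le q<\infty$, $\ell_q^{\mathrm{weak}}(X)$ is the Banach space of weakly $q$-summable sequences in $X$ with norm $\|(x_n)\|_q^{\mathrm{weak}}=\sup\{(\sum_n|\varphi(x_n)|^q)^{1/q}\colon\varphi\in B_{X^*}\}$; $\ell_\infty^{\mathrm{weak}}(X)$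 is the space of bounded sequences in $X$ with norm $\sup_n\|x_n\|$. An operator $T\in\mathcal{L}(X,Y)$ is right $p$-nuclear if there are $(x_n^* )\in\ell_{p^*}^{\mathrm{weak}}(X^* )$ and $(y_n)\in\ell_p(Y)$ with $T(x)=\sum_{n=1}^\infty x_n^*(x)y_n$ for all $x\in X$, the series converging in $\mathcal{L}(X,Y)$. $\mathcal{N}^p(X,Y)$ is the set of such operators, with norm $\nu^p(T)=\inf\{\|(x_n^* )\|_{p^*}^{\mathrm{weak}}\|(y_n)\|_p\}$ over all such representations. A holomorphic mapping $f\colon U\to F$ is right $p$-nuclear if there are $(g_n)\in\ell_{p^*}^{\mathrm{weak}}(\mathcal{H}^\infty(U))$ and $(y_n)\in\ell_p(F)$ such that $f=\sum_{n=1}^\infty g_n\cdot y_n$ in $(\mathcal{H}^\infty(U,F),\|\cdot\|_\infty)$, where $(g\cdot y)(x)=g(x)y$. $\mathcal{H}^\infty_{\mathcal{N}^p}(U,F)$ is the set of such mappings and $\nu^{p\mathcal{H}^\infty}(f)=\inf\{\|(g_n)\|_{p^*}^{\mathrm{weak}}\|(y_n)\|_p\}$ over all such representations. Linearisation (Mujica). $\mathcal{G}^\infty(U)$ is the norm-closed linear span in $\mathcal{H}^\infty(U)^*$ of the functionals $\delta(x)\colon f\mapsto f(x)$, $x\in U$; $g_U\colon U\to\mathcal{G}^\infty(U)$, $g_U(x)=\delta(x)$, is holomorphic. For $f\in\mathcal{H}^\infty(U,F)$, $T_f\in\mathcal{L}(\mathcal{G}^\infty(U),F)$ is the unique bounded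 linear operator with $T_f\circ g_U=f$ (it exists and $\|T_f\|=\|f\|_\infty$). *)

theory Defs
  imports "HOL-Analysis.Analysis" "HOL-Library.Function_Algebras"
begin

class complex_vector = ab_group_add +
  fixes scaleC :: "complex \<Rightarrow> 'a \<Rightarrow> 'a"  (infixr "*\<^sub>C" 75)
  assumes scaleC_add_right: "a *\<^sub>C (x + y) = a *\<^sub>C x + a *\<^sub>C y"
    and scaleC_add_left: "(a + b) *\<^sub>C x = a *\<^sub>C x + b *\<^sub>C x"
    and scaleC_scaleC: "a *\<^sub>C (b *\<^sub>C x) = (a * b) *\<^sub>C x"
    and scaleC_one: "1 *\<^sub>C x = x"

global_interpretation complex_vector:
  vector_space "scaleC :: complex \<Rightarrow> 'a \<Rightarrow> 'a::complex_vector"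
  by unfold_locales (simp_all add: scaleC_add_right scaleC_add_left scaleC_scaleC scaleC_one)

class complex_normed_vector = complex_vector + real_normed_vector +
  assumes scaleR_eq_scaleC: "r *\<^sub>R x = complex_of_real r *\<^sub>C x"
    and norm_scaleC: "norm (a *\<^sub>C x) = cmod a * norm x"

class complex_banach = complex_normed_vector + banach

instantiation complex :: complex_banach
begin

definition scaleC_complex :: "complex \<Rightarrow> complex \<Rightarrow> complex"
  where "scaleC_complex a x = a * x"

instance
  by standard (simp_all add: scaleC_complex_def algebra_simps norm_mult scaleR_conv_of_real)

end

instantiation "fun" :: (type, complex_vector) complex_vector
begin

definition scaleC_fun :: "complex \<Rightarrow> ('a \<Rightarrow> 'b) \<Rightarrow> 'a \<Rightarrow> 'b"
  where "scaleC_fun a f = (\<lambda>x. a *\<^sub>C f x)"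

instance
  by standard
    (simp_all add: scaleC_fun_def fun_eq_iff scaleC_add_right scaleC_add_left scaleC_scaleC scaleC_one)

end

text \<open>
  The spaces of bounded holomorphic maps on \<open>U\<close>, its predual and their duals depend on the
  set \<open>U\<close>, so they are not types. They are given by a carrier inside a complex vector space
  type, whose operations they use, and a norm that is meaningful on the carrier only.
  Maps defined on a proper subset are extended by zero, so that pointwise operations on
  total functions are the operations of the function space and equality is equality on the
  domain.
\<close>

record 'a cnspace =
  carr :: "'a set"
  nrm :: "'a \<Rightarrow> real"

definition normed_space :: "'a::complex_vector cnspace \<Rightarrow> bool" where
  "normed_space X \<longleftrightarrow>
     complex_vector.subspace (carr X) \<and>
     (\<forall>x\<in>carr X. nrm X x = 0 \<longleftrightarrow> x = 0) \<and>
     (\<forall>x\<in>carr X. \<forall>c. nrm X (c *\<^sub>C x) = cmod c * nrm X x) \<and>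
     (\<forall>x\<in>carr X. \<forall>y\<in>carr X. nrm X (x + y) \<le> nrm X x + nrm X y)"

definition linear_on :: "'a::complex_vector set \<Rightarrow> ('a \<Rightarrow> 'b::complex_vector) \<Rightarrow> bool" where
  "linear_on V T \<longleftrightarrow>
     (\<forall>x\<in>V. \<forall>y\<in>V. T (x + y) = T x + T y) \<and> (\<forall>c. \<forall>x\<in>V. T (c *\<^sub>C x) = c *\<^sub>C T x)"

definition isometric_isomorphism ::
  "'a::complex_vector cnspace \<Rightarrow> 'b::complex_vector cnspace \<Rightarrow> ('a \<Rightarrow> 'b) \<Rightarrow> bool" where
  "isometric_isomorphism X Y \<Phi> \<longleftrightarrow>
     normed_space X \<and> normed_space Y \<and>
     linear_on (carr X) \<Phi> \<and> bij_betw \<Phi> (carr X) (carr Y) \<and>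
     (\<forall>x\<in>carr X. nrm Y (\<Phi> x) = nrm X x)"

definition unit_ball :: "'a cnspace \<Rightarrow> 'a set" where
  "unit_ball X = {x \<in> carr X. nrm X x \<le> 1}"

definition sums_in :: "'a::ab_group_add cnspace \<Rightarrow> (nat \<Rightarrow> 'a) \<Rightarrow> 'a \<Rightarrow> bool" where
  "sums_in X a s \<longleftrightarrow>
     (\<forall>n. a n \<in> carr X) \<and> s \<in> carr X \<and> (\<lambda>N. nrm X (s - (\<Sum>n<N. a n))) \<longlonglongrightarrow> 0"

definition closed_span :: "'a::complex_vector cnspace \<Rightarrow> 'a set \<Rightarrow> 'a cnspace" where
  "closed_span X S =
     \<lparr>carr = {x \<in> carr X. \<forall>e>0. \<exists>s\<in>complex_vector.span S. nrm X (x - s) < e}, nrm = nrm X\<rparr>"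

definition bounded_operators ::
  "'a::complex_vector cnspace \<Rightarrow> ('a \<Rightarrow> 'b::complex_normed_vector) cnspace" where
  "bounded_operators X =
     \<lparr>carr = {T. linear_on (carr X) T \<and>
                 (\<exists>K. \<forall>x\<in>carr X. norm (T x) \<le> K * nrm X x) \<and>
                 (\<forall>x. x \<notin> carr X \<longrightarrow> T x = 0)},
      nrm = (\<lambda>T. SUP x\<in>unit_ball X. norm (T x))\<rparr>"

abbreviation dual :: "'a::complex_vector cnspace \<Rightarrow> ('a \<Rightarrow> complex) cnspace" where
  "dual X \<equiv> bounded_operators X"

definition tensor :: "('a \<Rightarrow> complex) \<Rightarrow> 'b::complex_vector \<Rightarrow> 'a \<Rightarrow> 'b" where
  "tensor g y = (\<lambda>x. g x *\<^sub>C y)"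

definition conj_exponent :: "real \<Rightarrow> ereal" where
  "conj_exponent p = (if p = 1 then \<infinity> else ereal (p / (p - 1)))"

definition lp_seqs :: "real \<Rightarrow> (nat \<Rightarrow> 'b::real_normed_vector) set" where
  "lp_seqs p = {y. summable (\<lambda>n. norm (y n) powr p)}"

definition lp_norm :: "real \<Rightarrow> (nat \<Rightarrow> 'b::real_normed_vector) \<Rightarrow> real" where
  "lp_norm p y = (\<Sum>n. norm (y n) powr p) powr (1 / p)"

definition weak_seqs :: "ereal \<Rightarrow> 'a::complex_vector cnspace \<Rightarrow> (nat \<Rightarrow> 'a) set" where
  "weak_seqs q X =
     {x. range x \<subseteq> carr X \<and>
         (if q = \<infinity> then bdd_above (range (\<lambda>n. nrm X (x n)))
          else \<forall>\<phi>\<in>carr (dual X). summable (\<lambda>n. cmod (\<phi> (x n)) powr real_of_ereal q))}"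

text \<open>
  On \<open>weak_seqs q X\<close> with \<open>q \<ge> 1\<close> and \<open>X\<close> a normed space the suprema are finite; for
  \<open>q < \<infinity>\<close> this is the uniform boundedness principle in the dual of \<open>X\<close>.
\<close>

definition weak_norm :: "ereal \<Rightarrow> 'a::complex_vector cnspace \<Rightarrow> (nat \<Rightarrow> 'a) \<Rightarrow> real" where
  "weak_norm q X x =
     (if q = \<infinity> then SUP n. nrm X (x n)
      else SUP \<phi>\<in>unit_ball (dual X).
             (\<Sum>n. cmod (\<phi> (x n)) powr real_of_ereal q) powr (1 / real_of_ereal q))"

definition nuclear_rep ::
  "real \<Rightarrow> 'a::complex_vector cnspace \<Rightarrow> ('a \<Rightarrow> 'b::complex_normed_vector) \<Rightarrow>
    (nat \<Rightarrow> 'a \<Rightarrow> complex) \<Rightarrow> (nat \<Rightarrow> 'b) \<Rightarrow> bool" where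
  "nuclear_rep p X T x' y \<longleftrightarrow>
     x' \<in> weak_seqs (conj_exponent p) (dual X) \<and> y \<in> lp_seqs p \<and>
     (\<forall>x\<in>carr X. (\<lambda>n. x' n x *\<^sub>C y n) sums T x) \<and>
     sums_in (bounded_operators X) (\<lambda>n. tensor (x' n) (y n)) T"

definition right_nuclear ::
  "real \<Rightarrow> 'a::complex_vector cnspace \<Rightarrow> ('a \<Rightarrow> 'b::complex_normed_vector) \<Rightarrow> bool" where
  "right_nuclear p X T \<longleftrightarrow> T \<in> carr (bounded_operators X) \<and> (\<exists>x' y. nuclear_rep p X T x' y)"

definition nuclear_norm ::
  "real \<Rightarrow> 'a::complex_vector cnspace \<Rightarrow> ('a \<Rightarrow> 'b::complex_normed_vector) \<Rightarrow> real" where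
  "nuclear_norm p X T =
     Inf {weak_norm (conj_exponent p) (dual X) x' * lp_norm p y | x' y. nuclear_rep p X T x' y}"

definition nuclear_operators ::
  "real \<Rightarrow> 'a::complex_vector cnspace \<Rightarrow> ('a \<Rightarrow> 'b::complex_normed_vector) cnspace" where
  "nuclear_operators p X = \<lparr>carr = {T. right_nuclear p X T}, nrm = nuclear_norm p X\<rparr>"

text \<open>
  \<open>has_derivative\<close> only provides a real-linear Frechet derivative; complex linearity is required
  separately.
\<close>

definition holomorphic_map ::
  "'e::complex_normed_vector set \<Rightarrow> ('e \<Rightarrow> 'f::complex_normed_vector) \<Rightarrow> bool" where
  "holomorphic_map U f \<longleftrightarrow>
     (\<forall>x\<in>U. \<exists>D. (f has_derivative D) (at x) \<and> linear_on UNIV D)"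

text \<open>Inserting \<open>0\<close> gives the supremum norm the value \<open>0\<close> when \<open>U\<close> is empty.\<close>

definition Hinf ::
  "'e::complex_normed_vector set \<Rightarrow> ('e \<Rightarrow> 'f::complex_normed_vector) cnspace" where
  "Hinf U =
     \<lparr>carr = {f. holomorphic_map U f \<and> bounded (f ` U) \<and> (\<forall>x. x \<notin> U \<longrightarrow> f x = 0)},
      nrm = (\<lambda>f. Sup (insert 0 ((\<lambda>x. norm (f x)) ` U)))\<rparr>"

definition hol_nuclear_rep ::
  "real \<Rightarrow> 'e::complex_normed_vector set \<Rightarrow> ('e \<Rightarrow> 'f::complex_normed_vector) \<Rightarrow>
    (nat \<Rightarrow> 'e \<Rightarrow> complex) \<Rightarrow> (nat \<Rightarrow> 'f) \<Rightarrow> bool" where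
  "hol_nuclear_rep p U f g y \<longleftrightarrow>
     g \<in> weak_seqs (conj_exponent p) (Hinf U) \<and> y \<in> lp_seqs p \<and>
     sums_in (Hinf U) (\<lambda>n. tensor (g n) (y n)) f"

definition right_nuclear_hol ::
  "real \<Rightarrow> 'e::complex_normed_vector set \<Rightarrow> ('e \<Rightarrow> 'f::complex_normed_vector) \<Rightarrow> bool" where
  "right_nuclear_hol p U f \<longleftrightarrow> f \<in> carr (Hinf U) \<and> (\<exists>g y. hol_nuclear_rep p U f g y)"

definition hol_nuclear_norm ::
  "real \<Rightarrow> 'e::complex_normed_vector set \<Rightarrow> ('e \<Rightarrow> 'f::complex_normed_vector) \<Rightarrow> real" where
  "hol_nuclear_norm p U f =
     Inf {weak_norm (conj_exponent p) (Hinf U) g * lp_norm p y | g y. hol_nuclear_rep p U f g y}"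

definition nuclear_hol_maps ::
  "real \<Rightarrow> 'e::complex_normed_vector set \<Rightarrow> ('e \<Rightarrow> 'f::complex_normed_vector) cnspace" where
  "nuclear_hol_maps p U = \<lparr>carr = {f. right_nuclear_hol p U f}, nrm = hol_nuclear_norm p U\<rparr>"

definition point_eval ::
  "'e::complex_normed_vector set \<Rightarrow> 'e \<Rightarrow> ('e \<Rightarrow> complex) \<Rightarrow> complex" where
  "point_eval U x = (\<lambda>f. if f \<in> carr (Hinf U) then f x else 0)"

definition Ginf ::
  "'e::complex_normed_vector set \<Rightarrow> (('e \<Rightarrow> complex) \<Rightarrow> complex) cnspace" where
  "Ginf U = closed_span (dual (Hinf U)) (point_eval U ` U)"

definition linearisation ::
  "'e::complex_normed_vector set \<Rightarrow> ('e \<Rightarrow> 'f::complex_normed_vector) \<Rightarrow>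
    (('e \<Rightarrow> complex) \<Rightarrow> complex) \<Rightarrow> 'f" where
  "linearisation U f =
     (THE T. T \<in> carr (bounded_operators (Ginf U)) \<and> (\<forall>x\<in>U. T (point_eval U x) = f x))"

end

theory Submission
  imports Defs "HOL-Complex_Analysis.Cauchy_Integral_Formula"
begin

text \<open>
  Linearisation \<open>f \<mapsto> T\<^sub>f\<close> is an isometric isomorphism from the bounded holomorphic maps \<open>U \<rightarrow> F\<close> onto the
  bounded operators from the predual to \<open>F\<close> (\<open>isometric_isomorphism_linearisation\<close>). This applies to the given \<open>F\<close>
  and to the scalars, and linearisation sends the elementary map \<open>g \<cdot> y\<close> to the elementary operator with
  functional \<open>T\<^sub>g\<close> and vector \<open>y\<close> (\<open>linearisation_tensor\<close>). Hence \<open>f = \<Sum> g\<^sub>n \<cdot> y\<^sub>n\<close> in the supremum norm if and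
  only if \<open>T\<^sub>f = \<Sum> T\<^bsub>g\<^sub>n\<^esub> \<cdot> y\<^sub>n\<close> in the operator norm, and every representation of \<open>T\<^sub>f\<close> is of this form. The
  weak norm of a sequence is invariant under isometric isomorphisms (\<open>weak_norm_iso\<close>), so
  corresponding representations have the same product of norms. The equivalence and the equality of norms follow.

  Existence of the linearisation rests on the Hahn-Banach theorem (\<open>norming_functional\<close>): the value at \<open>\<xi>\<close> is the
  vector \<open>y\<close> with \<open>\<phi> y = \<xi> (\<phi> \<circ> f)\<close> for all functionals \<open>\<phi>\<close>, which exists when \<open>\<xi>\<close> is an evaluation and,
  by completeness of \<open>F\<close>, on the closed span of evaluations (\<open>represents_exists\<close>). Surjectivity rests on Cauchy's
  estimates: they are uniform over the unit ball of the space of bounded holomorphic functions, so the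
  evaluation functional at \<open>x\<close> is a holomorphic function of \<open>x\<close> with values in the predual (\<open>point_eval_Taylor\<close>).

  An isometric isomorphism is one between normed spaces, so it also has to be shown that the right
  nuclear norm is a norm (\<open>normed_space_nuclear_hol_maps\<close>). That the weak norm is finite, and so bounds the sums
  of powers it is made of, is the uniform boundedness principle (\<open>dual_uniform_bound\<close>). A map of norm less than \<open>A\<close> has a representation whose two factors
  have norms at most \<open>A\<close> to the powers \<open>1 - 1 / p\<close> and \<open>1 / p\<close>; merging the sequences of two such representations
  gives the triangle inequality, and Young's inequality bounds the supremum norm by \<open>A\<close>.
\<close>

section \<open>Norming functionals\<close>

text \<open>
  The Hahn-Banach theorem is obtained from minimal sublinear functionals. Working with sublinear
  functionals on the whole space, ordered pointwise, replaces the usual extension of partially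
  defined functionals.
\<close>

definition sublinear :: "('a::real_vector \<Rightarrow> real) \<Rightarrow> bool" where
  "sublinear q \<longleftrightarrow> (\<forall>x y. q (x + y) \<le> q x + q y) \<and> (\<forall>t>0. \<forall>x. q (t *\<^sub>R x) \<le> t * q x)"

lemma sublinear_scaleR:
  assumes "sublinear q" "0 < t"
  shows "q (t *\<^sub>R x) = t * q x"
proof (rule antisym)
  have "q x = q ((1 / t) *\<^sub>R (t *\<^sub>R x))"
    using assms by simp
  also have "\<dots> \<le> (1 / t) * q (t *\<^sub>R x)"
    using assms unfolding sublinear_def by (meson zero_less_divide_1_iff)
  finally show "t * q x \<le> q (t *\<^sub>R x)"
    using assms by (simp add: field_simps)
qed (use assms in \<open>auto simp: sublinear_def\<close>)

lemma sublinear_zero: "sublinear q \<Longrightarrow> q 0 = 0"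
  using sublinear_scaleR[of q 2 0] by simp

lemma sublinear_ge_neg: "sublinear q \<Longrightarrow> - q (- x) \<le> q x"
  using sublinear_zero[of q] by (auto simp: sublinear_def) (smt (verit) add.right_inverse)

text \<open>
  \<open>tilt q y\<close> is a sublinear functional below \<open>q\<close> whose value at \<open>- y\<close> is at most \<open>- q y\<close>. A functional
  that cannot be lowered any further agrees with all its tilts, and this makes it additive.
\<close>

definition tilt :: "('a::real_vector \<Rightarrow> real) \<Rightarrow> 'a \<Rightarrow> 'a \<Rightarrow> real" where
  "tilt q y x = (INF t\<in>{0..}. q (x + t *\<^sub>R y) - t * q y)"

lemma tilt_le:
  assumes "sublinear q" "0 \<le> t"
  shows "tilt q y x \<le> q (x + t *\<^sub>R y) - t * q y"
  unfolding tilt_def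
proof (rule cINF_lower)
  show "bdd_below ((\<lambda>t. q (x + t *\<^sub>R y) - t * q y) ` {0..})"
  proof (rule bdd_belowI2)
    fix t :: real assume t: "t \<in> {0..}"
    \<comment> \<open>The value at \<open>t\<close> is bounded below by \<open>- q (- x)\<close>, so the infimum is a genuine one.\<close>
    have "t * q y = q (t *\<^sub>R y)"
      using t sublinear_scaleR[OF assms(1), of t y] sublinear_zero[OF assms(1)]
      by (cases "t = 0") auto
    also have "\<dots> = q ((x + t *\<^sub>R y) + (- x))"
      by simp
    also have "\<dots> \<le> q (x + t *\<^sub>R y) + q (- x)"
      using assms(1) unfolding sublinear_def by blast
    finally show "- q (- x) \<le> q (x + t *\<^sub>R y) - t * q y"
      by simp
  qed
qed (use assms in auto)

lemma tilt_greatest: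
  "(\<And>t. 0 \<le> t \<Longrightarrow> m \<le> q (x + t *\<^sub>R y) - t * q y) \<Longrightarrow> m \<le> tilt q y x"
  unfolding tilt_def by (rule cINF_greatest) auto

lemma sublinear_tilt:
  assumes q: "sublinear q"
  shows "sublinear (tilt q y)"
  unfolding sublinear_def
proof (intro conjI allI impI)
  fix x1 x2
  have "tilt q y (x1 + x2) - (q (x1 + t *\<^sub>R y) - t * q y) \<le> q (x2 + s *\<^sub>R y) - s * q y"
    if "0 \<le> t" "0 \<le> s" for s t
  proof -
    have "tilt q y (x1 + x2) \<le> q ((x1 + x2) + (t + s) *\<^sub>R y) - (t + s) * q y"
      using that by (intro tilt_le q) auto
    moreover have "q ((x1 + x2) + (t + s) *\<^sub>R y) \<le> q (x1 + t *\<^sub>R y) + q (x2 + s *\<^sub>R y)"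
    proof -
      have "(x1 + x2) + (t + s) *\<^sub>R y = (x1 + t *\<^sub>R y) + (x2 + s *\<^sub>R y)"
        by (simp add: algebra_simps)
      then show ?thesis
        using q unfolding sublinear_def by presburger
    qed
    ultimately show ?thesis
      by (simp add: algebra_simps)
  qed
  then have "tilt q y (x1 + x2) - (q (x1 + t *\<^sub>R y) - t * q y) \<le> tilt q y x2" if "0 \<le> t" for t
    using that by (intro tilt_greatest) auto
  then have "tilt q y (x1 + x2) - tilt q y x2 \<le> tilt q y x1"
    by (intro tilt_greatest) (smt (verit))
  then show "tilt q y (x1 + x2) \<le> tilt q y x1 + tilt q y x2"
    by simp
next
  fix s :: real and x assume s: "0 < s"
  have "tilt q y (s *\<^sub>R x) / s \<le> tilt q y x"
  proof (rule tilt_greatest)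
    fix t :: real assume t: "0 \<le> t"
    have "tilt q y (s *\<^sub>R x) \<le> q (s *\<^sub>R x + (s * t) *\<^sub>R y) - (s * t) * q y"
      using s t by (intro tilt_le q) auto
    also have "q (s *\<^sub>R x + (s * t) *\<^sub>R y) = s * q (x + t *\<^sub>R y)"
      using sublinear_scaleR[OF q s, of "x + t *\<^sub>R y"] by (simp add: scaleR_add_right)
    finally show "tilt q y (s *\<^sub>R x) / s \<le> q (x + t *\<^sub>R y) - t * q y"
      using s by (simp add: field_simps)
  qed
  then show "tilt q y (s *\<^sub>R x) \<le> s * tilt q y x"
    using s by (simp add: field_simps)
qed

text \<open>
  The smaller of two functionals of a chain bounds both values in the subadditivity inequality, which
  therefore passes to the infimum; \<open>- P (- x)\<close> is a lower bound that keeps the infimum finite.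
\<close>

lemma sublinear_INF_chain:
  assumes ne: "C \<noteq> {}" and chain: "\<And>q r. q \<in> C \<Longrightarrow> r \<in> C \<Longrightarrow> q \<le> r \<or> r \<le> q"
    and sub: "\<And>q. q \<in> C \<Longrightarrow> sublinear q \<and> q \<le> P"
  shows "sublinear (\<lambda>x. INF q\<in>C. q x)" "\<And>q. q \<in> C \<Longrightarrow> (\<lambda>x. INF q\<in>C. q x) \<le> q"
proof -
  have lower: "(INF q\<in>C. q x) \<le> q x" if "q \<in> C" for q x
  proof (rule cINF_lower[OF _ that])
    show "bdd_below ((\<lambda>q. q x) ` C)"
      by (rule bdd_belowI2[of _ "- P (- x)"]) (smt (verit) sub le_funD sublinear_ge_neg)
  qed
  then show "\<And>q. q \<in> C \<Longrightarrow> (\<lambda>x. INF q\<in>C. q x) \<le> q"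
    by (simp add: le_fun_def)
  show "sublinear (\<lambda>x. INF q\<in>C. q x)"
    unfolding sublinear_def
  proof (intro conjI allI impI)
    fix x y
    have *: "(INF q\<in>C. q (x + y)) - q x \<le> r y" if qr: "q \<in> C" "r \<in> C" for q r
    proof -
      obtain m where m: "m \<in> C" "m \<le> q" "m \<le> r"
        using chain[OF qr] qr by blast
      have "(INF q\<in>C. q (x + y)) \<le> m (x + y)"
        by (rule lower[OF m(1)])
      also have "\<dots> \<le> m x + m y"
        using sub[OF m(1)] by (auto simp: sublinear_def)
      finally show ?thesis
        using m(2,3) by (smt (verit) le_funD)
    qed
    have "(INF q\<in>C. q (x + y)) - q x \<le> (INF q\<in>C. q y)" if "q \<in> C" for q
      using * that by (intro cINF_greatest[OF ne]) auto
    then have "(INF q\<in>C. q (x + y)) - (INF q\<in>C. q y) \<le> (INF q\<in>C. q x)"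
      by (intro cINF_greatest[OF ne]) (smt (verit))
    then show "(INF q\<in>C. q (x + y)) \<le> (INF q\<in>C. q x) + (INF q\<in>C. q y)"
      by simp
  next
    fix t :: real and x assume t: "0 < t"
    have "(INF q\<in>C. q (t *\<^sub>R x)) / t \<le> (INF q\<in>C. q x)"
    proof (rule cINF_greatest[OF ne])
      fix q assume q: "q \<in> C"
      show "(INF q\<in>C. q (t *\<^sub>R x)) / t \<le> q x"
        using lower[OF q, of "t *\<^sub>R x"] sublinear_scaleR[of q t x] sub[OF q] t
        by (simp add: field_simps)
    qed
    then show "(INF q\<in>C. q (t *\<^sub>R x)) \<le> t * (INF q\<in>C. q x)"
      using t by (simp add: field_simps)
  qed
qed

text \<open>
  Zorn's lemma yields a minimal sublinear functional \<open>q\<close> below \<open>P\<close>. Minimality gives \<open>tilt q y = q\<close>, hence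
  \<open>q x \<le> q (x + y) - q y\<close>, the missing half of additivity.
\<close>

lemma linear_below_sublinear:
  fixes P :: "'a::real_vector \<Rightarrow> real"
  assumes P: "sublinear P"
  obtains q where "linear q" "\<And>x. q x \<le> P x"
proof -
  let ?A = "{q. sublinear q \<and> q \<le> P}"
  let ?P = "\<lambda>q r :: 'a \<Rightarrow> real. r \<le> q"
  have "partial_order_on ?A (relation_of ?P ?A)"
    by (rule partial_order_on_relation_ofI) auto
  moreover have "\<exists>u\<in>?A. \<forall>a\<in>C. ?P a u" if C: "C \<in> Chains (relation_of ?P ?A)" for C
  proof (cases "C = {}")
    case True
    then show ?thesis
      using P by auto
  next
    case False
    have chain: "\<And>q r. q \<in> C \<Longrightarrow> r \<in> C \<Longrightarrow> q \<le> r \<or> r \<le> q"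
      and sub: "\<And>q. q \<in> C \<Longrightarrow> sublinear q \<and> q \<le> P"
      using C by (auto simp: Chains_def relation_of_def)
    let ?u = "\<lambda>x. INF q\<in>C. q x"
    have "\<And>q. q \<in> C \<Longrightarrow> ?u \<le> q"
      by (rule sublinear_INF_chain[OF False chain sub])
    moreover have "sublinear ?u"
      by (rule sublinear_INF_chain[OF False chain sub])
    moreover have "?u \<le> P"
      using calculation(1) sub False by (meson ex_in_conv order_trans)
    ultimately show ?thesis
      by (intro bexI[of _ ?u]) auto
  qed
  ultimately obtain q where q: "sublinear q" "q \<le> P"
    and min: "\<And>r. sublinear r \<Longrightarrow> r \<le> P \<Longrightarrow> r \<le> q \<Longrightarrow> r = q"
    using predicate_Zorn[of ?A ?P] by auto
  have tilt: "tilt q y = q" for y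
  proof (rule min)
    show "tilt q y \<le> q"
      using tilt_le[OF q(1), of 0] by (simp add: le_fun_def)
    then show "tilt q y \<le> P"
      using q(2) by simp
  qed (rule sublinear_tilt[OF q(1)])
  have add: "q (x + y) = q x + q y" for x y
  proof (rule antisym)
    show "q (x + y) \<le> q x + q y"
      using q(1) by (auto simp: sublinear_def)
    show "q x + q y \<le> q (x + y)"
      using tilt_le[OF q(1), of 1 y x] by (simp add: tilt)
  qed
  have neg: "q (- x) = - q x" for x
    using add[of x "- x"] sublinear_zero[OF q(1)] by simp
  have "q (t *\<^sub>R x) = t * q x" for t x
    using sublinear_scaleR[OF q(1), of t x] sublinear_scaleR[OF q(1), of "- t" x]
      sublinear_zero[OF q(1)] neg[of "t *\<^sub>R x"]
    by (cases "t = 0"; cases "t > 0") auto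
  then have "linear q"
    by (intro linearI) (auto simp: add)
  then show thesis
    using that q(2) by (simp add: le_fun_def)
qed

text \<open>
  Starting from the tilt of the norm at \<open>y\<close> instead of the norm itself forces the real functional \<open>q\<close> below
  it to satisfy \<open>q (- y) \<le> - norm y\<close>, that is \<open>q y = norm y\<close>. The complex functional with real part \<open>q\<close>
  is \<open>q x - \<i> q (\<i> x)\<close>; rotating \<open>x\<close> so that its value becomes real shows that it is contractive.
\<close>

lemma norming_functional:
  fixes y :: "'a::complex_normed_vector"
  obtains \<phi> :: "'a \<Rightarrow> complex"
  where "linear_on UNIV \<phi>" "\<And>x. cmod (\<phi> x) \<le> norm x" "cmod (\<phi> y) = norm y"
proof -
  have n: "sublinear (norm :: 'a \<Rightarrow> real)"
    by (auto simp: sublinear_def norm_triangle_ineq)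
  obtain q where q: "linear q" and q_le: "\<And>x. q x \<le> tilt norm y x"
    using linear_below_sublinear[OF sublinear_tilt[OF n]] by blast
  have q_norm: "q x \<le> norm x" for x
    using q_le[of x] tilt_le[OF n, of 0 y x] by simp
  have q_y: "norm y \<le> q y"
    using q_le[of "- y"] tilt_le[OF n, of 1 y "- y"] linear_neg[OF q, of y] by simp
  define \<phi> where "\<phi> x = Complex (q x) (- q (\<i> *\<^sub>C x))" for x
  have add: "\<phi> (x + z) = \<phi> x + \<phi> z" for x z
    by (simp add: \<phi>_def linear_add[OF q] scaleC_add_right complex_eq_iff)
  have real: "\<phi> (complex_of_real t *\<^sub>C x) = complex_of_real t * \<phi> x" for t x
  proof -
    have "\<i> *\<^sub>C (complex_of_real t *\<^sub>C x) = t *\<^sub>R (\<i> *\<^sub>C x)"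
      by (metis mult.commute scaleC_scaleC scaleR_eq_scaleC)
    then show ?thesis
      by (simp add: \<phi>_def linear_scale[OF q] complex_eq_iff flip: scaleR_eq_scaleC)
  qed
  have imag: "\<phi> (\<i> *\<^sub>C x) = \<i> * \<phi> x" for x
  proof -
    have "\<i> *\<^sub>C (\<i> *\<^sub>C x) = (- 1) *\<^sub>R x"
      by (simp add: scaleC_scaleC scaleR_eq_scaleC)
    then show ?thesis
      by (simp add: \<phi>_def complex_eq_iff linear_neg[OF q])
  qed
  have scale: "\<phi> (c *\<^sub>C x) = c * \<phi> x" for c x
  proof -
    have "\<phi> (c *\<^sub>C x) = \<phi> (complex_of_real (Re c) *\<^sub>C x + complex_of_real (Im c) *\<^sub>C (\<i> *\<^sub>C x))"
      by (metis complex_eq mult.commute scaleC_add_left scaleC_scaleC)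
    also have "\<dots> = (complex_of_real (Re c) + complex_of_real (Im c) * \<i>) * \<phi> x"
      by (simp only: add real imag) (simp add: algebra_simps)
    also have "\<dots> = c * \<phi> x"
      by (metis complex_eq mult.commute)
    finally show ?thesis .
  qed
  have le: "cmod (\<phi> x) \<le> norm x" for x
  proof -
    \<comment> \<open>The rotation that turns \<open>\<phi> x\<close> into its modulus.\<close>
    define c where "c = cnj (sgn (\<phi> x))"
    have "c * \<phi> x = complex_of_real (cmod (\<phi> x))"
      by (cases "\<phi> x = 0")
        (simp_all add: c_def sgn_eq complex_norm_square[symmetric] power2_eq_square mult.commute[of "cnj _"])
    then have "\<phi> (c *\<^sub>C x) = complex_of_real (cmod (\<phi> x))"
      by (simp add: scale)
    then have "cmod (\<phi> x) = q (c *\<^sub>C x)"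
      by (simp add: \<phi>_def complex_eq_iff)
    also have "\<dots> \<le> norm (c *\<^sub>C x)"
      by (rule q_norm)
    also have "\<dots> \<le> norm x"
      by (simp add: norm_scaleC c_def norm_sgn)
    finally show ?thesis .
  qed
  have "norm y \<le> cmod (\<phi> y)"
    using q_y complex_Re_le_cmod[of "\<phi> y"] by (simp add: \<phi>_def)
  with le[of y] have "cmod (\<phi> y) = norm y"
    by simp
  moreover have "linear_on UNIV \<phi>"
    by (simp add: linear_on_def add scale scaleC_complex_def)
  ultimately show thesis
    using that le by blast
qed

section \<open>Normed carriers\<close>

lemma sum_fun_apply: "(\<Sum>i\<in>A. f i) x = (\<Sum>i\<in>A. f i x :: 'b::comm_monoid_add)"
  by (induction A rule: infinite_finite_induct) auto

lemma scaleC_fun_apply [simp]: "(c *\<^sub>C f) x = c *\<^sub>C f x"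
  by (simp add: scaleC_fun_def)

lemma normed_spaceD:
  assumes "normed_space X"
  shows normed_space_subspace: "complex_vector.subspace (carr X)"
    and nrm_eq_0_iff: "x \<in> carr X \<Longrightarrow> nrm X x = 0 \<longleftrightarrow> x = 0"
    and nrm_scaleC: "x \<in> carr X \<Longrightarrow> nrm X (c *\<^sub>C x) = cmod c * nrm X x"
    and nrm_triangle: "x \<in> carr X \<Longrightarrow> y \<in> carr X \<Longrightarrow> nrm X (x + y) \<le> nrm X x + nrm X y"
  using assms by (auto simp: normed_space_def)

lemma normed_space_carr:
  assumes "normed_space X"
  shows carr_zero: "0 \<in> carr X"
    and carr_add: "x \<in> carr X \<Longrightarrow> y \<in> carr X \<Longrightarrow> x + y \<in> carr X"
    and carr_diff: "x \<in> carr X \<Longrightarrow> y \<in> carr X \<Longrightarrow> x - y \<in> carr X"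
    and carr_scaleC: "x \<in> carr X \<Longrightarrow> c *\<^sub>C x \<in> carr X"
    and carr_sum: "(\<And>i. i \<in> A \<Longrightarrow> a i \<in> carr X) \<Longrightarrow> sum a A \<in> carr X"
  using normed_space_subspace[OF assms]
  by (auto intro: complex_vector.subspace_0 complex_vector.subspace_add
      complex_vector.subspace_diff complex_vector.subspace_scale complex_vector.subspace_sum)

lemma nrm_zero: "normed_space X \<Longrightarrow> nrm X 0 = 0"
  by (simp add: carr_zero nrm_eq_0_iff)

lemma nrm_minus:
  assumes "normed_space X" "x \<in> carr X"
  shows "nrm X (- x) = nrm X x"
  using nrm_scaleC[OF assms, of "- 1"] by (simp add: complex_vector.scale_minus_left scaleC_one)

lemma nrm_minus_commute:
  assumes "normed_space X" "x \<in> carr X" "y \<in> carr X"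
  shows "nrm X (x - y) = nrm X (y - x)"
  using nrm_minus[OF assms(1) carr_diff[OF assms]] by simp

lemma nrm_nonneg:
  assumes "normed_space X" "x \<in> carr X"
  shows "0 \<le> nrm X x"
  using nrm_triangle[OF assms(1), of x "- x"] nrm_minus[OF assms] nrm_zero[OF assms(1)]
    carr_diff[OF assms(1) carr_zero[OF assms(1)] assms(2)] assms(2) by simp

lemma nrm_triangle_diff:
  assumes "normed_space X" "x \<in> carr X" "y \<in> carr X" "z \<in> carr X"
  shows "nrm X (x - z) \<le> nrm X (x - y) + nrm X (y - z)"
  using nrm_triangle[OF assms(1), of "x - y" "y - z"] assms by (simp add: carr_diff)

lemma linear_onD:
  assumes "linear_on V T"
  shows linear_on_add: "x \<in> V \<Longrightarrow> y \<in> V \<Longrightarrow> T (x + y) = T x + T y"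
    and linear_on_scaleC: "x \<in> V \<Longrightarrow> T (c *\<^sub>C x) = c *\<^sub>C T x"
  using assms by (auto simp: linear_on_def)

lemma linear_on_sub:
  assumes "complex_vector.subspace V" "linear_on V T"
  shows linear_on_zero: "T 0 = 0"
    and linear_on_diff: "x \<in> V \<Longrightarrow> y \<in> V \<Longrightarrow> T (x - y) = T x - T y"
    and linear_on_sum: "(\<And>i. i \<in> A \<Longrightarrow> a i \<in> V) \<Longrightarrow> T (\<Sum>i\<in>A. a i) = (\<Sum>i\<in>A. T (a i))"
proof -
  show 0: "T 0 = 0"
    using linear_on_scaleC[OF assms(2), of 0 0] complex_vector.subspace_0[OF assms(1)]
    by (simp add: complex_vector.scale_zero_left)
  show "T (x - y) = T x - T y" if "x \<in> V" "y \<in> V"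
  proof -
    have "x = (x - y) + y"
      by simp
    then have "T x = T (x - y) + T y"
      using linear_on_add[OF assms(2), of "x - y" y] complex_vector.subspace_diff[OF assms(1) that] that
      by metis
    then show ?thesis
      by simp
  qed
  show "T (\<Sum>i\<in>A. a i) = (\<Sum>i\<in>A. T (a i))" if "\<And>i. i \<in> A \<Longrightarrow> a i \<in> V"
    using that
  proof (induction A rule: infinite_finite_induct)
    case (insert i A)
    then show ?case
      using linear_on_add[OF assms(2), of "a i" "sum a A"] complex_vector.subspace_sum[OF assms(1), of A a]
      by auto
  qed (auto simp: 0)
qed

section \<open>Bounded operators\<close>

lemma bounded_operatorsD:
  assumes "T \<in> carr (bounded_operators X)"
  shows operator_linear: "linear_on (carr X) T"
    and operator_outside: "x \<notin> carr X \<Longrightarrow> T x = 0"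
  using assms by (auto simp: bounded_operators_def)

lemma bounded_operatorsI:
  assumes "linear_on (carr X) T" "\<And>x. x \<in> carr X \<Longrightarrow> norm (T x) \<le> K * nrm X x"
    and "\<And>x. x \<notin> carr X \<Longrightarrow> T x = 0"
  shows "T \<in> carr (bounded_operators X)"
  using assms by (auto simp: bounded_operators_def)

lemma operator_norm_le:
  assumes X: "normed_space X" and "0 \<le> K" "\<And>x. x \<in> carr X \<Longrightarrow> norm (T x) \<le> K * nrm X x"
  shows "nrm (bounded_operators X) T \<le> K"
proof -
  have "norm (T x) \<le> K" if "x \<in> unit_ball X" for x
    using that assms(2) assms(3)[of x] mult_left_mono[of "nrm X x" 1 K] by (auto simp: unit_ball_def)
  moreover have "0 \<in> unit_ball X"
    using X by (simp add: unit_ball_def carr_zero nrm_zero)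
  ultimately show ?thesis
    by (auto simp: bounded_operators_def intro!: cSUP_least)
qed

lemma
  assumes X: "normed_space X" and T: "T \<in> carr (bounded_operators X)"
  shows operator_norm_bound: "x \<in> carr X \<Longrightarrow> norm (T x) \<le> nrm (bounded_operators X) T * nrm X x"
    and operator_norm_nonneg: "0 \<le> nrm (bounded_operators X) T"
proof -
  obtain K where K: "\<And>x. x \<in> carr X \<Longrightarrow> norm (T x) \<le> K * nrm X x"
    using T by (auto simp: bounded_operators_def)
  have bdd: "bdd_above ((\<lambda>x. norm (T x)) ` unit_ball X)"
  proof (rule bdd_aboveI2)
    fix x assume "x \<in> unit_ball X"
    then have x: "x \<in> carr X" "nrm X x \<le> 1"
      by (auto simp: unit_ball_def)
    have "norm (T x) \<le> K * nrm X x"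
      by (rule K[OF x(1)])
    also have "\<dots> \<le> \<bar>K\<bar> * 1"
      using nrm_nonneg[OF X x(1)] x(2) by (intro mult_mono) auto
    finally show "norm (T x) \<le> \<bar>K\<bar>"
      by simp
  qed
  have ball: "norm (T x) \<le> nrm (bounded_operators X) T" if "x \<in> unit_ball X" for x
    using cSUP_upper[OF that bdd] by (simp add: bounded_operators_def)
  show "0 \<le> nrm (bounded_operators X) T"
    using ball[of 0] X by (auto simp: unit_ball_def carr_zero nrm_zero intro: order_trans[OF norm_ge_zero])
  assume x: "x \<in> carr X"
  show "norm (T x) \<le> nrm (bounded_operators X) T * nrm X x"
  proof (cases "nrm X x = 0")
    case True
    then show ?thesis
      using K[OF x] by simp
  next
    case False
    then have pos: "0 < nrm X x"
      using nrm_nonneg[OF X x] by simp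
    define c where "c = complex_of_real (1 / nrm X x)"
    have "norm (T (c *\<^sub>C x)) \<le> nrm (bounded_operators X) T"
      using pos X x by (intro ball) (simp add: unit_ball_def carr_scaleC nrm_scaleC c_def norm_divide)
    also have "T (c *\<^sub>C x) = c *\<^sub>C T x"
      by (rule linear_on_scaleC[OF operator_linear[OF T] x])
    finally show ?thesis
      using pos by (simp add: norm_scaleC c_def norm_divide field_simps)
  qed
qed

lemma normed_space_bounded_operators:
  fixes X :: "'a::complex_vector cnspace"
  assumes X: "normed_space X"
  shows "normed_space (bounded_operators X :: ('a \<Rightarrow> 'b::complex_normed_vector) cnspace)"
proof -
  let ?B = "bounded_operators X :: ('a \<Rightarrow> 'b) cnspace"
  have add: "S + T \<in> carr ?B" "nrm ?B (S + T) \<le> nrm ?B S + nrm ?B T"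
    if ST: "S \<in> carr ?B" "T \<in> carr ?B" for S T
  proof -
    have le: "norm ((S + T) x) \<le> (nrm ?B S + nrm ?B T) * nrm X x" if "x \<in> carr X" for x
      using operator_norm_bound[OF X ST(1) that] operator_norm_bound[OF X ST(2) that]
        norm_triangle_ineq[of "S x" "T x"] by (simp add: algebra_simps)
    show "S + T \<in> carr ?B"
      using operator_linear[OF ST(1)] operator_linear[OF ST(2)] ST
      by (intro bounded_operatorsI[OF _ le])
         (auto simp: linear_on_def scaleC_add_right operator_outside)
    show "nrm ?B (S + T) \<le> nrm ?B S + nrm ?B T"
      by (intro operator_norm_le[OF X _ le]) (auto simp: operator_norm_nonneg[OF X] ST)
  qed
  have scale: "c *\<^sub>C T \<in> carr ?B" "nrm ?B (c *\<^sub>C T) \<le> cmod c * nrm ?B T"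
    if T: "T \<in> carr ?B" for c T
  proof -
    have le: "norm ((c *\<^sub>C T) x) \<le> (cmod c * nrm ?B T) * nrm X x" if "x \<in> carr X" for x
      using mult_left_mono[OF operator_norm_bound[OF X T that], of "cmod c"]
      by (simp add: norm_scaleC mult.assoc)
    show "c *\<^sub>C T \<in> carr ?B"
      using operator_linear[OF T] T
      by (intro bounded_operatorsI[OF _ le])
         (auto simp: linear_on_def scaleC_add_right scaleC_scaleC mult.commute operator_outside
           complex_vector.scale_zero_right)
    show "nrm ?B (c *\<^sub>C T) \<le> cmod c * nrm ?B T"
      by (intro operator_norm_le[OF X _ le]) (auto simp: operator_norm_nonneg[OF X] T)
  qed
  have zero: "0 \<in> carr ?B" "nrm ?B 0 \<le> 0"
    by (auto intro!: bounded_operatorsI[of _ _ 0] operator_norm_le[OF X]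
        simp: linear_on_def complex_vector.scale_zero_right)
  show ?thesis
    unfolding normed_space_def
  proof (intro conjI ballI allI)
    show "complex_vector.subspace (carr ?B)"
      by (intro complex_vector.subspaceI) (auto simp: add scale zero)
  next
    fix T assume T: "T \<in> carr ?B"
    show "nrm ?B T = 0 \<longleftrightarrow> T = 0"
    proof
      assume 0: "nrm ?B T = 0"
      have "T x = 0" for x
        using operator_norm_bound[OF X T, of x] operator_outside[OF T, of x] by (cases "x \<in> carr X") (auto simp: 0)
      then show "T = 0"
        by (simp add: fun_eq_iff)
    next
      assume "T = 0"
      then show "nrm ?B T = 0"
        using zero operator_norm_nonneg[OF X zero(1)] by simp
    qed
  next
    fix T c assume T: "T \<in> carr ?B"
    show "nrm ?B (c *\<^sub>C T) = cmod c * nrm ?B T"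
    proof (cases "c = 0")
      case True
      then show ?thesis
        using zero operator_norm_nonneg[OF X zero(1)] by (simp add: complex_vector.scale_zero_left)
    next
      case False
      have "T = (1 / c) *\<^sub>C (c *\<^sub>C T)"
        using False by (simp add: scaleC_scaleC scaleC_one)
      then have "nrm ?B T \<le> cmod (1 / c) * nrm ?B (c *\<^sub>C T)"
        using scale(2)[OF scale(1)[OF T, of c], of "1 / c"] by simp
      then show ?thesis
        using scale(2)[OF T, of c] False by (simp add: norm_divide field_simps)
    qed
  qed (auto simp: add)
qed

text \<open>
  A Cauchy sequence of operators converges pointwise because the target space is complete, and the Cauchy
  estimate, being uniform in \<open>x\<close>, survives the pointwise limit.
\<close>

lemma bounded_operators_complete:
  fixes T :: "nat \<Rightarrow> 'a::complex_vector \<Rightarrow> 'b::complex_banach"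
  assumes X: "normed_space X" and T: "\<And>n. T n \<in> carr (bounded_operators X)"
    and Cauchy: "\<And>e. 0 < e \<Longrightarrow> \<exists>N. \<forall>m\<ge>N. \<forall>n\<ge>N. nrm (bounded_operators X) (T m - T n) < e"
  obtains S where "S \<in> carr (bounded_operators X)"
    "(\<lambda>n. nrm (bounded_operators X) (T n - S)) \<longlonglongrightarrow> 0"
proof -
  let ?B = "bounded_operators X :: ('a \<Rightarrow> 'b) cnspace"
  have B: "normed_space ?B"
    by (rule normed_space_bounded_operators[OF X])
  have bound: "norm (T m x - T n x) \<le> nrm ?B (T m - T n) * nrm X x" if "x \<in> carr X" for m n x
    using operator_norm_bound[OF X carr_diff[OF B T T] that, of m n] by simp
  have "convergent (\<lambda>n. T n x)" for x
  proof (cases "x \<in> carr X")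
    case True
    have "Cauchy (\<lambda>n. T n x)"
    proof (rule CauchyI)
      fix e :: real assume e: "0 < e"
      then obtain N where N: "\<And>m n. m \<ge> N \<Longrightarrow> n \<ge> N \<Longrightarrow> nrm ?B (T m - T n) < e / (nrm X x + 1)"
        using Cauchy[of "e / (nrm X x + 1)"] nrm_nonneg[OF X True] by (smt (verit) divide_pos_pos)
      have "norm (T m x - T n x) < e" if "m \<ge> N" "n \<ge> N" for m n
      proof -
        have "norm (T m x - T n x) \<le> e / (nrm X x + 1) * nrm X x"
          using bound[OF True, of m n] N[OF that] nrm_nonneg[OF X True] by (meson less_imp_le mult_right_mono order_trans)
        also have "\<dots> < e"
          using e nrm_nonneg[OF X True] by (simp add: divide_simps algebra_simps)
        finally show ?thesis .
      qed
      then show "\<exists>M. \<forall>m\<ge>M. \<forall>n\<ge>M. norm (T m x - T n x) < e"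
        by blast
    qed
    then show ?thesis
      by (simp add: Cauchy_convergent_iff)
  qed (auto simp: operator_outside[OF T] convergent_const)
  then obtain S where S: "\<And>x. (\<lambda>n. T n x) \<longlonglongrightarrow> S x"
    unfolding convergent_def by metis
  have lin: "linear_on (carr X) S"
    unfolding linear_on_def
  proof (intro conjI allI ballI)
    fix x y assume xy: "x \<in> carr X" "y \<in> carr X"
    have "(\<lambda>n. T n (x + y)) \<longlonglongrightarrow> S x + S y"
      using tendsto_add[OF S[of x] S[of y]] by (simp add: linear_on_add[OF operator_linear[OF T] xy])
    then show "S (x + y) = S x + S y"
      using S LIMSEQ_unique by blast
  next
    fix c x assume x: "x \<in> carr X"
    have "bounded_linear (\<lambda>y::'b. c *\<^sub>C y)"
      by (rule bounded_linear_intro[where K = "cmod c"])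
         (auto simp: scaleC_add_right scaleR_eq_scaleC scaleC_scaleC norm_scaleC mult.commute)
    then have "(\<lambda>n. T n (c *\<^sub>C x)) \<longlonglongrightarrow> c *\<^sub>C S x"
      using bounded_linear.tendsto[OF _ S[of x]] by (simp add: linear_on_scaleC[OF operator_linear[OF T] x])
    then show "S (c *\<^sub>C x) = c *\<^sub>C S x"
      using S LIMSEQ_unique by blast
  qed
  have out: "S x = 0" if "x \<notin> carr X" for x
    using S[of x] operator_outside[OF T that] by (simp add: LIMSEQ_const_iff)
  have tail: "\<exists>N. \<forall>n\<ge>N. \<forall>x\<in>carr X. norm ((T n - S) x) \<le> e * nrm X x" if e: "0 < e" for e
  proof -
    obtain N where N: "\<And>m n. m \<ge> N \<Longrightarrow> n \<ge> N \<Longrightarrow> nrm ?B (T m - T n) < e"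
      using Cauchy[OF e] by blast
    have "norm ((T n - S) x) \<le> e * nrm X x" if n: "n \<ge> N" and x: "x \<in> carr X" for n x
    proof (rule LIMSEQ_le_const2)
      show "(\<lambda>m. norm (T n x - T m x)) \<longlonglongrightarrow> norm ((T n - S) x)"
        by (auto intro!: tendsto_intros S)
      have "norm (T n x - T m x) \<le> e * nrm X x" if "m \<ge> N" for m
        using bound[OF x, of n m] N[OF n that] nrm_nonneg[OF X x] by (meson less_imp_le mult_right_mono order_trans)
      then show "\<exists>N. \<forall>m\<ge>N. norm (T n x - T m x) \<le> e * nrm X x"
        by blast
    qed
    then show ?thesis
      by blast
  qed
  obtain N where N: "\<And>x. x \<in> carr X \<Longrightarrow> norm ((T N - S) x) \<le> 1 * nrm X x"
    using tail[of 1] by auto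
  have "S \<in> carr ?B"
  proof (rule bounded_operatorsI[OF lin _ out])
    fix x assume x: "x \<in> carr X"
    have "norm (S x) \<le> norm (T N x) + norm ((T N - S) x)"
      using norm_triangle_ineq4[of "T N x" "(T N - S) x"] by simp
    then show "norm (S x) \<le> (nrm ?B (T N) + 1) * nrm X x"
      using N[OF x] operator_norm_bound[OF X T x, of N] by (simp add: algebra_simps)
  qed
  moreover have "(\<lambda>n. nrm ?B (T n - S)) \<longlonglongrightarrow> 0"
  proof (rule LIMSEQ_I)
    fix e :: real assume e: "0 < e"
    obtain N where N: "\<And>n x. n \<ge> N \<Longrightarrow> x \<in> carr X \<Longrightarrow> norm ((T n - S) x) \<le> (e / 2) * nrm X x"
      using tail[of "e / 2"] e by auto
    have "nrm ?B (T n - S) \<le> e / 2" if "n \<ge> N" for n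
      using e by (intro operator_norm_le[OF X _ N[OF that]]) auto
    moreover have "0 \<le> nrm ?B (T n - S)" for n
      by (rule nrm_nonneg[OF B carr_diff[OF B T \<open>S \<in> carr ?B\<close>]])
    ultimately have "norm (nrm ?B (T n - S) - 0) < e" if "n \<ge> N" for n
      using e that by (smt (verit) field_sum_of_halves real_norm_def)
    then show "\<exists>N. \<forall>n\<ge>N. norm (nrm ?B (T n - S) - 0) < e"
      by blast
  qed
  ultimately show thesis
    by (rule that)
qed

lemma sums_in_bounded_operators:
  assumes X: "normed_space X" and sums: "sums_in (bounded_operators X) A T" and x: "x \<in> carr X"
  shows "(\<lambda>n. A n x) sums T x"
proof -
  let ?B = "bounded_operators X"
  have B: "normed_space ?B"
    by (rule normed_space_bounded_operators[OF X])
  have "\<forall>n. norm (norm (T x - (\<Sum>i<n. A i x))) \<le> nrm ?B (T - (\<Sum>i<n. A i)) * nrm X x"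
    using sums operator_norm_bound[OF X carr_diff[OF B _ carr_sum[OF B]] x, of T "{..<_}" A]
    by (auto simp: sums_in_def sum_fun_apply)
  moreover have "(\<lambda>n. nrm ?B (T - (\<Sum>i<n. A i)) * nrm X x) \<longlonglongrightarrow> 0"
    using sums by (auto simp: sums_in_def intro: tendsto_mult_left_zero)
  ultimately have "(\<lambda>n. norm (T x - (\<Sum>i<n. A i x))) \<longlonglongrightarrow> 0"
    by (rule Lim_null_comparison[OF always_eventually])
  then have "(\<lambda>n. T x - (\<Sum>i<n. A i x)) \<longlonglongrightarrow> 0"
    by (simp only: tendsto_norm_zero_iff)
  from tendsto_diff[OF tendsto_const[of "T x"] this] show ?thesis
    by (simp add: sums_def)
qed

section \<open>Closed spans\<close>

lemma
  assumes X: "normed_space X" and S: "S \<subseteq> carr X"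
  shows normed_space_closed_span: "normed_space (closed_span X S)"
    and closed_span_subset: "carr (closed_span X S) \<subseteq> carr X"
    and nrm_closed_span: "nrm (closed_span X S) = nrm X"
    and closed_span_superset: "S \<subseteq> carr (closed_span X S)"
    and closed_span_closed: "x \<in> carr X \<Longrightarrow> (\<And>e. 0 < e \<Longrightarrow> \<exists>y\<in>carr (closed_span X S). nrm X (x - y) < e)
      \<Longrightarrow> x \<in> carr (closed_span X S)"
proof -
  let ?Y = "closed_span X S" and ?L = "complex_vector.span S"
  show sub: "carr ?Y \<subseteq> carr X" and nrm: "nrm ?Y = nrm X"
    by (auto simp: closed_span_def)
  have L: "?L \<subseteq> carr X"
    by (rule complex_vector.span_minimal[OF S normed_space_subspace[OF X]])
  have span: "?L \<subseteq> carr ?Y"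
    using L X by (auto simp: closed_span_def nrm_zero intro!: bexI)
  then show "S \<subseteq> carr ?Y"
    using complex_vector.span_superset by blast
  show "x \<in> carr ?Y" if x: "x \<in> carr X" and lim: "\<And>e. 0 < e \<Longrightarrow> \<exists>y\<in>carr ?Y. nrm X (x - y) < e"
    unfolding closed_span_def
  proof (clarsimp simp: x)
    fix e :: real assume e: "0 < e"
    then obtain y where y: "y \<in> carr ?Y" "nrm X (x - y) < e / 2"
      using lim[of "e / 2"] by auto
    then obtain s where s: "s \<in> ?L" "nrm X (y - s) < e / 2"
      using e unfolding closed_span_def by (auto dest: spec[of _ "e / 2"])
    have "nrm X (x - s) \<le> nrm X (x - y) + nrm X (y - s)"
      using y s sub L by (intro nrm_triangle_diff[OF X x]) auto
    then show "\<exists>s\<in>?L. nrm X (x - s) < e"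
      using y s by (intro bexI[of _ s]) linarith+
  qed
  have "complex_vector.subspace (carr ?Y)"
  proof (rule complex_vector.subspaceI)
    show "0 \<in> carr ?Y"
      using span complex_vector.span_zero by blast
  next
    fix x y assume xy: "x \<in> carr ?Y" "y \<in> carr ?Y"
    show "x + y \<in> carr ?Y"
      unfolding closed_span_def
    proof (clarsimp, intro conjI allI impI)
      show "x + y \<in> carr X"
        using xy sub carr_add[OF X] by auto
      fix e :: real assume "0 < e"
      then obtain s t where st: "s \<in> ?L" "nrm X (x - s) < e / 2" "t \<in> ?L" "nrm X (y - t) < e / 2"
        using xy unfolding closed_span_def by (fastforce dest: spec[of _ "e / 2"])
      have "nrm X ((x - s) + (y - t)) \<le> nrm X (x - s) + nrm X (y - t)"
        using st xy sub L by (intro nrm_triangle[OF X] carr_diff[OF X]) auto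
      also have "(x - s) + (y - t) = x + y - (s + t)"
        by simp
      finally show "\<exists>s\<in>?L. nrm X (x + y - s) < e"
        using st by (intro bexI[of _ "s + t"] complex_vector.span_add) auto
    qed
  next
    fix c x assume x: "x \<in> carr ?Y"
    show "c *\<^sub>C x \<in> carr ?Y"
      unfolding closed_span_def
    proof (clarsimp, intro conjI allI impI)
      show "c *\<^sub>C x \<in> carr X"
        using x sub carr_scaleC[OF X] by auto
      fix e :: real assume e: "0 < e"
      then have "0 < e / (cmod c + 1)"
        by (smt (verit) divide_pos_pos norm_ge_zero)
      then obtain s where s: "s \<in> ?L" "nrm X (x - s) < e / (cmod c + 1)"
        using x unfolding closed_span_def by auto
      have xs: "x - s \<in> carr X"
        using x s sub L carr_diff[OF X] by auto
      have "nrm X (c *\<^sub>C x - c *\<^sub>C s) = cmod c * nrm X (x - s)"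
        by (simp add: nrm_scaleC[OF X xs] flip: complex_vector.scale_right_diff_distrib)
      also have "\<dots> \<le> cmod c * (e / (cmod c + 1))"
        using s by (intro mult_left_mono) auto
      also have "\<dots> < e"
        using e norm_ge_zero[of c] by (simp add: pos_divide_less_eq algebra_simps add_pos_nonneg)
      finally show "\<exists>s\<in>?L. nrm X (c *\<^sub>C x - s) < e"
        using s by (intro bexI[of _ "c *\<^sub>C s"] complex_vector.span_scale) auto
    qed
  qed
  then show "normed_space ?Y"
    using subsetD[OF sub] nrm_eq_0_iff[OF X] nrm_scaleC[OF X] nrm_triangle[OF X]
    unfolding normed_space_def nrm by simp
qed

text \<open>
  The induction principle for closed spans: a property holds on all of it as soon as it holds for the
  generators, defines a subspace and passes to norm limits.
\<close>

lemma closed_span_minimal: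
  assumes "S \<subseteq> V" "complex_vector.subspace V"
    and "\<And>x. x \<in> carr X \<Longrightarrow> (\<And>e. 0 < e \<Longrightarrow> \<exists>v\<in>V. nrm X (x - v) < e) \<Longrightarrow> x \<in> V"
  shows "carr (closed_span X S) \<subseteq> V"
  using complex_vector.span_minimal[OF assms(1,2)] assms(3)
  by (force simp: closed_span_def)

section \<open>Isometric isomorphisms\<close>

lemma isometric_isomorphismD:
  assumes "isometric_isomorphism X Y \<Phi>"
  shows iso_domain: "normed_space X" and iso_codomain: "normed_space Y"
    and iso_linear: "linear_on (carr X) \<Phi>" and iso_bij: "bij_betw \<Phi> (carr X) (carr Y)"
    and iso_nrm: "x \<in> carr X \<Longrightarrow> nrm Y (\<Phi> x) = nrm X x"
    and iso_carr: "x \<in> carr X \<Longrightarrow> \<Phi> x \<in> carr Y"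
  using assms by (auto simp: isometric_isomorphism_def bij_betw_def)

lemma isometric_isomorphismI:
  assumes X: "normed_space X" and lin: "linear_on (carr X) \<Phi>"
    and bij: "bij_betw \<Phi> (carr X) (carr Y)" and nrm: "\<And>x. x \<in> carr X \<Longrightarrow> nrm Y (\<Phi> x) = nrm X x"
  shows "isometric_isomorphism X Y \<Phi>"
proof -
  have Y: "carr Y = \<Phi> ` carr X" and inj: "inj_on \<Phi> (carr X)"
    using bij by (auto simp: bij_betw_def)
  note sub = normed_space_subspace[OF X]
  have 0: "\<Phi> 0 = 0"
    by (rule linear_on_zero[OF sub lin])
  have "complex_vector.subspace (carr Y)"
  proof (rule complex_vector.subspaceI)
    show "0 \<in> carr Y"
      using 0 carr_zero[OF X] Y by (metis imageI)
    show "x + y \<in> carr Y" if xy: "x \<in> carr Y" "y \<in> carr Y" for x y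
    proof -
      obtain a b where "a \<in> carr X" "b \<in> carr X" "x = \<Phi> a" "y = \<Phi> b"
        using xy Y by auto
      then show ?thesis
        unfolding Y using linear_on_add[OF lin, of a b] carr_add[OF X, of a b] by (metis imageI)
    qed
    show "c *\<^sub>C x \<in> carr Y" if x: "x \<in> carr Y" for c x
    proof -
      obtain a where "a \<in> carr X" "x = \<Phi> a"
        using x Y by auto
      then show ?thesis
        unfolding Y using linear_on_scaleC[OF lin, of a c] carr_scaleC[OF X, of a c] by (metis imageI)
    qed
  qed
  moreover have "nrm Y (\<Phi> x) = 0 \<longleftrightarrow> \<Phi> x = 0" if "x \<in> carr X" for x
    using that nrm nrm_eq_0_iff[OF X that] 0 inj carr_zero[OF X] by (metis inj_onD)
  moreover have "nrm Y (c *\<^sub>C \<Phi> x) = cmod c * nrm Y (\<Phi> x)" if "x \<in> carr X" for c x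
    using that nrm_scaleC[OF X that, of c] nrm carr_scaleC[OF X that, of c] linear_on_scaleC[OF lin that, of c] by metis
  moreover have "nrm Y (\<Phi> x + \<Phi> y) \<le> nrm Y (\<Phi> x) + nrm Y (\<Phi> y)" if "x \<in> carr X" "y \<in> carr X" for x y
    using that nrm_triangle[OF X that] nrm carr_add[OF X that] linear_on_add[OF lin that] by metis
  ultimately have "normed_space Y"
    unfolding normed_space_def by (auto simp: Y)
  then show ?thesis
    using assms by (simp add: isometric_isomorphism_def)
qed

lemma isometric_isomorphism_inverse:
  assumes iso: "isometric_isomorphism X Y \<Phi>"
  shows "isometric_isomorphism Y X (inv_into (carr X) \<Phi>)"
proof (rule isometric_isomorphismI[OF iso_codomain[OF iso]])
  let ?\<Psi> = "inv_into (carr X) \<Phi>"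
  note bij = iso_bij[OF iso] and X = iso_domain[OF iso]
  show "bij_betw ?\<Psi> (carr Y) (carr X)"
    by (rule bij_betw_inv_into[OF bij])
  have inv: "?\<Psi> y \<in> carr X" "\<Phi> (?\<Psi> y) = y" if "y \<in> carr Y" for y
    using that bij by (auto simp: bij_betw_def inv_into_into f_inv_into_f)
  have eq: "?\<Psi> (\<Phi> x) = x" if "x \<in> carr X" for x
    using that bij by (simp add: bij_betw_def)
  show "linear_on (carr Y) ?\<Psi>"
    unfolding linear_on_def
  proof (intro conjI ballI allI)
    fix x y assume xy: "x \<in> carr Y" "y \<in> carr Y"
    have "\<Phi> (?\<Psi> x + ?\<Psi> y) = x + y"
      using linear_on_add[OF iso_linear[OF iso] inv(1)[OF xy(1)] inv(1)[OF xy(2)]] inv xy by simp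
    then show "?\<Psi> (x + y) = ?\<Psi> x + ?\<Psi> y"
      using eq[OF carr_add[OF X inv(1)[OF xy(1)] inv(1)[OF xy(2)]]] by simp
  next
    fix c x assume x: "x \<in> carr Y"
    have "\<Phi> (c *\<^sub>C ?\<Psi> x) = c *\<^sub>C x"
      using linear_on_scaleC[OF iso_linear[OF iso] inv(1)[OF x]] inv x by simp
    then show "?\<Psi> (c *\<^sub>C x) = c *\<^sub>C ?\<Psi> x"
      using eq[OF carr_scaleC[OF X inv(1)[OF x]]] by metis
  qed
  show "nrm X (?\<Psi> y) = nrm Y y" if "y \<in> carr Y" for y
    using iso_nrm[OF iso inv(1)[OF that]] inv(2)[OF that] by simp
qed

lemma isometric_isomorphism_inverse_simps:
  assumes "isometric_isomorphism X Y \<Phi>"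
  shows "x \<in> carr X \<Longrightarrow> inv_into (carr X) \<Phi> (\<Phi> x) = x"
    and "y \<in> carr Y \<Longrightarrow> \<Phi> (inv_into (carr X) \<Phi> y) = y"
  using iso_bij[OF assms] by (auto simp: bij_betw_def f_inv_into_f)

lemma sums_in_iso:
  assumes iso: "isometric_isomorphism X Y \<Phi>" and sums: "sums_in X a s"
  shows "sums_in Y (\<lambda>n. \<Phi> (a n)) (\<Phi> s)"
proof -
  note X = iso_domain[OF iso] and lin = iso_linear[OF iso]
  have a: "a n \<in> carr X" and s: "s \<in> carr X" for n
    using sums by (auto simp: sums_in_def)
  have S: "(\<Sum>n<N. a n) \<in> carr X" for N
    by (rule carr_sum[OF X a])
  have "\<Phi> s - (\<Sum>n<N. \<Phi> (a n)) = \<Phi> (s - (\<Sum>n<N. a n))" for N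
    using linear_on_diff[OF normed_space_subspace[OF X] lin s S]
      linear_on_sum[OF normed_space_subspace[OF X] lin, of "{..<N}" a] a by simp
  then have "nrm Y (\<Phi> s - (\<Sum>n<N. \<Phi> (a n))) = nrm X (s - (\<Sum>n<N. a n))" for N
    using iso_nrm[OF iso carr_diff[OF X s S]] by simp
  then show ?thesis
    using sums iso_carr[OF iso] by (simp add: sums_in_def)
qed

text \<open>
  Composition with an isometric isomorphism carries functionals back without increasing their norm. The
  composite is cut off outside the carrier, as membership in the dual requires.
\<close>

lemma dual_pullback:
  assumes iso: "isometric_isomorphism X Y \<Phi>" and \<psi>: "\<psi> \<in> carr (dual Y)"
  defines "\<phi> \<equiv> \<lambda>x. if x \<in> carr X then \<psi> (\<Phi> x) else 0"
  shows "\<phi> \<in> carr (dual X)" "nrm (dual X) \<phi> \<le> nrm (dual Y) \<psi>"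
proof -
  note X = iso_domain[OF iso] and Y = iso_codomain[OF iso]
  have le: "cmod (\<phi> x) \<le> nrm (dual Y) \<psi> * nrm X x" if "x \<in> carr X" for x
    using operator_norm_bound[OF Y \<psi> iso_carr[OF iso that]] that by (simp add: \<phi>_def iso_nrm[OF iso])
  show "\<phi> \<in> carr (dual X)"
    using linear_onD[OF operator_linear[OF \<psi>]] linear_onD[OF iso_linear[OF iso]]
    by (intro bounded_operatorsI[OF _ le])
       (auto simp: linear_on_def \<phi>_def carr_add[OF X] carr_scaleC[OF X] iso_carr[OF iso])
  show "nrm (dual X) \<phi> \<le> nrm (dual Y) \<psi>"
    by (rule operator_norm_le[OF X operator_norm_nonneg[OF Y \<psi>] le])
qed

lemma unit_ball_dual_pullback:
  assumes "isometric_isomorphism X Y \<Phi>" "\<And>n. x n \<in> carr X" "\<psi> \<in> unit_ball (dual Y)"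
  obtains \<phi> where "\<phi> \<in> unit_ball (dual X)" "\<And>n. \<phi> (x n) = \<psi> (\<Phi> (x n))"
proof
  let ?\<phi> = "\<lambda>x. if x \<in> carr X then \<psi> (\<Phi> x) else 0"
  show "?\<phi> \<in> unit_ball (dual X)"
    using assms(3) dual_pullback[OF assms(1), of \<psi>] by (auto simp: unit_ball_def)
  show "?\<phi> (x n) = \<psi> (\<Phi> (x n))" for n
    using assms(2) by simp
qed

lemma weak_seqs_iso_imp:
  assumes iso: "isometric_isomorphism X Y \<Phi>" and x: "x \<in> weak_seqs q X"
  shows "(\<lambda>n. \<Phi> (x n)) \<in> weak_seqs q Y"
proof -
  have c: "x n \<in> carr X" for n
    using x by (auto simp: weak_seqs_def)
  show ?thesis
  proof (cases "q = \<infinity>")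
    case True
    then show ?thesis
      using x c by (auto simp: weak_seqs_def iso_carr[OF iso] iso_nrm[OF iso])
  next
    case False
    have "summable (\<lambda>n. cmod (\<psi> (\<Phi> (x n))) powr real_of_ereal q)" if "\<psi> \<in> carr (dual Y)" for \<psi>
      using x False dual_pullback(1)[OF iso that] c by (fastforce simp: weak_seqs_def)
    then show ?thesis
      using False c by (auto simp: weak_seqs_def iso_carr[OF iso])
  qed
qed

text \<open>
  Pulling functionals back along \<open>\<Phi>\<close> and along its inverse matches the two dual unit balls, so both suprema
  run over the same set of numbers.
\<close>

lemma weak_norm_iso:
  assumes iso: "isometric_isomorphism X Y \<Phi>" and x: "x \<in> weak_seqs q X"
  shows "weak_norm q Y (\<lambda>n. \<Phi> (x n)) = weak_norm q X x"
proof -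
  have c: "x n \<in> carr X" for n
    using x by (auto simp: weak_seqs_def)
  let ?S = "\<lambda>q z. (\<Sum>n. cmod (z n) powr real_of_ereal q) powr (1 / real_of_ereal q)"
  have "(\<lambda>\<psi>. ?S q (\<lambda>n. \<psi> (\<Phi> (x n)))) ` unit_ball (dual Y) = (\<lambda>\<phi>. ?S q (\<lambda>n. \<phi> (x n))) ` unit_ball (dual X)"
  proof (intro equalityI image_subsetI)
    fix \<psi> assume "\<psi> \<in> unit_ball (dual Y)"
    then obtain \<phi> where "\<phi> \<in> unit_ball (dual X)" "\<And>n. \<phi> (x n) = \<psi> (\<Phi> (x n))"
      using unit_ball_dual_pullback[where x = x, OF iso c] by metis
    then show "?S q (\<lambda>n. \<psi> (\<Phi> (x n))) \<in> (\<lambda>\<phi>. ?S q (\<lambda>n. \<phi> (x n))) ` unit_ball (dual X)"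
      by (intro image_eqI[of _ _ \<phi>]) simp_all
  next
    fix \<phi> assume "\<phi> \<in> unit_ball (dual X)"
    then obtain \<psi> where "\<psi> \<in> unit_ball (dual Y)" "\<And>n. \<psi> (\<Phi> (x n)) = \<phi> (inv_into (carr X) \<Phi> (\<Phi> (x n)))"
      using unit_ball_dual_pullback[where x = "\<lambda>n. \<Phi> (x n)",
          OF isometric_isomorphism_inverse[OF iso] iso_carr[OF iso c]] by metis
    then show "?S q (\<lambda>n. \<phi> (x n)) \<in> (\<lambda>\<psi>. ?S q (\<lambda>n. \<psi> (\<Phi> (x n)))) ` unit_ball (dual Y)"
      by (intro image_eqI[of _ _ \<psi>]) (simp_all add: isometric_isomorphism_inverse_simps[OF iso] c)
  qed
  then show ?thesis
    using c by (auto simp: weak_norm_def iso_nrm[OF iso])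
qed

section \<open>Bounded holomorphic maps\<close>

lemma bounded_linear_of_linear_on:
  fixes A :: "'a::complex_normed_vector \<Rightarrow> 'b::complex_normed_vector"
  assumes "linear_on UNIV A" "\<And>x. norm (A x) \<le> K * norm x"
  shows "bounded_linear A"
  by (rule bounded_linear_intro[where K = K])
     (use assms in \<open>auto simp: linear_on_def scaleR_eq_scaleC mult.commute\<close>)

lemma bounded_linear_scaleC: "bounded_linear (\<lambda>x::'a::complex_normed_vector. c *\<^sub>C x)"
  by (rule bounded_linear_of_linear_on[where K = "cmod c"])
     (auto simp: linear_on_def scaleC_add_right scaleC_scaleC norm_scaleC mult.commute)

lemma holomorphic_map_add:
  assumes "holomorphic_map U f" "holomorphic_map U g"
  shows "holomorphic_map U (f + g)"
  unfolding holomorphic_map_def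
proof
  fix x assume "x \<in> U"
  then obtain D E where "(f has_derivative D) (at x)" "linear_on UNIV D"
      "(g has_derivative E) (at x)" "linear_on UNIV E"
    using assms unfolding holomorphic_map_def by blast
  then show "\<exists>D. (f + g has_derivative D) (at x) \<and> linear_on UNIV D"
    by (intro exI[of _ "\<lambda>h. D h + E h"])
       (auto simp: plus_fun_def linear_on_def scaleC_add_right intro: has_derivative_add)
qed

lemma holomorphic_map_compose_linear:
  fixes A :: "'a::complex_normed_vector \<Rightarrow> 'b::complex_normed_vector"
  assumes f: "holomorphic_map U f" and A: "linear_on UNIV A" "bounded_linear A"
  shows "holomorphic_map U (\<lambda>x. A (f x))"
  unfolding holomorphic_map_def
proof
  fix x assume "x \<in> U"
  then obtain D where "(f has_derivative D) (at x)" "linear_on UNIV D"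
    using f unfolding holomorphic_map_def by blast
  then show "\<exists>D. ((\<lambda>x. A (f x)) has_derivative D) (at x) \<and> linear_on UNIV D"
    using A by (intro exI[of _ "\<lambda>h. A (D h)"]) (auto simp: linear_on_def intro: bounded_linear.has_derivative)
qed

lemma HinfI:
  assumes "holomorphic_map U f" "\<And>x. x \<in> U \<Longrightarrow> norm (f x) \<le> K" "\<And>x. x \<notin> U \<Longrightarrow> f x = 0"
  shows "f \<in> carr (Hinf U)"
  using assms by (auto simp: Hinf_def bounded_iff)

lemma HinfD:
  assumes "f \<in> carr (Hinf U)"
  shows Hinf_holomorphic: "holomorphic_map U f" and Hinf_outside: "x \<notin> U \<Longrightarrow> f x = 0"
    and Hinf_norm_bound: "norm (f x) \<le> nrm (Hinf U) f" and Hinf_norm_nonneg: "0 \<le> nrm (Hinf U) f"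
proof -
  show "holomorphic_map U f" and out: "x \<notin> U \<Longrightarrow> f x = 0" for x
    using assms by (auto simp: Hinf_def)
  obtain K where "\<And>x. x \<in> U \<Longrightarrow> norm (f x) \<le> K"
    using assms by (auto simp: Hinf_def bounded_iff)
  then have bdd: "bdd_above (insert 0 ((\<lambda>x. norm (f x)) ` U))"
    by (auto intro!: bdd_aboveI[of _ "max 0 K"] simp: le_max_iff_disj)
  show 0: "0 \<le> nrm (Hinf U) f"
    using cSup_upper[OF _ bdd, of 0] by (simp add: Hinf_def)
  show "norm (f x) \<le> nrm (Hinf U) f"
    using cSup_upper[OF _ bdd, of "norm (f x)"] out[of x] 0 by (cases "x \<in> U") (auto simp: Hinf_def)
qed

lemma Hinf_norm_le:
  assumes "0 \<le> K" "\<And>x. x \<in> U \<Longrightarrow> norm (f x) \<le> K"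
  shows "nrm (Hinf U) f \<le> K"
  using assms by (auto simp: Hinf_def intro!: cSup_least)

lemma normed_space_Hinf: "normed_space (Hinf U :: ('e::complex_normed_vector \<Rightarrow> 'f::complex_normed_vector) cnspace)"
proof -
  let ?H = "Hinf U :: ('e \<Rightarrow> 'f) cnspace"
  have add: "f + g \<in> carr ?H" "nrm ?H (f + g) \<le> nrm ?H f + nrm ?H g"
    if "f \<in> carr ?H" "g \<in> carr ?H" for f g
  proof -
    have le: "norm ((f + g) x) \<le> nrm ?H f + nrm ?H g" for x
      using norm_triangle_ineq[of "f x" "g x"] Hinf_norm_bound[OF that(1), of x]
        Hinf_norm_bound[OF that(2), of x] by simp
    show "f + g \<in> carr ?H"
      using that by (intro HinfI[OF _ le] holomorphic_map_add) (auto simp: Hinf_holomorphic Hinf_outside)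
    show "nrm ?H (f + g) \<le> nrm ?H f + nrm ?H g"
      using that by (intro Hinf_norm_le[OF _ le]) (auto simp: Hinf_norm_nonneg)
  qed
  have scale: "c *\<^sub>C f \<in> carr ?H" "nrm ?H (c *\<^sub>C f) \<le> cmod c * nrm ?H f" if f: "f \<in> carr ?H" for c f
  proof -
    have le: "norm ((c *\<^sub>C f) x) \<le> cmod c * nrm ?H f" for x
      using Hinf_norm_bound[OF f] by (simp add: norm_scaleC mult_left_mono)
    have "linear_on UNIV (\<lambda>y::'f. c *\<^sub>C y)"
      by (auto simp: linear_on_def scaleC_add_right scaleC_scaleC mult.commute)
    from holomorphic_map_compose_linear[OF Hinf_holomorphic[OF f] this bounded_linear_scaleC]
    have "holomorphic_map U (c *\<^sub>C f)"
      by (simp add: scaleC_fun_def)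
    then show "c *\<^sub>C f \<in> carr ?H"
      by (rule HinfI[OF _ le]) (simp add: Hinf_outside[OF f] complex_vector.scale_zero_right)
    show "nrm ?H (c *\<^sub>C f) \<le> cmod c * nrm ?H f"
      using f by (intro Hinf_norm_le[OF _ le]) (auto simp: Hinf_norm_nonneg)
  qed
  have "holomorphic_map U (0 :: 'e \<Rightarrow> 'f)"
    unfolding holomorphic_map_def zero_fun_def
    by (auto intro!: exI[of _ "\<lambda>_. 0"] simp: linear_on_def complex_vector.scale_zero_right)
  then have zero: "0 \<in> carr ?H" "nrm ?H 0 \<le> 0"
    by (auto intro!: HinfI[of _ _ 0] Hinf_norm_le)
  show ?thesis
    unfolding normed_space_def
  proof (intro conjI ballI allI)
    show "complex_vector.subspace (carr ?H)"
      by (intro complex_vector.subspaceI) (auto simp: add scale zero)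
  next
    fix f assume f: "f \<in> carr ?H"
    show "nrm ?H f = 0 \<longleftrightarrow> f = 0"
    proof
      assume "nrm ?H f = 0"
      then show "f = 0"
        using Hinf_norm_bound[OF f] by (simp add: fun_eq_iff)
    next
      assume "f = 0"
      then show "nrm ?H f = 0"
        using zero Hinf_norm_nonneg[OF zero(1)] by simp
    qed
  next
    fix f c assume f: "f \<in> carr ?H"
    show "nrm ?H (c *\<^sub>C f) = cmod c * nrm ?H f"
    proof (cases "c = 0")
      case True
      then show ?thesis
        using zero Hinf_norm_nonneg[OF zero(1)] by (simp add: complex_vector.scale_zero_left)
    next
      case False
      have "f = (1 / c) *\<^sub>C (c *\<^sub>C f)"
        using False by (simp add: scaleC_scaleC scaleC_one)
      then have "nrm ?H f \<le> cmod (1 / c) * nrm ?H (c *\<^sub>C f)"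
        using scale(2)[OF scale(1)[OF f, of c], of "1 / c"] by simp
      then show ?thesis
        using scale(2)[OF f, of c] False by (simp add: norm_divide field_simps)
    qed
  qed (auto simp: add)
qed

text \<open>
  Contractive functionals reduce vector-valued maps to scalar ones: this is how elements of the predual,
  which act on scalar functions only, get applied to \<open>f\<close>.
\<close>

lemma Hinf_compose_functional:
  fixes \<phi> :: "'f::complex_normed_vector \<Rightarrow> complex"
  assumes f: "f \<in> carr (Hinf U)" and \<phi>: "linear_on UNIV \<phi>" "\<And>x. cmod (\<phi> x) \<le> norm x"
  shows "(\<lambda>x. \<phi> (f x)) \<in> carr (Hinf U)" "nrm (Hinf U) (\<lambda>x. \<phi> (f x)) \<le> nrm (Hinf U) f"
proof -
  have le: "cmod (\<phi> (f x)) \<le> nrm (Hinf U) f" for x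
    using \<phi>(2)[of "f x"] Hinf_norm_bound[OF f, of x] by linarith
  have "bounded_linear \<phi>"
    using \<phi> by (intro bounded_linear_of_linear_on[where K = 1]) auto
  from holomorphic_map_compose_linear[OF Hinf_holomorphic[OF f] \<phi>(1) this]
  show "(\<lambda>x. \<phi> (f x)) \<in> carr (Hinf U)"
    by (rule HinfI[OF _ le]) (simp add: Hinf_outside[OF f] linear_on_zero[OF complex_vector.subspace_UNIV \<phi>(1)])
  show "nrm (Hinf U) (\<lambda>x. \<phi> (f x)) \<le> nrm (Hinf U) f"
    using f by (intro Hinf_norm_le[OF _ le]) (auto simp: Hinf_norm_nonneg)
qed

section \<open>The predual and the linearisation\<close>

lemma point_eval_apply: "f \<in> carr (Hinf U) \<Longrightarrow> point_eval U x f = f x"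
  by (simp add: point_eval_def)

lemma point_eval_dual:
  "point_eval U x \<in> carr (dual (Hinf U))" "nrm (dual (Hinf U)) (point_eval U x) \<le> 1"
proof -
  have le: "cmod (point_eval U x f) \<le> 1 * nrm (Hinf U) f" if "f \<in> carr (Hinf U)" for f
    using Hinf_norm_bound[OF that] that by (simp add: point_eval_apply)
  show "point_eval U x \<in> carr (dual (Hinf U))"
  proof (rule bounded_operatorsI[OF _ le])
    show "linear_on (carr (Hinf U)) (point_eval U x)"
      unfolding linear_on_def
      by (intro conjI ballI allI)
         (simp_all add: point_eval_apply carr_add[OF normed_space_Hinf] carr_scaleC[OF normed_space_Hinf])
  qed (simp_all add: point_eval_def)
  show "nrm (dual (Hinf U)) (point_eval U x) \<le> 1"
    by (intro operator_norm_le[OF normed_space_Hinf _ le]) auto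
qed

lemma normed_space_dual_Hinf:
  "normed_space (dual (Hinf U :: ('e::complex_normed_vector \<Rightarrow> complex) cnspace))"
  by (rule normed_space_bounded_operators[OF normed_space_Hinf])

lemma point_evals_subset: "point_eval U ` U \<subseteq> carr (dual (Hinf U))"
  by (auto simp: point_eval_dual)

lemmas normed_space_Ginf =
  normed_space_closed_span[OF normed_space_dual_Hinf point_evals_subset, folded Ginf_def]
lemmas Ginf_subset = closed_span_subset[OF normed_space_dual_Hinf point_evals_subset, folded Ginf_def]
lemmas nrm_Ginf = nrm_closed_span[OF normed_space_dual_Hinf point_evals_subset, folded Ginf_def]
lemmas Ginf_closed = closed_span_closed[OF normed_space_dual_Hinf point_evals_subset, folded Ginf_def]

lemma point_eval_Ginf: "x \<in> U \<Longrightarrow> point_eval U x \<in> carr (Ginf U)"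
  using closed_span_superset[OF normed_space_dual_Hinf point_evals_subset] by (auto simp: Ginf_def)

text \<open>
  The kernel of the difference is a closed subspace that contains the generators of the predual.
\<close>

lemma operators_on_Ginf_eqI:
  fixes S T :: "_ \<Rightarrow> 'f::complex_normed_vector"
  assumes S: "S \<in> carr (bounded_operators (Ginf U))" and T: "T \<in> carr (bounded_operators (Ginf U))"
    and eq: "\<And>x. x \<in> U \<Longrightarrow> S (point_eval U x) = T (point_eval U x)"
  shows "S = T"
proof -
  let ?B = "bounded_operators (Ginf U) :: (_ \<Rightarrow> 'f) cnspace"
  define R where "R = S - T"
  have R: "R \<in> carr ?B"
    unfolding R_def by (rule carr_diff[OF normed_space_bounded_operators[OF normed_space_Ginf] S T])
  note sub = normed_space_subspace[OF normed_space_Ginf] and lin = operator_linear[OF R]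
  let ?V = "{\<xi> \<in> carr (Ginf U). R \<xi> = 0}"
  have "carr (Ginf U) \<subseteq> ?V"
    unfolding Ginf_def
  proof (rule closed_span_minimal; fold Ginf_def)
    show "point_eval U ` U \<subseteq> ?V"
      using eq point_eval_Ginf by (auto simp: R_def)
    show "complex_vector.subspace ?V"
      using carr_add[OF normed_space_Ginf] carr_scaleC[OF normed_space_Ginf] carr_zero[OF normed_space_Ginf]
        linear_on_zero[OF sub lin]
      by (intro complex_vector.subspaceI)
         (auto simp: linear_on_add[OF lin] linear_on_scaleC[OF lin] complex_vector.scale_zero_right)
  next
    fix \<xi> assume \<xi>: "\<xi> \<in> carr (dual (Hinf U))" and lim: "\<And>e. 0 < e \<Longrightarrow> \<exists>v\<in>?V. nrm (dual (Hinf U)) (\<xi> - v) < e"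
    have \<xi>G: "\<xi> \<in> carr (Ginf U)"
      using lim by (intro Ginf_closed[OF \<xi>]) blast
    have "norm (R \<xi>) \<le> nrm ?B R * e" if "0 < e" for e
    proof -
      obtain v where v: "v \<in> carr (Ginf U)" "R v = 0" "nrm (dual (Hinf U)) (\<xi> - v) < e"
        using lim[OF \<open>0 < e\<close>] by blast
      have "norm (R (\<xi> - v)) \<le> nrm ?B R * nrm (Ginf U) (\<xi> - v)"
        by (rule operator_norm_bound[OF normed_space_Ginf R carr_diff[OF normed_space_Ginf \<xi>G v(1)]])
      also have "\<dots> \<le> nrm ?B R * e"
        using v by (intro mult_left_mono operator_norm_nonneg[OF normed_space_Ginf R]) (auto simp: nrm_Ginf)
      also have "R (\<xi> - v) = R \<xi>"
        by (simp add: linear_on_diff[OF sub lin \<xi>G v(1)] v(2))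
      finally show ?thesis .
    qed
    note le = this
    have "norm (R \<xi>) \<le> 0 + e" if "0 < e" for e
    proof -
      have N: "0 \<le> nrm ?B R"
        by (rule operator_norm_nonneg[OF normed_space_Ginf R])
      have "norm (R \<xi>) \<le> nrm ?B R * (e / (nrm ?B R + 1))"
        using that N by (intro le) auto
      also have "\<dots> \<le> e"
        using that N by (simp add: pos_divide_le_eq algebra_simps)
      finally show ?thesis
        by simp
    qed
    then have "norm (R \<xi>) \<le> 0"
      by (rule field_le_epsilon)
    then show "\<xi> \<in> ?V"
      using \<xi>G by simp
  qed
  then have "R \<xi> = 0" for \<xi>
    using operator_outside[OF R, of \<xi>] by blast
  then show ?thesis
    by (simp add: R_def fun_eq_iff)
qed

text \<open>
  A weak description of the value of the linearisation of \<open>f\<close> at the functional \<open>\<xi>\<close>: the vector \<open>y\<close> such that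
  \<open>\<phi> y = \<xi> (\<phi> \<circ> f)\<close> for all contractive functionals \<open>\<phi>\<close>. It makes sense for every \<open>\<xi>\<close> in the dual of the
  space of bounded holomorphic functions, so no choice of approximations by linear combinations of
  evaluations enters, and linearity is immediate.
\<close>

definition represents :: "'e::complex_normed_vector set \<Rightarrow> ('e \<Rightarrow> 'f::complex_normed_vector) \<Rightarrow>
    (('e \<Rightarrow> complex) \<Rightarrow> complex) \<Rightarrow> 'f \<Rightarrow> bool" where
  "represents U f \<xi> y \<longleftrightarrow>
     (\<forall>\<phi>. linear_on UNIV \<phi> \<longrightarrow> (\<forall>z. cmod (\<phi> z) \<le> norm z) \<longrightarrow> \<phi> y = \<xi> (\<lambda>x. \<phi> (f x)))"

text \<open>
  Testing against a functional that norms \<open>y\<close> gives the bound from which both uniqueness of \<open>y\<close> and the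
  norm estimate for the linearisation follow.
\<close>

lemma represents_norm_le:
  assumes f: "f \<in> carr (Hinf U)" and \<xi>: "\<xi> \<in> carr (dual (Hinf U))" and y: "represents U f \<xi> y"
  shows "norm y \<le> nrm (Hinf U) f * nrm (dual (Hinf U)) \<xi>"
proof -
  obtain \<phi> where \<phi>: "linear_on UNIV \<phi>" "\<And>z. cmod (\<phi> z) \<le> norm z" "cmod (\<phi> y) = norm y"
    using norming_functional by blast
  have "norm y = cmod (\<xi> (\<lambda>x. \<phi> (f x)))"
    using y \<phi> by (simp add: represents_def)
  also have "\<dots> \<le> nrm (dual (Hinf U)) \<xi> * nrm (Hinf U) (\<lambda>x. \<phi> (f x))"
    by (rule operator_norm_bound[OF normed_space_Hinf \<xi> Hinf_compose_functional(1)[OF f \<phi>(1,2)]])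
  also have "\<dots> \<le> nrm (dual (Hinf U)) \<xi> * nrm (Hinf U) f"
    by (rule mult_left_mono[OF Hinf_compose_functional(2)[OF f \<phi>(1,2)] operator_norm_nonneg[OF normed_space_Hinf \<xi>]])
  finally show ?thesis
    by (simp add: mult.commute)
qed

lemma represents_add: "represents U f \<xi> y \<Longrightarrow> represents U f \<mu> z \<Longrightarrow> represents U f (\<xi> + \<mu>) (y + z)"
  by (simp add: represents_def linear_on_def)

lemma represents_scaleC: "represents U f \<xi> y \<Longrightarrow> represents U f (c *\<^sub>C \<xi>) (c *\<^sub>C y)"
  by (simp add: represents_def linear_on_def)

lemma represents_diff:
  assumes "represents U f \<xi> y" "represents U f \<mu> z"
  shows "represents U f (\<xi> - \<mu>) (y - z)"
  using represents_add[OF assms(1) represents_scaleC[OF assms(2), of "- 1"]]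
  by (simp add: complex_vector.scale_minus_left scaleC_one)

lemma represents_unique:
  assumes "f \<in> carr (Hinf U)" "represents U f \<xi> y" "represents U f \<xi> z"
  shows "y = z"
  using represents_norm_le[OF assms(1) carr_zero[OF normed_space_dual_Hinf], of "y - z"]
    represents_diff[OF assms(2,3)] by (simp add: nrm_zero[OF normed_space_dual_Hinf])

text \<open>
  The functionals \<open>\<xi>\<close> that have a representing vector form a subspace. It contains the evaluation at \<open>x\<close>,
  represented by \<open>f x\<close>. It is closed: if \<open>v n\<close> tends to \<open>\<mu>\<close>, the vectors \<open>y n\<close> representing them form a
  Cauchy sequence by the norm bound, and their limit represents \<open>\<mu>\<close>.
\<close>

lemma represents_exists:
  fixes f :: "'e::complex_normed_vector \<Rightarrow> 'f::complex_banach"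
  assumes f: "f \<in> carr (Hinf U)" and \<xi>: "\<xi> \<in> carr (Ginf U)"
  shows "\<exists>y. represents U f \<xi> y"
proof -
  let ?D = "dual (Hinf U) :: (('e \<Rightarrow> complex) \<Rightarrow> complex) cnspace"
  note D = normed_space_dual_Hinf[where U = U]
  let ?V = "{\<xi> \<in> carr ?D. \<exists>y. represents U f \<xi> y}"
  have "carr (Ginf U) \<subseteq> ?V"
    unfolding Ginf_def
  proof (rule closed_span_minimal)
    show "point_eval U ` U \<subseteq> ?V"
    proof (safe intro!: point_eval_dual)
      fix x
      show "\<exists>y. represents U f (point_eval U x) y"
        using Hinf_compose_functional(1)[OF f] by (auto simp: represents_def point_eval_apply)
    qed
    show "complex_vector.subspace ?V"
    proof (rule complex_vector.subspaceI)
      have "represents U f 0 0"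
        using linear_on_zero[OF complex_vector.subspace_UNIV] by (auto simp: represents_def)
      then show "0 \<in> ?V"
        using carr_zero[OF D] by auto
    qed (use represents_add represents_scaleC carr_add[OF D] carr_scaleC[OF D] in blast)+
  next
    fix \<mu> assume \<mu>: "\<mu> \<in> carr ?D" and lim: "\<And>e. 0 < e \<Longrightarrow> \<exists>v\<in>?V. nrm ?D (\<mu> - v) < e"
    have "\<exists>v y. v \<in> carr ?D \<and> represents U f v y \<and> nrm ?D (\<mu> - v) < 1 / Suc n" for n
      using lim[of "1 / Suc n"] by auto
    then obtain v y where v: "\<And>n. v n \<in> carr ?D" and y: "\<And>n. represents U f (v n) (y n)"
      and close: "\<And>n. nrm ?D (\<mu> - v n) < 1 / Suc n"
      by metis
    have v_lim: "(\<lambda>n. nrm ?D (\<mu> - v n)) \<longlonglongrightarrow> 0"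
      by (rule tendsto_sandwich[OF _ _ tendsto_const LIMSEQ_inverse_real_of_nat])
         (auto intro!: always_eventually less_imp_le[OF close, simplified] nrm_nonneg[OF D] carr_diff[OF D] \<mu> v
           simp: inverse_eq_divide)
    have "Cauchy y"
    proof (rule CauchyI)
      fix e :: real assume e: "0 < e"
      define K where "K = nrm (Hinf U) f + 1"
      have K: "0 < K" "nrm (Hinf U) f \<le> K"
        using Hinf_norm_nonneg[OF f] by (simp_all add: K_def)
      have ek: "0 < e / (2 * K)"
        using e K by simp
      obtain N where "\<forall>n\<ge>N. norm (nrm ?D (\<mu> - v n) - 0) < e / (2 * K)"
        using LIMSEQ_D[OF v_lim ek] by blast
      then have N: "nrm ?D (\<mu> - v n) < e / (2 * K)" if "n \<ge> N" for n
        using that by (auto simp: abs_less_iff)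
      have "norm (y m - y n) < e" if mn: "m \<ge> N" "n \<ge> N" for m n
      proof -
        have "norm (y m - y n) \<le> nrm (Hinf U) f * nrm ?D (v m - v n)"
          by (rule represents_norm_le[OF f carr_diff[OF D v v] represents_diff[OF y y]])
        also have "\<dots> \<le> K * nrm ?D (v m - v n)"
          by (intro mult_right_mono nrm_nonneg[OF D carr_diff[OF D v v]] K)
        also have "nrm ?D (v m - v n) \<le> nrm ?D (\<mu> - v m) + nrm ?D (\<mu> - v n)"
          using nrm_triangle_diff[OF D v \<mu> v, of m n] nrm_minus_commute[OF D v \<mu>, of m] by simp
        also have "\<dots> < e / (2 * K) + e / (2 * K)"
          by (intro add_strict_mono N mn)
        also have "K * (e / (2 * K) + e / (2 * K)) = e"
          using K by (simp add: field_simps)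
        finally show ?thesis
          using K by simp
      qed
      then show "\<exists>M. \<forall>m\<ge>M. \<forall>n\<ge>M. norm (y m - y n) < e"
        by blast
    qed
    then obtain z where z: "y \<longlonglongrightarrow> z"
      by (auto simp: Cauchy_convergent_iff convergent_def)
    have "represents U f \<mu> z"
      unfolding represents_def
    proof (intro allI impI)
      fix \<phi> :: "'f \<Rightarrow> complex" assume \<phi>: "linear_on UNIV \<phi>" "\<forall>z. cmod (\<phi> z) \<le> norm z"
      let ?g = "\<lambda>x. \<phi> (f x)"
      have g: "?g \<in> carr (Hinf U)"
        using \<phi> by (intro Hinf_compose_functional(1)[OF f]) auto
      have "bounded_linear \<phi>"
        using \<phi> by (intro bounded_linear_of_linear_on[where K = 1]) auto
      from bounded_linear.tendsto[OF this z] have "(\<lambda>n. v n ?g) \<longlonglongrightarrow> \<phi> z"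
        using y \<phi> by (simp add: represents_def)
      moreover have "(\<lambda>n. \<mu> ?g - v n ?g) \<longlonglongrightarrow> 0"
      proof (rule Lim_null_comparison[OF always_eventually])
        show "\<forall>n. norm (\<mu> ?g - v n ?g) \<le> nrm ?D (\<mu> - v n) * nrm (Hinf U) ?g"
          using operator_norm_bound[OF normed_space_Hinf carr_diff[OF D \<mu> v] g] by simp
        show "(\<lambda>n. nrm ?D (\<mu> - v n) * nrm (Hinf U) ?g) \<longlonglongrightarrow> 0"
          by (rule tendsto_mult_left_zero[OF v_lim])
      qed
      then have "(\<lambda>n. v n ?g) \<longlonglongrightarrow> \<mu> ?g"
        using tendsto_diff[OF tendsto_const[of "\<mu> ?g"]] by fastforce
      ultimately show "\<phi> z = \<mu> ?g"
        using LIMSEQ_unique by blast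
    qed
    then show "\<mu> \<in> ?V"
      using \<mu> by blast
  qed
  then show ?thesis
    using \<xi> by blast
qed

lemma linearisation_exists:
  fixes f :: "'e::complex_normed_vector \<Rightarrow> 'f::complex_banach"
  assumes f: "f \<in> carr (Hinf U)"
  obtains T where "T \<in> carr (bounded_operators (Ginf U))" "\<And>x. x \<in> U \<Longrightarrow> T (point_eval U x) = f x"
    "nrm (bounded_operators (Ginf U)) T \<le> nrm (Hinf U) f"
proof -
  obtain t where t: "\<And>\<xi>. \<xi> \<in> carr (Ginf U) \<Longrightarrow> represents U f \<xi> (t \<xi>)"
    using represents_exists[OF f] by metis
  define T where "T \<xi> = (if \<xi> \<in> carr (Ginf U) then t \<xi> else 0)" for \<xi>
  note G = normed_space_Ginf[where U = U]
  have T: "T \<xi> = y" if "\<xi> \<in> carr (Ginf U)" "represents U f \<xi> y" for \<xi> y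
    using represents_unique[OF f t[OF that(1)] that(2)] that(1) by (simp add: T_def)
  have rep: "represents U f \<xi> (T \<xi>)" if "\<xi> \<in> carr (Ginf U)" for \<xi>
    using t[OF that] that by (simp add: T_def)
  have le: "norm (T \<xi>) \<le> nrm (Hinf U) f * nrm (Ginf U) \<xi>" if "\<xi> \<in> carr (Ginf U)" for \<xi>
    using represents_norm_le[OF f subsetD[OF Ginf_subset that] rep[OF that]] by (simp add: nrm_Ginf)
  have "linear_on (carr (Ginf U)) T"
    unfolding linear_on_def
    by (intro conjI ballI allI T carr_add[OF G] carr_scaleC[OF G] represents_add represents_scaleC rep)
  then have "T \<in> carr (bounded_operators (Ginf U))"
    by (rule bounded_operatorsI[OF _ le]) (simp_all add: T_def)
  moreover have "T (point_eval U x) = f x" if "x \<in> U" for x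
    using Hinf_compose_functional(1)[OF f]
    by (intro T[OF point_eval_Ginf[OF that]]) (auto simp: represents_def point_eval_apply)
  ultimately show thesis
    using that operator_norm_le[OF G Hinf_norm_nonneg[OF f] le] by blast
qed

lemma linearisation_eqI:
  assumes "T \<in> carr (bounded_operators (Ginf U))" "\<And>x. x \<in> U \<Longrightarrow> T (point_eval U x) = f x"
  shows "linearisation U f = T"
  unfolding linearisation_def using assms by (intro the_equality operators_on_Ginf_eqI) auto

lemma
  fixes f :: "'e::complex_normed_vector \<Rightarrow> 'f::complex_banach"
  assumes f: "f \<in> carr (Hinf U)"
  shows linearisation_bounded: "linearisation U f \<in> carr (bounded_operators (Ginf U))"
    and linearisation_point_eval: "x \<in> U \<Longrightarrow> linearisation U f (point_eval U x) = f x"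
    and nrm_linearisation: "nrm (bounded_operators (Ginf U)) (linearisation U f) = nrm (Hinf U) f"
proof -
  let ?B = "bounded_operators (Ginf U) :: (_ \<Rightarrow> 'f) cnspace"
  obtain T where T: "T \<in> carr ?B" "\<And>x. x \<in> U \<Longrightarrow> T (point_eval U x) = f x" "nrm ?B T \<le> nrm (Hinf U) f"
    using linearisation_exists[OF f] by blast
  have lin: "linearisation U f = T"
    using T by (intro linearisation_eqI)
  show "linearisation U f \<in> carr ?B" "x \<in> U \<Longrightarrow> linearisation U f (point_eval U x) = f x"
    using T by (auto simp: lin)
  have "nrm (Hinf U) f \<le> nrm ?B T"
  proof (rule Hinf_norm_le[OF operator_norm_nonneg[OF normed_space_Ginf T(1)]])
    fix x assume x: "x \<in> U"
    have "norm (f x) \<le> nrm ?B T * nrm (Ginf U) (point_eval U x)"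
      using operator_norm_bound[OF normed_space_Ginf T(1) point_eval_Ginf[OF x]] T(2)[OF x] by simp
    also have "\<dots> \<le> nrm ?B T * 1"
      by (intro mult_left_mono operator_norm_nonneg[OF normed_space_Ginf T(1)]) (auto simp: nrm_Ginf point_eval_dual)
    finally show "norm (f x) \<le> nrm ?B T"
      by simp
  qed
  then show "nrm ?B (linearisation U f) = nrm (Hinf U) f"
    using T(3) by (simp add: lin)
qed

section \<open>Holomorphy of the evaluation map\<close>

lemma holomorphic_map_frechet:
  assumes "holomorphic_map U f" "x \<in> U"
  shows "(f has_derivative frechet_derivative f (at x)) (at x)"
    and "linear_on UNIV (frechet_derivative f (at x))"
  using assms frechet_derivative_at by (fastforce simp: holomorphic_map_def)+

text \<open>
  Cauchy's inequality on circles of radius \<open>r / 2\<close> about points of the ball of radius \<open>r / 4\<close> bounds the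
  second derivative by \<open>8 * B / r\<^sup>2\<close>.
\<close>

lemma second_order_Taylor:
  fixes \<phi> :: "complex \<Rightarrow> complex"
  assumes hol: "\<phi> holomorphic_on ball 0 r" and r: "0 < r"
    and B: "\<And>z. z \<in> ball 0 r \<Longrightarrow> cmod (\<phi> z) \<le> B" and z: "cmod z \<le> r / 4"
  shows "cmod (\<phi> z - \<phi> 0 - deriv \<phi> 0 * z) \<le> 8 * B / r\<^sup>2 * (cmod z)\<^sup>2"
proof -
  let ?S = "cball (0::complex) (r / 4)"
  have S: "?S \<subseteq> ball 0 r"
    using r by auto
  have "cmod (((deriv ^^ 0) \<phi>) z - (\<Sum>i\<le>1. ((deriv ^^ i) \<phi>) 0 * (z - 0) ^ i / fact i))
      \<le> 8 * B / r\<^sup>2 * cmod (z - 0) ^ Suc 1 / fact 1"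
  proof (rule complex_Taylor[where S = ?S])
    fix i w assume "w \<in> ?S"
    then have w: "w \<in> ball 0 r"
      using S by blast
    show "((deriv ^^ i) \<phi> has_field_derivative (deriv ^^ Suc i) \<phi> w) (at w within ?S)"
      using holomorphic_derivI[OF holomorphic_higher_deriv[OF hol open_ball] open_ball w] by simp
  next
    fix w assume w: "w \<in> ?S"
    have sub: "cball w (r / 2) \<subseteq> ball 0 r"
      using w r by (auto simp: cball_subset_ball_iff)
    have "cmod ((deriv ^^ 2) \<phi> w) \<le> fact 2 * B / (r / 2) ^ 2"
    proof (rule Cauchy_inequality)
      show "\<phi> holomorphic_on ball w (r / 2)" "continuous_on (cball w (r / 2)) \<phi>"
        using sub ball_subset_cball holomorphic_on_subset[OF hol] holomorphic_on_imp_continuous_on by blast+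
      show "cmod (\<phi> v) \<le> B" if "cmod (w - v) = r / 2" for v
        using that sub by (intro B) (auto simp: subset_iff dist_norm)
    qed (use r in auto)
    also have "\<dots> = 8 * B / r\<^sup>2"
      by (simp add: power_divide)
    finally show "cmod ((deriv ^^ Suc 1) \<phi> w) \<le> 8 * B / r\<^sup>2"
      by (simp add: numeral_2_eq_2)
  qed (use z r in auto)
  then show ?thesis
    by (simp add: algebra_simps power2_eq_square)
qed

text \<open>
  Restriction to the complex line through \<open>x\<close> in the direction of \<open>h\<close> reduces the estimate to one variable.
  The point is that the error is quadratic in \<open>h\<close> with a constant that depends on \<open>g\<close> only through its
  supremum norm.
\<close>

lemma Hinf_Taylor:
  fixes U :: "'e::complex_normed_vector set"
  assumes g: "g \<in> carr (Hinf U)" and r: "0 < r" and U: "ball x r \<subseteq> U" and h: "norm h \<le> r / 4"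
  shows "cmod (g (x + h) - g x - frechet_derivative g (at x) h) \<le> 8 / r\<^sup>2 * nrm (Hinf U) g * (norm h)\<^sup>2"
proof (cases "h = 0")
  case True
  have "frechet_derivative g (at x) 0 = 0"
    using r U by (intro linear_on_zero[OF complex_vector.subspace_UNIV] holomorphic_map_frechet[OF Hinf_holomorphic[OF g]]) auto
  then show ?thesis
    using True by simp
next
  case False
  define u where "u = (1 / norm h) *\<^sub>R h"
  have u: "norm u = 1" and h_eq: "h = complex_of_real (norm h) *\<^sub>C u"
    using False by (simp_all add: u_def flip: scaleR_eq_scaleC)
  define \<phi> where "\<phi> z = g (x + z *\<^sub>C u)" for z
  have der: "(\<phi> has_field_derivative frechet_derivative g (at (x + z *\<^sub>C u)) u) (at z)"
    if z: "z \<in> ball 0 r" for z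
  proof -
    let ?y = "x + z *\<^sub>C u"
    have "?y \<in> ball x r"
      using z u by (simp add: dist_norm norm_scaleC)
    then have y: "?y \<in> U"
      using U by blast
    have "bounded_linear (\<lambda>w. w *\<^sub>C u)"
      by (rule bounded_linear_of_linear_on[where K = "norm u"])
         (auto simp: linear_on_def scaleC_add_left scaleC_complex_def scaleC_scaleC norm_scaleC)
    then have "((\<lambda>w. x + w *\<^sub>C u) has_derivative (\<lambda>w. w *\<^sub>C u)) (at z)"
      by (auto intro!: derivative_eq_intros bounded_linear_imp_has_derivative)
    from has_derivative_compose[OF this holomorphic_map_frechet(1)[OF Hinf_holomorphic[OF g] y]]
    have "(\<phi> has_derivative (\<lambda>w. frechet_derivative g (at ?y) (w *\<^sub>C u))) (at z)"
      by (simp add: \<phi>_def[abs_def])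
    moreover have "(\<lambda>w. frechet_derivative g (at ?y) (w *\<^sub>C u)) = (*) (frechet_derivative g (at ?y) u)"
      using linear_on_scaleC[OF holomorphic_map_frechet(2)[OF Hinf_holomorphic[OF g] y]]
      by (auto simp: scaleC_complex_def)
    ultimately show ?thesis
      by (simp add: has_field_derivative_def)
  qed
  then have "\<phi> holomorphic_on ball 0 r"
    unfolding holomorphic_on_open[OF open_ball] by blast
  then have "cmod (\<phi> (norm h) - \<phi> 0 - deriv \<phi> 0 * norm h)
      \<le> 8 * nrm (Hinf U) g / r\<^sup>2 * (cmod (complex_of_real (norm h)))\<^sup>2"
    by (rule second_order_Taylor[OF _ r]) (use r h Hinf_norm_bound[OF g] in \<open>simp_all add: \<phi>_def\<close>)
  moreover have "\<phi> (norm h) = g (x + h)" "\<phi> 0 = g x"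
    using h_eq by (simp_all add: \<phi>_def complex_vector.scale_zero_left)
  moreover have "deriv \<phi> 0 * norm h = frechet_derivative g (at x) h"
  proof -
    have x: "x \<in> U"
      using U r by auto
    have "deriv \<phi> 0 = frechet_derivative g (at x) u"
      using der[of 0] r by (simp add: DERIV_imp_deriv complex_vector.scale_zero_left)
    then show ?thesis
      using linear_on_scaleC[OF holomorphic_map_frechet(2)[OF Hinf_holomorphic[OF g] x], of u "norm h"]
      by (simp add: h_eq[symmetric] scaleC_complex_def)
  qed
  ultimately show ?thesis
    by simp
qed

text \<open>
  The derivative of the map \<open>x \<mapsto> point_eval U x\<close> at \<open>x\<close> in the direction \<open>h\<close>.
\<close>

definition directional_eval :: "'e::complex_normed_vector set \<Rightarrow> 'e \<Rightarrow> 'e \<Rightarrow> ('e \<Rightarrow> complex) \<Rightarrow> complex" where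
  "directional_eval U x h = (\<lambda>g. if g \<in> carr (Hinf U) then frechet_derivative g (at x) h else 0)"

lemma directional_eval_linear:
  assumes "x \<in> U"
  shows "linear_on UNIV (directional_eval U x)"
  unfolding linear_on_def
proof (intro conjI ballI allI; rule ext)
  fix h k g
  show "directional_eval U x (h + k) g = (directional_eval U x h + directional_eval U x k) g"
    using linear_on_add[OF holomorphic_map_frechet(2)[OF Hinf_holomorphic[of g] assms], of h k]
    by (simp add: directional_eval_def)
next
  fix c h g
  show "directional_eval U x (c *\<^sub>C h) g = (c *\<^sub>C directional_eval U x h) g"
    using linear_on_scaleC[OF holomorphic_map_frechet(2)[OF Hinf_holomorphic[of g] assms], of h c]
    by (simp add: directional_eval_def scaleC_complex_def)
qed

text \<open>
  The bound comes from the Taylor estimate at the multiple \<open>k\<close> of \<open>h\<close> of norm \<open>r / 4\<close>: there the derivative is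
  at most \<open>5 / 2\<close> times the norm of \<open>g\<close>, and dividing by \<open>r / 4\<close> gives \<open>10 / r\<close>.
\<close>

lemma directional_eval_dual:
  fixes U :: "'e::complex_normed_vector set"
  assumes r: "0 < r" and U: "ball x r \<subseteq> U"
  shows "directional_eval U x h \<in> carr (dual (Hinf U))"
    "nrm (dual (Hinf U)) (directional_eval U x h) \<le> 10 / r * norm h"
proof -
  have x: "x \<in> U"
    using r U by auto
  have le: "cmod (directional_eval U x h g) \<le> 10 / r * norm h * nrm (Hinf U) g"
    if g: "g \<in> carr (Hinf U)" for g
  proof (cases "h = 0")
    case True
    have "frechet_derivative g (at x) 0 = 0"
      by (intro linear_on_zero[OF complex_vector.subspace_UNIV] holomorphic_map_frechet[OF Hinf_holomorphic[OF g] x])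
    then show ?thesis
      using True by (simp add: directional_eval_def)
  next
    case False
    define k where "k = complex_of_real (r / 4 / norm h) *\<^sub>C h"
    let ?D = "frechet_derivative g (at x)" and ?M = "nrm (Hinf U) g"
    have k: "norm k = r / 4"
      using False r by (simp add: k_def norm_scaleC norm_divide)
    have "cmod (?D k) \<le> cmod (g (x + k)) + cmod (g x) + cmod (g (x + k) - g x - ?D k)"
      using norm_triangle_ineq4[of "g (x + k) - g x" "g (x + k) - g x - ?D k"]
        norm_triangle_ineq4[of "g (x + k)" "g x"] by simp
    also have "\<dots> \<le> ?M + ?M + 8 / r\<^sup>2 * ?M * (r / 4)\<^sup>2"
      using Hinf_Taylor[OF g r U, of k] k by (intro add_mono Hinf_norm_bound[OF g]) simp
    also have "\<dots> = 5 / 2 * ?M"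
      using r by (simp add: power2_eq_square field_simps)
    also have "?D k = complex_of_real (r / 4 / norm h) * ?D h"
      using linear_on_scaleC[OF holomorphic_map_frechet(2)[OF Hinf_holomorphic[OF g] x], of h]
      by (simp add: k_def scaleC_complex_def)
    finally have "r / 4 / norm h * cmod (?D h) \<le> 5 / 2 * ?M"
      using r by (simp add: norm_mult norm_divide)
    then show ?thesis
      using r False g by (simp add: directional_eval_def field_simps)
  qed
  have "linear_on (carr (Hinf U)) (directional_eval U x h)"
    unfolding linear_on_def
  proof (intro conjI ballI allI)
    fix f g :: "'e \<Rightarrow> complex" assume fg: "f \<in> carr (Hinf U)" "g \<in> carr (Hinf U)"
    have "(f + g has_derivative (\<lambda>h. frechet_derivative f (at x) h + frechet_derivative g (at x) h)) (at x)"
      unfolding plus_fun_def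
      by (intro has_derivative_add holomorphic_map_frechet(1)[OF Hinf_holomorphic x] fg)
    then show "directional_eval U x h (f + g) = directional_eval U x h f + directional_eval U x h g"
      using fg carr_add[OF normed_space_Hinf fg] by (simp add: directional_eval_def frechet_derivative_at[symmetric])
  next
    fix c and g :: "'e \<Rightarrow> complex" assume g: "g \<in> carr (Hinf U)"
    have "(c *\<^sub>C g has_derivative (\<lambda>h. c *\<^sub>C frechet_derivative g (at x) h)) (at x)"
      unfolding scaleC_fun_def
      by (intro bounded_linear.has_derivative[OF bounded_linear_scaleC] holomorphic_map_frechet(1)[OF Hinf_holomorphic x] g)
    then show "directional_eval U x h (c *\<^sub>C g) = c *\<^sub>C directional_eval U x h g"
      using g carr_scaleC[OF normed_space_Hinf g, of c] by (simp add: directional_eval_def frechet_derivative_at[symmetric])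
  qed
  then show "directional_eval U x h \<in> carr (dual (Hinf U))"
    by (rule bounded_operatorsI[OF _ le]) (simp_all add: directional_eval_def)
  show "nrm (dual (Hinf U)) (directional_eval U x h) \<le> 10 / r * norm h"
    using r by (intro operator_norm_le[OF normed_space_Hinf _ le]) auto
qed

text \<open>
  Since the Taylor estimate is uniform over the unit ball of the space of bounded holomorphic functions, it
  is an estimate for the norm of functionals: \<open>x \<mapsto> point_eval U x\<close> is differentiable in norm.
\<close>

lemma point_eval_Taylor:
  fixes U :: "'e::complex_normed_vector set"
  assumes r: "0 < r" and U: "ball x r \<subseteq> U" and h: "norm h \<le> r / 4"
  shows "nrm (dual (Hinf U)) (point_eval U (x + h) - point_eval U x - directional_eval U x h) \<le> 8 / r\<^sup>2 * (norm h)\<^sup>2"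
proof (rule operator_norm_le[OF normed_space_Hinf])
  fix g :: "'e \<Rightarrow> complex" assume g: "g \<in> carr (Hinf U)"
  show "cmod ((point_eval U (x + h) - point_eval U x - directional_eval U x h) g)
      \<le> 8 / r\<^sup>2 * (norm h)\<^sup>2 * nrm (Hinf U) g"
    using Hinf_Taylor[OF g r U h] g by (simp add: point_eval_def directional_eval_def mult.commute mult.left_commute)
qed (use r in auto)

text \<open>
  The derivative stays in the predual, being a norm limit of difference quotients of evaluations.
\<close>

lemma directional_eval_Ginf:
  fixes U :: "'e::complex_normed_vector set"
  assumes r: "0 < r" and U: "ball x r \<subseteq> U"
  shows "directional_eval U x h \<in> carr (Ginf U)"
proof (rule Ginf_closed[OF directional_eval_dual(1)[OF r U]])
  let ?D = "dual (Hinf U :: ('e \<Rightarrow> complex) cnspace)"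
  fix e :: real assume e: "0 < e"
  have x: "x \<in> U"
    using r U by auto
  have lim: "((\<lambda>t. t * norm h) \<longlongrightarrow> 0) (at_right 0)" "((\<lambda>t. 8 / r\<^sup>2 * (norm h)\<^sup>2 * t) \<longlongrightarrow> 0) (at_right 0)"
    using r by (auto intro!: tendsto_eq_intros)
  have "\<forall>\<^sub>F t in at_right (0::real). 0 < t \<and> t * norm h < r / 4 \<and> 8 / r\<^sup>2 * (norm h)\<^sup>2 * t < e"
    using r e by (intro eventually_conj order_tendstoD(2)[OF lim(1)] order_tendstoD(2)[OF lim(2)] eventually_at_right_less) auto
  then obtain t where t: "0 < t" "t * norm h < r / 4" "8 / r\<^sup>2 * (norm h)\<^sup>2 * t < e"
    using eventually_happens'[OF trivial_limit_at_right_real] by blast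
  let ?k = "complex_of_real t *\<^sub>C h"
  let ?q = "point_eval U (x + ?k) - point_eval U x"
  have k: "norm ?k = t * norm h"
    using t by (simp add: norm_scaleC)
  have "x + ?k \<in> ball x r"
    using k t r by (simp add: dist_norm)
  then have xk: "x + ?k \<in> U"
    using U by blast
  have q: "?q \<in> carr (Ginf U)"
    by (rule carr_diff[OF normed_space_Ginf point_eval_Ginf[OF xk] point_eval_Ginf[OF x]])
  have D: "normed_space ?D"
    by (rule normed_space_dual_Hinf)
  have rem: "?q - directional_eval U x ?k \<in> carr ?D"
    by (intro carr_diff[OF D] directional_eval_dual(1)[OF r U] point_eval_dual(1))
  have k_eq: "directional_eval U x ?k = complex_of_real t *\<^sub>C directional_eval U x h"
    using linear_on_scaleC[OF directional_eval_linear[OF x]] by simp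
  have "directional_eval U x h - complex_of_real (1 / t) *\<^sub>C ?q = complex_of_real (- 1 / t) *\<^sub>C (?q - directional_eval U x ?k)"
    using t by (simp add: k_eq fun_eq_iff scaleC_complex_def field_simps)
  then have "nrm ?D (directional_eval U x h - complex_of_real (1 / t) *\<^sub>C ?q) = (1 / t) * nrm ?D (?q - directional_eval U x ?k)"
    by (simp only: nrm_scaleC[OF D rem]) (use t in \<open>simp add: norm_divide\<close>)
  also have "\<dots> \<le> (1 / t) * (8 / r\<^sup>2 * (t * norm h)\<^sup>2)"
    using point_eval_Taylor[OF r U, of ?k] t k by (intro mult_left_mono) auto
  also have "\<dots> = 8 / r\<^sup>2 * (norm h)\<^sup>2 * t"
    using t by (simp add: power2_eq_square)
  finally show "\<exists>y\<in>carr (Ginf U). nrm ?D (directional_eval U x h - y) < e"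
    using t carr_scaleC[OF normed_space_Ginf q] by (intro bexI[of _ "complex_of_real (1 / t) *\<^sub>C ?q"]) auto
qed

lemma holomorphic_map_operator_point_eval:
  fixes U :: "'e::complex_normed_vector set" and T :: "_ \<Rightarrow> 'f::complex_normed_vector"
  assumes "open U" and T: "T \<in> carr (bounded_operators (Ginf U))"
  shows "holomorphic_map U (\<lambda>x. if x \<in> U then T (point_eval U x) else 0)" (is "holomorphic_map U ?g")
  unfolding holomorphic_map_def
proof
  fix x assume x: "x \<in> U"
  then obtain r where r: "0 < r" and U: "ball x r \<subseteq> U"
    using \<open>open U\<close> open_contains_ball by blast
  let ?D = "\<lambda>h. T (directional_eval U x h)" and ?M = "nrm (bounded_operators (Ginf U)) T"
  note G = normed_space_Ginf[where U = U] and d = directional_eval_Ginf[OF r U]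
  note bound = operator_norm_bound[OF G T, unfolded nrm_Ginf]
    and M = operator_norm_nonneg[OF G T] and lin = operator_linear[OF T]
  have D: "linear_on UNIV ?D"
    using linear_onD[OF directional_eval_linear[OF x]] linear_onD[OF lin] d by (simp add: linear_on_def)
  have "(?g has_derivative ?D) (at x)"
  proof (rule has_derivativeI_sandwich[where e = "r / 4"])
    show "bounded_linear ?D"
    proof (rule bounded_linear_of_linear_on[OF D])
      fix h
      show "norm (?D h) \<le> (?M * (10 / r)) * norm h"
        using order_trans[OF bound[OF d] mult_left_mono[OF directional_eval_dual(2)[OF r U] M]]
        by (simp add: mult.assoc)
    qed
    show "((\<lambda>y. ?M * (8 / r\<^sup>2) * norm (y - x)) \<longlongrightarrow> 0) (at x)"
      using r by (auto intro!: tendsto_eq_intros)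
    fix y assume y: "y \<noteq> x" "dist y x < r / 4"
    let ?h = "y - x"
    have h: "norm ?h \<le> r / 4"
      using y by (simp add: dist_norm)
    have "y \<in> ball x r"
      using y r by (auto simp: dist_commute)
    then have yU: "y \<in> U"
      using U by blast
    let ?R = "point_eval U y - point_eval U x"
    have R: "?R \<in> carr (Ginf U)"
      by (rule carr_diff[OF G point_eval_Ginf[OF yU] point_eval_Ginf[OF x]])
    have sub: "complex_vector.subspace (carr (Ginf U))"
      by (rule normed_space_subspace[OF G])
    have "?g y - ?g x - ?D ?h = T (?R - directional_eval U x ?h)"
      using linear_on_diff[OF sub lin R d] linear_on_diff[OF sub lin point_eval_Ginf[OF yU] point_eval_Ginf[OF x]] x yU
      by simp
    also have "norm \<dots> \<le> ?M * nrm (dual (Hinf U)) (?R - directional_eval U x ?h)"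
      by (rule bound[OF carr_diff[OF G R d]])
    also have "\<dots> \<le> ?M * (8 / r\<^sup>2 * (norm ?h)\<^sup>2)"
      using point_eval_Taylor[OF r U h] by (intro mult_left_mono M) simp
    finally show "norm (?g y - ?g x - ?D ?h) / norm ?h \<le> ?M * (8 / r\<^sup>2) * norm ?h"
      using y by (simp add: divide_le_eq power2_eq_square mult.assoc)
  qed (use r in auto)
  with D show "\<exists>D. (?g has_derivative D) (at x) \<and> linear_on UNIV D"
    by blast
qed

text \<open>
  Mujica's linearisation theorem. Surjectivity is where holomorphy of the evaluation map enters: an operator
  \<open>T\<close> is the linearisation of \<open>x \<mapsto> T (point_eval U x)\<close>.
\<close>

lemma isometric_isomorphism_linearisation:
  fixes U :: "'e::complex_normed_vector set"
  assumes "open U"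
  shows "isometric_isomorphism (Hinf U) (bounded_operators (Ginf U))
    (linearisation U :: ('e \<Rightarrow> 'f::complex_banach) \<Rightarrow> _)"
proof (rule isometric_isomorphismI[OF normed_space_Hinf])
  let ?H = "Hinf U :: ('e \<Rightarrow> 'f) cnspace"
  let ?B = "bounded_operators (Ginf U) :: (_ \<Rightarrow> 'f) cnspace"
  note B = normed_space_bounded_operators[OF normed_space_Ginf]
  show "linear_on (carr ?H) (linearisation U)"
    unfolding linear_on_def
    by (intro conjI ballI allI linearisation_eqI)
       (simp_all add: carr_add[OF B] carr_scaleC[OF B] linearisation_bounded linearisation_point_eval)
  show "nrm ?B (linearisation U f) = nrm ?H f" if "f \<in> carr ?H" for f
    by (rule nrm_linearisation[OF that])
  show "bij_betw (linearisation U) (carr ?H) (carr ?B)"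
  proof (rule bij_betwI')
    fix f g assume fg: "f \<in> carr ?H" "g \<in> carr ?H"
    show "linearisation U f = linearisation U g \<longleftrightarrow> f = g"
    proof
      assume "linearisation U f = linearisation U g"
      then have "f x = g x" for x
        using linearisation_point_eval[OF fg(1), of x] linearisation_point_eval[OF fg(2), of x]
          Hinf_outside[OF fg(1), of x] Hinf_outside[OF fg(2), of x] by (cases "x \<in> U") auto
      then show "f = g"
        by (simp add: fun_eq_iff)
    qed simp
  next
    fix T assume T: "T \<in> carr ?B"
    let ?g = "\<lambda>x. if x \<in> U then T (point_eval U x) else 0"
    have "norm (?g x) \<le> nrm ?B T" if x: "x \<in> U" for x
    proof -
      have "norm (T (point_eval U x)) \<le> nrm ?B T * nrm (Ginf U) (point_eval U x)"
        by (rule operator_norm_bound[OF normed_space_Ginf T point_eval_Ginf[OF x]])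
      also have "\<dots> \<le> nrm ?B T * 1"
        by (intro mult_left_mono operator_norm_nonneg[OF normed_space_Ginf T]) (auto simp: nrm_Ginf point_eval_dual)
      finally show ?thesis
        using x by simp
    qed
    then have "?g \<in> carr ?H"
      by (rule HinfI[OF holomorphic_map_operator_point_eval[OF assms T]]) simp_all
    moreover have "linearisation U ?g = T"
      by (rule linearisation_eqI[OF T]) simp
    ultimately show "\<exists>f\<in>carr ?H. T = linearisation U f"
      by metis
  qed (rule linearisation_bounded)
qed

section \<open>Weakly summable sequences\<close>

lemma powr_add_le:
  fixes a b q :: real
  assumes "0 \<le> a" "0 \<le> b" "0 \<le> q"
  shows "(a + b) powr q \<le> 2 powr q * (a powr q + b powr q)"
proof -
  have "(a + b) powr q \<le> (2 * max a b) powr q"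
    using assms by (intro powr_mono2) auto
  also have "\<dots> = 2 powr q * max a b powr q"
    using assms by (simp add: powr_mult)
  also have "\<dots> \<le> 2 powr q * (a powr q + b powr q)"
    by (intro mult_left_mono) (auto simp: max_def)
  finally show ?thesis .
qed

text \<open>
  The distance is \<open>0\<close> as soon as one argument lies outside the carrier, because symmetry and nonnegativity of
  a metric are demanded for all elements of the type.
\<close>

lemma dual_Metric_space:
  fixes X :: "'a::complex_vector cnspace"
  assumes X: "normed_space X"
  defines "d \<equiv> \<lambda>\<phi> \<psi>. if \<phi> \<in> carr (dual X) \<and> \<psi> \<in> carr (dual X) then nrm (dual X) (\<phi> - \<psi>) else 0"
  shows "Metric_space (carr (dual X)) d" "Metric_space.mcomplete (carr (dual X)) d"
proof -
  have D: "normed_space (dual X)"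
    by (rule normed_space_bounded_operators[OF X])
  show ms: "Metric_space (carr (dual X)) d"
  proof
    show "0 \<le> d \<phi> \<psi>" for \<phi> \<psi>
      by (simp add: d_def nrm_nonneg[OF D] carr_diff[OF D])
    show "d \<phi> \<psi> = d \<psi> \<phi>" for \<phi> \<psi>
      using nrm_minus_commute[OF D, of \<phi> \<psi>] by (simp add: d_def)
    show "d \<phi> \<psi> = 0 \<longleftrightarrow> \<phi> = \<psi>" if "\<phi> \<in> carr (dual X)" "\<psi> \<in> carr (dual X)" for \<phi> \<psi>
      using that nrm_eq_0_iff[OF D carr_diff[OF D that]] by (simp add: d_def)
    show "d \<phi> \<theta> \<le> d \<phi> \<psi> + d \<psi> \<theta>"
      if "\<phi> \<in> carr (dual X)" "\<psi> \<in> carr (dual X)" "\<theta> \<in> carr (dual X)" for \<phi> \<psi> \<theta>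
      using that nrm_triangle_diff[OF D that] by (simp add: d_def)
  qed
  interpret Metric_space "carr (dual X)" d
    by (rule ms)
  show mcomplete
    unfolding mcomplete_def
  proof (intro allI impI)
    fix \<sigma> assume \<sigma>: "MCauchy \<sigma>"
    then have c: "\<sigma> n \<in> carr (dual X)" for n
      by (auto simp: MCauchy_def)
    have "\<exists>N. \<forall>m\<ge>N. \<forall>n\<ge>N. nrm (dual X) (\<sigma> m - \<sigma> n) < e" if "0 < e" for e
    proof -
      have "d (\<sigma> m) (\<sigma> n) = nrm (dual X) (\<sigma> m - \<sigma> n)" for m n
        by (simp add: d_def c)
      then show ?thesis
        using \<sigma> that unfolding MCauchy_def by metis
    qed
    then obtain S where "S \<in> carr (dual X)" "(\<lambda>n. nrm (dual X) (\<sigma> n - S)) \<longlonglongrightarrow> 0"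
      using bounded_operators_complete[where T = \<sigma>, OF X c] by blast
    then have "limitin mtopology \<sigma> S sequentially"
      unfolding limitin_metric_dist_null by (simp add: d_def c)
    then show "\<exists>x. limitin mtopology \<sigma> x sequentially"
      by blast
  qed
qed

text \<open>
  The uniform boundedness principle in the dual of \<open>X\<close>, which is complete even if \<open>X\<close> is not. The closed sets
  \<open>C k\<close> of functionals whose sums are bounded by \<open>k\<close> cover the dual, so by Baire's theorem one of them
  contains a ball, say of radius \<open>r\<close> about \<open>\<phi>0\<close>. A functional \<open>\<psi>\<close> in the unit ball is a multiple of the difference
  of \<open>\<phi>0 + (r / 2) \<psi>\<close> and \<open>\<phi>0\<close>, both of which belong to \<open>C k\<close>; the crude inequality \<open>powr_add_le\<close> takes the
  place of Minkowski's here.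
\<close>

lemma dual_uniform_bound:
  fixes X :: "'a::complex_vector cnspace"
  assumes X: "normed_space X" and x: "\<And>n. x n \<in> carr X" and q: "0 < q"
    and sum: "\<And>\<phi>. \<phi> \<in> carr (dual X) \<Longrightarrow> summable (\<lambda>n. cmod (\<phi> (x n)) powr q)"
  obtains M where "\<And>\<phi> N. \<phi> \<in> unit_ball (dual X) \<Longrightarrow> (\<Sum>n<N. cmod (\<phi> (x n)) powr q) \<le> M"
proof -
  let ?M = "carr (dual X)"
  define d where "d \<phi> \<psi> = (if \<phi> \<in> ?M \<and> \<psi> \<in> ?M then nrm (dual X) (\<phi> - \<psi>) else 0)" for \<phi> \<psi>
  have D: "normed_space (dual X)"
    by (rule normed_space_bounded_operators[OF X])
  interpret Metric_space ?M d
    unfolding d_def[abs_def] by (rule dual_Metric_space[OF X])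
  have complete: mcomplete
    unfolding d_def[abs_def] by (rule dual_Metric_space[OF X])
  define C where "C k = {\<phi> \<in> ?M. \<forall>N. (\<Sum>n<N. cmod (\<phi> (x n)) powr q) \<le> real k}" for k
  have closed: "closedin mtopology (C k)" for k
    unfolding metric_closedin_iff_sequentially_closed
  proof (intro conjI allI impI; (elim conjE)?)
    show "C k \<subseteq> ?M"
      by (auto simp: C_def)
    fix \<sigma> \<phi> assume \<sigma>: "range \<sigma> \<subseteq> C k" and "limitin mtopology \<sigma> \<phi> sequentially"
    then have \<phi>: "\<phi> \<in> ?M" and lim: "(\<lambda>i. d (\<sigma> i) \<phi>) \<longlonglongrightarrow> 0"
      by (auto simp: limitin_metric_dist_null)
    have \<sigma>M: "\<sigma> i \<in> ?M" for i
      using \<sigma> by (auto simp: C_def)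
    have "(\<lambda>i. \<sigma> i (x n)) \<longlonglongrightarrow> \<phi> (x n)" for n
    proof -
      have "(\<lambda>i. \<sigma> i (x n) - \<phi> (x n)) \<longlonglongrightarrow> 0"
      proof (rule Lim_null_comparison[OF always_eventually])
        show "\<forall>i. norm (\<sigma> i (x n) - \<phi> (x n)) \<le> d (\<sigma> i) \<phi> * nrm X (x n)"
          using operator_norm_bound[OF X carr_diff[OF D \<sigma>M \<phi>] x] by (simp add: d_def \<sigma>M \<phi>)
        show "(\<lambda>i. d (\<sigma> i) \<phi> * nrm X (x n)) \<longlonglongrightarrow> 0"
          by (rule tendsto_mult_left_zero[OF lim])
      qed
      then show ?thesis
        by (simp add: LIM_zero_iff)
    qed
    then have "(\<lambda>i. \<Sum>n<N. cmod (\<sigma> i (x n)) powr q) \<longlonglongrightarrow> (\<Sum>n<N. cmod (\<phi> (x n)) powr q)" for N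
      using q by (intro tendsto_sum tendsto_powr' tendsto_norm tendsto_const) auto
    moreover have "(\<Sum>n<N. cmod (\<sigma> i (x n)) powr q) \<le> real k" for N i
      using \<sigma> by (auto simp: C_def)
    ultimately have "(\<Sum>n<N. cmod (\<phi> (x n)) powr q) \<le> real k" for N
      using LIMSEQ_le_const2 by blast
    then show "\<phi> \<in> C k"
      using \<phi> by (simp add: C_def)
  qed
  have cover: "\<Union> (range C) = ?M"
  proof
    show "?M \<subseteq> \<Union> (range C)"
    proof
      fix \<phi> assume \<phi>: "\<phi> \<in> ?M"
      obtain k where k: "(\<Sum>n. cmod (\<phi> (x n)) powr q) \<le> real k"
        using real_arch_simple by blast
      have "(\<Sum>n<N. cmod (\<phi> (x n)) powr q) \<le> real k" for N
        using sum_le_suminf[OF sum[OF \<phi>], of "{..<N}"] k by simp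
      then show "\<phi> \<in> \<Union> (range C)"
        using \<phi> by (auto simp: C_def)
    qed
  qed (auto simp: C_def)
  have "\<exists>k. mtopology interior_of (C k) \<noteq> {}"
  proof (rule ccontr)
    assume "\<nexists>k. mtopology interior_of (C k) \<noteq> {}"
    then have "mtopology interior_of \<Union> (range C) = {}"
      using closed by (intro metric_Baire_category_alt[OF complete]) auto
    moreover have "mtopology interior_of \<Union> (range C) = ?M"
      unfolding cover using interior_of_topspace[of mtopology] by simp
    ultimately show False
      using carr_zero[OF D] by auto
  qed
  then obtain k \<phi>0 where \<phi>0: "\<phi>0 \<in> mtopology interior_of (C k)"
    by auto
  have "openin mtopology (mtopology interior_of (C k))"
    by (rule openin_interior_of)
  from iffD1[OF openin_mtopology this, THEN conjunct2, rule_format, OF \<phi>0]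
  obtain r where r: "0 < r" "mball \<phi>0 r \<subseteq> mtopology interior_of (C k)"
    by (elim exE conjE) (rule that)
  have ball: "mball \<phi>0 r \<subseteq> C k"
    by (rule order_trans[OF r(2) interior_of_subset])
  have \<phi>0C: "\<phi>0 \<in> C k"
    by (rule subsetD[OF interior_of_subset \<phi>0])
  then have \<phi>0M: "\<phi>0 \<in> ?M"
    by (auto simp: C_def)
  let ?c = "complex_of_real (r / 2)"
  have "(\<Sum>n<N. cmod (\<psi> (x n)) powr q) \<le> (2 / r) powr q * (2 powr q * (real k + real k))"
    if \<psi>: "\<psi> \<in> unit_ball (dual X)" for \<psi> N
  proof -
    have \<psi>M: "\<psi> \<in> ?M" and \<psi>1: "nrm (dual X) \<psi> \<le> 1"
      using \<psi> by (auto simp: unit_ball_def)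
    let ?\<theta> = "\<phi>0 + ?c *\<^sub>C \<psi>"
    have \<theta>M: "?\<theta> \<in> ?M"
      by (intro carr_add[OF D] carr_scaleC[OF D] \<phi>0M \<psi>M)
    have "nrm (dual X) (?\<theta> - \<phi>0) = r / 2 * nrm (dual X) \<psi>"
      using r nrm_scaleC[OF D \<psi>M, of ?c] by (simp add: norm_divide)
    also have "\<dots> < r"
      using r(1) mult_left_mono[OF \<psi>1, of "r / 2"] by simp
    finally have "?\<theta> \<in> mball \<phi>0 r"
      using \<phi>0M \<theta>M commute[of \<phi>0 ?\<theta>] by (simp add: d_def)
    then have \<theta>C: "?\<theta> \<in> C k"
      using ball by blast
    have each: "cmod (\<psi> (x n)) powr q
        \<le> (2 / r) powr q * (2 powr q * (cmod (?\<theta> (x n)) powr q + cmod (\<phi>0 (x n)) powr q))" for n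
    proof -
      have "?c * \<psi> (x n) = ?\<theta> (x n) - \<phi>0 (x n)"
        by (simp add: scaleC_complex_def)
      then have "r / 2 * cmod (\<psi> (x n)) \<le> cmod (?\<theta> (x n)) + cmod (\<phi>0 (x n))"
        using norm_triangle_ineq4[of "?\<theta> (x n)" "\<phi>0 (x n)"] norm_mult[of ?c "\<psi> (x n)"] r(1)
        by (simp add: norm_divide)
      then have "cmod (\<psi> (x n)) \<le> 2 / r * (cmod (?\<theta> (x n)) + cmod (\<phi>0 (x n)))"
        using r(1) by (simp add: field_simps)
      then have "cmod (\<psi> (x n)) powr q \<le> (2 / r * (cmod (?\<theta> (x n)) + cmod (\<phi>0 (x n)))) powr q"
        using q by (intro powr_mono2) auto
      also have "\<dots> = (2 / r) powr q * (cmod (?\<theta> (x n)) + cmod (\<phi>0 (x n))) powr q"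
        by (rule powr_mult)
      also have "\<dots> \<le> (2 / r) powr q * (2 powr q * (cmod (?\<theta> (x n)) powr q + cmod (\<phi>0 (x n)) powr q))"
        using q by (intro mult_left_mono powr_add_le) auto
      finally show ?thesis .
    qed
    have "(\<Sum>n<N. cmod (\<psi> (x n)) powr q)
        \<le> (\<Sum>n<N. (2 / r) powr q * (2 powr q * (cmod (?\<theta> (x n)) powr q + cmod (\<phi>0 (x n)) powr q)))"
      by (intro sum_mono each)
    also have "\<dots> = (2 / r) powr q * (2 powr q *
        ((\<Sum>n<N. cmod (?\<theta> (x n)) powr q) + (\<Sum>n<N. cmod (\<phi>0 (x n)) powr q)))"
      by (simp only: sum_distrib_left[symmetric] sum.distrib)
    also have "\<dots> \<le> (2 / r) powr q * (2 powr q * (real k + real k))"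
      using \<theta>C \<phi>0C unfolding C_def by (intro mult_left_mono add_mono) auto
    finally show ?thesis .
  qed
  then show thesis
    using that by blast
qed

lemma partial_sums_powr_le_iff:
  fixes a :: "nat \<Rightarrow> real"
  assumes a: "\<And>n. 0 \<le> a n" and q: "0 < q" and L: "0 \<le> L"
  shows "(\<forall>N. (\<Sum>n<N. a n powr q) \<le> L powr q) \<longleftrightarrow>
    summable (\<lambda>n. a n powr q) \<and> (\<Sum>n. a n powr q) powr (1 / q) \<le> L"
proof safe
  assume le: "\<forall>N. (\<Sum>n<N. a n powr q) \<le> L powr q"
  then show s: "summable (\<lambda>n. a n powr q)"
    by (intro summableI_nonneg_bounded) auto
  have "(\<Sum>n. a n powr q) powr (1 / q) \<le> (L powr q) powr (1 / q)"
    using q le by (intro powr_mono2 suminf_le_const[OF s] suminf_nonneg[OF s]) auto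
  then show "(\<Sum>n. a n powr q) powr (1 / q) \<le> L"
    using q L by (simp add: powr_powr)
next
  fix N assume s: "summable (\<lambda>n. a n powr q)" and le: "(\<Sum>n. a n powr q) powr (1 / q) \<le> L"
  have nonneg: "0 \<le> (\<Sum>n. a n powr q)"
    by (intro suminf_nonneg[OF s]) auto
  have "(\<Sum>n<N. a n powr q) \<le> (\<Sum>n. a n powr q)"
    by (intro sum_le_suminf[OF s]) auto
  also have "\<dots> = ((\<Sum>n. a n powr q) powr (1 / q)) powr q"
    using q nonneg by (simp add: powr_powr)
  also have "\<dots> \<le> L powr q"
    using q le by (intro powr_mono2) auto
  finally show "(\<Sum>n<N. a n powr q) \<le> L powr q" .
qed

definition lp_bounded :: "real \<Rightarrow> (nat \<Rightarrow> 'b::real_normed_vector) \<Rightarrow> real \<Rightarrow> bool" where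
  "lp_bounded p y L \<longleftrightarrow> 0 \<le> L \<and> (\<forall>N. (\<Sum>n<N. norm (y n) powr p) \<le> L powr p)"

lemma lp_bounded_iff:
  assumes "0 < p"
  shows "lp_bounded p y L \<longleftrightarrow> y \<in> lp_seqs p \<and> lp_norm p y \<le> L"
proof -
  have "0 \<le> L" if "lp_norm p y \<le> L"
    by (rule order_trans[OF _ that]) (simp add: lp_norm_def)
  then show ?thesis
    using partial_sums_powr_le_iff[of "\<lambda>n. norm (y n)" p L] assms
    unfolding lp_bounded_def lp_seqs_def lp_norm_def by auto
qed

text \<open>
  The weak norm of \<open>x\<close> for the exponent conjugate to \<open>p\<close> is at most \<open>W\<close>. The bound is put on finite partial
  sums, so that it can be established without first knowing that series converge or that suprema are finite.
\<close>

definition weakly_bounded :: "real \<Rightarrow> 'a::complex_vector cnspace \<Rightarrow> (nat \<Rightarrow> 'a) \<Rightarrow> real \<Rightarrow> bool" where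
  "weakly_bounded p X x W \<longleftrightarrow> (\<forall>n. x n \<in> carr X) \<and> 0 \<le> W \<and>
     (if p = 1 then \<forall>n. nrm X (x n) \<le> W
      else \<forall>\<phi>\<in>unit_ball (dual X). \<forall>N.
        (\<Sum>n<N. cmod (\<phi> (x n)) powr (p / (p - 1))) \<le> W powr (p / (p - 1)))"

lemma weakly_bounded_iff_1:
  assumes X: "normed_space X"
  shows "weakly_bounded 1 X x W \<longleftrightarrow> x \<in> weak_seqs \<infinity> X \<and> weak_norm \<infinity> X x \<le> W"
proof
  assume "weakly_bounded 1 X x W"
  then show "x \<in> weak_seqs \<infinity> X \<and> weak_norm \<infinity> X x \<le> W"
    by (auto simp: weakly_bounded_def weak_seqs_def weak_norm_def intro!: bdd_aboveI2 cSUP_least)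
next
  assume x: "x \<in> weak_seqs \<infinity> X \<and> weak_norm \<infinity> X x \<le> W"
  then have c: "x n \<in> carr X" and bdd: "bdd_above (range (\<lambda>n. nrm X (x n)))" for n
    by (auto simp: weak_seqs_def)
  have "nrm X (x n) \<le> W" for n
    using cSUP_upper[OF UNIV_I bdd, of n] x by (auto simp: weak_norm_def)
  then show "weakly_bounded 1 X x W"
    using c order_trans[OF nrm_nonneg[OF X c]] by (auto simp: weakly_bounded_def)
qed

text \<open>
  From left to right, summability for an arbitrary functional follows by scaling it into the unit ball. From
  right to left, uniform boundedness makes the supremum in the weak norm a genuine upper bound.
\<close>

lemma weakly_bounded_iff:
  fixes X :: "'a::complex_vector cnspace"
  assumes X: "normed_space X" and p: "1 \<le> p"
  shows "weakly_bounded p X x W \<longleftrightarrow>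
    x \<in> weak_seqs (conj_exponent p) X \<and> weak_norm (conj_exponent p) X x \<le> W"
proof (cases "p = 1")
  case True
  then show ?thesis
    using weakly_bounded_iff_1[OF X] by (simp add: conj_exponent_def)
next
  case False
  define q where "q = p / (p - 1)"
  have q: "0 < q" and conj: "conj_exponent p = ereal q"
    using False p by (simp_all add: q_def conj_exponent_def)
  have D: "normed_space (dual X)"
    by (rule normed_space_bounded_operators[OF X])
  let ?s = "\<lambda>\<phi>. (\<Sum>n. cmod (\<phi> (x n)) powr q) powr (1 / q)"
  have ball0: "0 \<in> unit_ball (dual X)"
    by (simp add: unit_ball_def carr_zero[OF D] nrm_zero[OF D])
  have bounded: "weakly_bounded p X x W \<longleftrightarrow> (\<forall>n. x n \<in> carr X) \<and> 0 \<le> W \<and>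
      (\<forall>\<phi>\<in>unit_ball (dual X). summable (\<lambda>n. cmod (\<phi> (x n)) powr q) \<and> ?s \<phi> \<le> W)"
    using False partial_sums_powr_le_iff[OF _ q, of "\<lambda>n. cmod (_ (x n))" W]
    by (auto simp: weakly_bounded_def q_def[symmetric])
  have seqs: "x \<in> weak_seqs (conj_exponent p) X \<longleftrightarrow> (\<forall>n. x n \<in> carr X) \<and>
      (\<forall>\<phi>\<in>carr (dual X). summable (\<lambda>n. cmod (\<phi> (x n)) powr q))"
    by (auto simp: conj weak_seqs_def)
  have norm: "weak_norm (conj_exponent p) X x = (SUP \<phi>\<in>unit_ball (dual X). ?s \<phi>)"
    by (simp add: conj weak_norm_def)
  show ?thesis
  proof
    assume "weakly_bounded p X x W"
    then have x: "\<And>n. x n \<in> carr X" and W: "0 \<le> W"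
      and s: "\<And>\<phi>. \<phi> \<in> unit_ball (dual X) \<Longrightarrow> summable (\<lambda>n. cmod (\<phi> (x n)) powr q)"
      and le: "\<And>\<phi>. \<phi> \<in> unit_ball (dual X) \<Longrightarrow> ?s \<phi> \<le> W"
      unfolding bounded by auto
    have "summable (\<lambda>n. cmod (\<phi> (x n)) powr q)" if \<phi>: "\<phi> \<in> carr (dual X)" for \<phi>
    proof -
      define k where "k = nrm (dual X) \<phi> + 1"
      have k: "0 < k" "nrm (dual X) \<phi> \<le> k"
        using nrm_nonneg[OF D \<phi>] by (simp_all add: k_def)
      let ?\<psi> = "complex_of_real (1 / k) *\<^sub>C \<phi>"
      have "?\<psi> \<in> unit_ball (dual X)"
        using k nrm_scaleC[OF D \<phi>, of "complex_of_real (1 / k)"]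
        by (simp add: unit_ball_def carr_scaleC[OF D \<phi>] norm_divide)
      from summable_mult[OF s[OF this], of "k powr q"]
      have "summable (\<lambda>n. (k * cmod (?\<psi> (x n))) powr q)"
        using k by (simp add: powr_mult)
      moreover have "k * cmod (?\<psi> (x n)) = cmod (\<phi> (x n))" for n
        using k by (simp add: norm_scaleC norm_divide)
      ultimately show ?thesis
        by simp
    qed
    moreover have "(SUP \<phi>\<in>unit_ball (dual X). ?s \<phi>) \<le> W"
      using ball0 le by (intro cSUP_least) auto
    ultimately show "x \<in> weak_seqs (conj_exponent p) X \<and> weak_norm (conj_exponent p) X x \<le> W"
      unfolding seqs norm using x by blast
  next
    assume "x \<in> weak_seqs (conj_exponent p) X \<and> weak_norm (conj_exponent p) X x \<le> W"
    then have x: "\<And>n. x n \<in> carr X" and W: "(SUP \<phi>\<in>unit_ball (dual X). ?s \<phi>) \<le> W"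
      and s: "\<And>\<phi>. \<phi> \<in> carr (dual X) \<Longrightarrow> summable (\<lambda>n. cmod (\<phi> (x n)) powr q)"
      unfolding seqs norm by auto
    obtain M where M: "\<And>\<phi> N. \<phi> \<in> unit_ball (dual X) \<Longrightarrow> (\<Sum>n<N. cmod (\<phi> (x n)) powr q) \<le> M"
      using dual_uniform_bound[where x = x, OF X x q s] by blast
    have bdd: "bdd_above (?s ` unit_ball (dual X))"
    proof (rule bdd_aboveI2)
      fix \<phi> assume \<phi>: "\<phi> \<in> unit_ball (dual X)"
      then have "\<phi> \<in> carr (dual X)"
        by (simp add: unit_ball_def)
      from s[OF this] show "?s \<phi> \<le> M powr (1 / q)"
        using q M[OF \<phi>] by (intro powr_mono2 suminf_le_const suminf_nonneg) auto
    qed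
    have le: "?s \<phi> \<le> W" if "\<phi> \<in> unit_ball (dual X)" for \<phi>
      using cSUP_upper[OF that bdd] W by linarith
    have "0 \<le> W"
      using order_trans[OF powr_ge_zero le[OF ball0]] .
    then show "weakly_bounded p X x W"
      unfolding bounded using x le s by (auto simp: unit_ball_def)
  qed
qed

section \<open>Scaling and interleaving sequences\<close>

lemma weakly_bounded_scaleC:
  assumes X: "normed_space X" and x: "weakly_bounded p X x W"
  shows "weakly_bounded p X (\<lambda>n. c *\<^sub>C x n) (cmod c * W)"
proof -
  let ?q = "p / (p - 1)"
  have xc: "x n \<in> carr X" and W: "0 \<le> W" for n
    using x by (auto simp: weakly_bounded_def)
  have "(\<Sum>n<N. cmod (\<phi> (c *\<^sub>C x n)) powr ?q) \<le> (cmod c * W) powr ?q"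
    if p: "p \<noteq> 1" and \<phi>: "\<phi> \<in> unit_ball (dual X)" for \<phi> N
  proof -
    have "linear_on (carr X) \<phi>"
      using \<phi> operator_linear by (auto simp: unit_ball_def)
    then have "(\<Sum>n<N. cmod (\<phi> (c *\<^sub>C x n)) powr ?q) = cmod c powr ?q * (\<Sum>n<N. cmod (\<phi> (x n)) powr ?q)"
      by (simp add: linear_on_scaleC xc norm_scaleC powr_mult sum_distrib_left)
    also have "\<dots> \<le> cmod c powr ?q * W powr ?q"
      using x p \<phi> by (intro mult_left_mono) (auto simp: weakly_bounded_def)
    finally show ?thesis
      by (simp add: powr_mult)
  qed
  then show ?thesis
    using x by (auto simp: weakly_bounded_def carr_scaleC[OF X] nrm_scaleC[OF X] mult_left_mono)
qed

lemma lp_bounded_scaleC: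
  fixes y :: "nat \<Rightarrow> 'b::complex_normed_vector"
  assumes "lp_bounded p y L"
  shows "lp_bounded p (\<lambda>n. c *\<^sub>C y n) (cmod c * L)"
proof -
  have "(\<Sum>n<N. norm (c *\<^sub>C y n) powr p) \<le> (cmod c * L) powr p" for N
  proof -
    have "(\<Sum>n<N. norm (c *\<^sub>C y n) powr p) = cmod c powr p * (\<Sum>n<N. norm (y n) powr p)"
      by (simp add: norm_scaleC powr_mult sum_distrib_left)
    also have "\<dots> \<le> cmod c powr p * L powr p"
      using assms by (intro mult_left_mono) (auto simp: lp_bounded_def)
    finally show ?thesis
      by (simp add: powr_mult)
  qed
  then show ?thesis
    using assms by (simp add: lp_bounded_def)
qed

text \<open>
  Two representations are added by merging their sequences, with the terms of the first at even and those of
  the second at odd positions. Then sums of \<open>p\<close>-th powers add up, for the scalar part as well as for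
  the vector part.
\<close>

definition interleave :: "(nat \<Rightarrow> 'a) \<Rightarrow> (nat \<Rightarrow> 'a) \<Rightarrow> nat \<Rightarrow> 'a" where
  "interleave a b n = (if even n then a (n div 2) else b (n div 2))"

lemma sum_interleave:
  fixes a b :: "nat \<Rightarrow> 'a::comm_monoid_add"
  shows "(\<Sum>n<N. interleave a b n) = (\<Sum>n<(N + 1) div 2. a n) + (\<Sum>n<N div 2. b n)"
proof (induction N)
  case (Suc N)
  then show ?case
    by (cases "even N") (auto elim!: evenE oddE simp: interleave_def add_ac)
qed simp

lemma sum_interleave_le:
  fixes a b :: "nat \<Rightarrow> real"
  assumes "\<And>N. (\<Sum>n<N. a n) \<le> A" "\<And>N. (\<Sum>n<N. b n) \<le> B"
  shows "(\<Sum>n<N. interleave a b n) \<le> A + B"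
  unfolding sum_interleave by (intro add_mono assms)

lemma sums_in_interleave:
  assumes X: "normed_space X" and a: "sums_in X a s" and b: "sums_in X b t"
  shows "sums_in X (interleave a b) (s + t)"
proof -
  have ac: "a n \<in> carr X" and bc: "b n \<in> carr X" and s: "s \<in> carr X" and t: "t \<in> carr X" for n
    using a b by (auto simp: sums_in_def)
  let ?A = "\<lambda>N. s - (\<Sum>n<N. a n)" and ?B = "\<lambda>N. t - (\<Sum>n<N. b n)"
  have A: "?A N \<in> carr X" and B: "?B N \<in> carr X" for N
    by (intro carr_diff[OF X] carr_sum[OF X] s t ac bc)+
  have split: "s + t - (\<Sum>n<N. interleave a b n) = ?A ((N + 1) div 2) + ?B (N div 2)" for N
    by (simp add: sum_interleave)
  have "Z \<le> (N + 1) div 2" "Z \<le> N div 2" if "2 * Z \<le> N" for Z N :: nat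
    using that by linarith+
  then have at_top: "filterlim (\<lambda>N. (N + 1) div 2) at_top (at_top :: nat filter)"
      "filterlim (\<lambda>N. N div 2) at_top (at_top :: nat filter)"
    unfolding filterlim_at_top eventually_at_top_linorder by blast+
  have lim: "(\<lambda>N. nrm X (?A ((N + 1) div 2)) + nrm X (?B (N div 2))) \<longlonglongrightarrow> 0"
    using a b unfolding sums_in_def
    by (intro tendsto_add_zero filterlim_compose[OF _ at_top(1)] filterlim_compose[OF _ at_top(2)]) auto
  have "(\<lambda>N. nrm X (s + t - (\<Sum>n<N. interleave a b n))) \<longlonglongrightarrow> 0"
  proof (rule Lim_null_comparison[OF always_eventually lim], rule allI)
    fix N
    show "norm (nrm X (s + t - (\<Sum>n<N. interleave a b n)))
        \<le> nrm X (?A ((N + 1) div 2)) + nrm X (?B (N div 2))"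
      unfolding split using nrm_triangle[OF X A B] nrm_nonneg[OF X carr_add[OF X A B]] by simp
  qed
  then show ?thesis
    using ac bc s t by (simp add: sums_in_def interleave_def carr_add[OF X])
qed

lemma conj_exponent_powr:
  assumes "1 \<le> p" "p \<noteq> 1" "0 < (A::real)"
  shows "(A powr (1 - 1 / p)) powr (p / (p - 1)) = A"
proof -
  have "(1 - 1 / p) * (p / (p - 1)) = 1"
    using assms by (simp add: field_simps)
  then show ?thesis
    using assms by (simp only: powr_powr) simp
qed

text \<open>
  With bounds of the form \<open>A powr (1 - 1 / p)\<close> the sums of powers are bounded by \<open>A\<close> and \<open>B\<close>, hence those of the
  merged sequence by \<open>A + B\<close>. For \<open>p = 1\<close> all three bounds are \<open>1\<close>, and the assumption that \<open>A\<close> and \<open>B\<close> are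
  positive excludes the value \<open>0 powr 0 = 0\<close>.
\<close>

lemma weakly_bounded_interleave:
  assumes p: "1 \<le> p" and pos: "0 < A" "0 < B"
    and x: "weakly_bounded p X x (A powr (1 - 1 / p))" and y: "weakly_bounded p X y (B powr (1 - 1 / p))"
  shows "weakly_bounded p X (interleave x y) ((A + B) powr (1 - 1 / p))"
proof (cases "p = 1")
  case True
  then show ?thesis
    using x y pos by (auto simp: weakly_bounded_def interleave_def)
next
  case False
  let ?q = "p / (p - 1)"
  have pow: "(C powr (1 - 1 / p)) powr ?q = C" if "0 < C" for C
    by (rule conj_exponent_powr[OF p False that])
  have "(\<Sum>n<N. cmod (\<phi> (interleave x y n)) powr ?q) \<le> A + B" if \<phi>: "\<phi> \<in> unit_ball (dual X)" for \<phi> N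
  proof -
    have "(\<Sum>n<N. cmod (\<phi> (interleave x y n)) powr ?q)
        = (\<Sum>n<N. interleave (\<lambda>n. cmod (\<phi> (x n)) powr ?q) (\<lambda>n. cmod (\<phi> (y n)) powr ?q) n)"
      by (rule sum.cong) (simp_all add: interleave_def)
    also have "\<dots> \<le> A + B"
      using x y False \<phi> by (intro sum_interleave_le) (auto simp: weakly_bounded_def pow pos)
    finally show ?thesis .
  qed
  then show ?thesis
    using x y False pos by (auto simp: weakly_bounded_def pow interleave_def)
qed

lemma lp_bounded_interleave:
  assumes p: "1 \<le> p" and pos: "0 < A" "0 < B"
    and y: "lp_bounded p y (A powr (1 / p))" and z: "lp_bounded p z (B powr (1 / p))"
  shows "lp_bounded p (interleave y z) ((A + B) powr (1 / p))"
proof -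
  have pow: "(C powr (1 / p)) powr p = C" if "0 < C" for C
    using p that by (simp add: powr_powr)
  have "(\<Sum>n<N. norm (interleave y z n) powr p) \<le> A + B" for N
  proof -
    have "(\<Sum>n<N. norm (interleave y z n) powr p)
        = (\<Sum>n<N. interleave (\<lambda>n. norm (y n) powr p) (\<lambda>n. norm (z n) powr p) n)"
      by (rule sum.cong) (simp_all add: interleave_def)
    also have "\<dots> \<le> A + B"
      using y z by (intro sum_interleave_le) (auto simp: lp_bounded_def pow pos)
    finally show ?thesis .
  qed
  then show ?thesis
    using pos by (simp add: lp_bounded_def pow)
qed

section \<open>The right nuclear norm\<close>

text \<open>
  A representation whose product of norms \<open>W * L\<close> is below \<open>A\<close> can be rescaled, multiplying one factor by \<open>t\<close>
  and dividing the other by it, until the factors are below \<open>A powr (1 - 1 / p)\<close> and \<open>A powr (1 / p)\<close>.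
\<close>

lemma balancing_factor:
  fixes W L A :: real
  assumes p: "1 \<le> p" and nonneg: "0 \<le> W" "0 \<le> L" and less: "W * L < A"
  obtains t where "0 < t" "t * W \<le> A powr (1 - 1 / p)" "L / t \<le> A powr (1 / p)"
proof -
  have A: "0 < A"
    using less mult_nonneg_nonneg[OF nonneg] by linarith
  show thesis
  proof (cases "L = 0")
    case True
    have "A powr (1 - 1 / p) / (W + 1) * W \<le> A powr (1 - 1 / p)"
      using nonneg by (simp add: pos_divide_le_eq algebra_simps)
    then show thesis
      using True nonneg A by (intro that[of "A powr (1 - 1 / p) / (W + 1)"]) auto
  next
    case False
    have "L / A powr (1 / p) * W = W * L / A powr (1 / p)"
      by simp
    also have "\<dots> \<le> A / A powr (1 / p)"
      using less by (intro divide_right_mono) auto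
    also have "\<dots> = A powr (1 - 1 / p)"
      using A by (simp add: powr_diff)
    finally show thesis
      using False nonneg A by (intro that[of "L / A powr (1 / p)"]) auto
  qed
qed

text \<open>
  A representation in which the bound \<open>A\<close> is distributed over the two factors according to the exponents.
  These are the representations that add well under merging. The right nuclear norm is the infimum of the
  admissible \<open>A\<close>.
\<close>

definition balanced_rep :: "real \<Rightarrow> 'e::complex_normed_vector set \<Rightarrow> ('e \<Rightarrow> 'f::complex_normed_vector) \<Rightarrow>
    real \<Rightarrow> bool" where
  "balanced_rep p U f A \<longleftrightarrow> 0 < A \<and> (\<exists>g y. sums_in (Hinf U) (\<lambda>n. tensor (g n) (y n)) f \<and>
     weakly_bounded p (Hinf U) g (A powr (1 - 1 / p)) \<and> lp_bounded p y (A powr (1 / p)))"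

lemma weak_norm_nonneg:
  assumes "normed_space X" "1 \<le> p" "x \<in> weak_seqs (conj_exponent p) X"
  shows "0 \<le> weak_norm (conj_exponent p) X x"
  using weakly_bounded_iff[OF assms(1,2), of x "weak_norm (conj_exponent p) X x"] assms(3)
  by (simp add: weakly_bounded_def)

lemma hol_nuclear_rep_product_nonneg:
  assumes "1 \<le> p" "hol_nuclear_rep p U f g y"
  shows "0 \<le> weak_norm (conj_exponent p) (Hinf U) g * lp_norm p y"
  using assms weak_norm_nonneg[OF normed_space_Hinf assms(1), of g]
  by (auto simp: hol_nuclear_rep_def lp_norm_def)

lemma hol_nuclear_norm_nonneg:
  assumes p: "1 \<le> p" and f: "right_nuclear_hol p U f"
  shows "0 \<le> hol_nuclear_norm p U f"
  using f hol_nuclear_rep_product_nonneg[OF p] unfolding hol_nuclear_norm_def right_nuclear_hol_def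
  by (intro cInf_greatest) auto

lemma balanced_rep_if_norm_less:
  assumes p: "1 \<le> p" and f: "right_nuclear_hol p U f" and less: "hol_nuclear_norm p U f < A"
  shows "balanced_rep p U f A"
proof -
  let ?q = "conj_exponent p"
  have "\<exists>z\<in>{weak_norm ?q (Hinf U) g * lp_norm p y | g y. hol_nuclear_rep p U f g y}. z < A"
    using f less unfolding hol_nuclear_norm_def right_nuclear_hol_def by (intro cInf_lessD) auto
  then obtain g y where rep: "hol_nuclear_rep p U f g y" and WL: "weak_norm ?q (Hinf U) g * lp_norm p y < A"
    by blast
  then have g: "weakly_bounded p (Hinf U) g (weak_norm ?q (Hinf U) g)" and y: "lp_bounded p y (lp_norm p y)"
    and sums: "sums_in (Hinf U) (\<lambda>n. tensor (g n) (y n)) f"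
    using p by (auto simp: hol_nuclear_rep_def weakly_bounded_iff[OF normed_space_Hinf] lp_bounded_iff)
  obtain t where t: "0 < t" "t * weak_norm ?q (Hinf U) g \<le> A powr (1 - 1 / p)" "lp_norm p y / t \<le> A powr (1 / p)"
    using balancing_factor[OF p _ _ WL] g y by (auto simp: weakly_bounded_def lp_bounded_def)
  let ?c = "complex_of_real t" and ?d = "complex_of_real (1 / t)"
  have "weakly_bounded p (Hinf U) (\<lambda>n. ?c *\<^sub>C g n) (A powr (1 - 1 / p))"
    using weakly_bounded_scaleC[OF normed_space_Hinf g, of ?c] t
    by (auto simp: weakly_bounded_iff[OF normed_space_Hinf p])
  moreover have "lp_bounded p (\<lambda>n. ?d *\<^sub>C y n) (A powr (1 / p))"
    using lp_bounded_scaleC[OF y, of ?d] t p by (auto simp: lp_bounded_iff norm_divide)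
  moreover have "tensor (?c *\<^sub>C g n) (?d *\<^sub>C y n) = tensor (g n) (y n)" for n
    using t by (simp add: tensor_def fun_eq_iff scaleC_complex_def scaleC_scaleC)
  moreover have "0 < A"
    using WL hol_nuclear_rep_product_nonneg[OF p rep] by linarith
  ultimately show ?thesis
    unfolding balanced_rep_def using sums
    by (intro conjI exI[of _ "\<lambda>n. ?c *\<^sub>C g n"] exI[of _ "\<lambda>n. ?d *\<^sub>C y n"]) simp_all
qed

lemma balanced_rep_imp_nuclear:
  assumes p: "1 \<le> p" and f: "balanced_rep p U f A"
  shows "right_nuclear_hol p U f" "hol_nuclear_norm p U f \<le> A"
proof -
  let ?q = "conj_exponent p"
  obtain g y where A: "0 < A" and sums: "sums_in (Hinf U) (\<lambda>n. tensor (g n) (y n)) f"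
    and g: "weakly_bounded p (Hinf U) g (A powr (1 - 1 / p))" and y: "lp_bounded p y (A powr (1 / p))"
    using f by (auto simp: balanced_rep_def)
  have g': "g \<in> weak_seqs ?q (Hinf U)" "weak_norm ?q (Hinf U) g \<le> A powr (1 - 1 / p)"
    using g by (auto simp: weakly_bounded_iff[OF normed_space_Hinf p])
  have y': "y \<in> lp_seqs p" "lp_norm p y \<le> A powr (1 / p)"
    using y p by (auto simp: lp_bounded_iff)
  have rep: "hol_nuclear_rep p U f g y"
    using g' y' sums by (simp add: hol_nuclear_rep_def)
  then show "right_nuclear_hol p U f"
    using sums by (auto simp: right_nuclear_hol_def sums_in_def)
  have "hol_nuclear_norm p U f \<le> weak_norm ?q (Hinf U) g * lp_norm p y"
    unfolding hol_nuclear_norm_def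
  proof (rule cInf_lower)
    show "bdd_below {weak_norm ?q (Hinf U) g * lp_norm p y | g y. hol_nuclear_rep p U f g y}"
      using hol_nuclear_rep_product_nonneg[OF p] by (intro bdd_belowI[of _ 0]) auto
  qed (use rep in auto)
  also have "\<dots> \<le> A powr (1 - 1 / p) * A powr (1 / p)"
    using g' y' by (intro mult_mono) (auto simp: lp_norm_def)
  also have "\<dots> = A"
    using A by (simp flip: powr_add)
  finally show "hol_nuclear_norm p U f \<le> A" .
qed

text \<open>
  By Young's inequality \<open>\<Sum> \<bar>g n x\<bar> * norm (y n)\<close> is at most \<open>A / q + A / p = A\<close> for the conjugate exponent \<open>q\<close>;
  the evaluation at \<open>x\<close> is one of the functionals over which the weak norm is taken. This is what makes the
  nuclear norm definite.
\<close>

lemma balanced_rep_norm_le: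
  fixes f :: "'e::complex_normed_vector \<Rightarrow> 'f::complex_normed_vector"
  assumes p: "1 \<le> p" and f: "balanced_rep p U f A"
  shows "nrm (Hinf U) f \<le> A"
proof -
  obtain g y where A: "0 < A" and sums: "sums_in (Hinf U) (\<lambda>n. tensor (g n) (y n)) f"
    and g: "weakly_bounded p (Hinf U) g (A powr (1 - 1 / p))" and y: "lp_bounded p y (A powr (1 / p))"
    using f by (auto simp: balanced_rep_def)
  have y_sum: "(\<Sum>n<N. norm (y n) powr p) \<le> A" for N
    using y A p by (auto simp: lp_bounded_def powr_powr)
  have partial: "(\<Sum>n<N. cmod (g n x) * norm (y n)) \<le> A" for N x
  proof (cases "p = 1")
    case True
    have "cmod (g n x) \<le> 1" for n
    proof -
      have "g n \<in> carr (Hinf U)" "nrm (Hinf U) (g n) \<le> 1"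
        using g True A by (auto simp: weakly_bounded_def)
      then show ?thesis
        using Hinf_norm_bound order_trans by blast
    qed
    then have "(\<Sum>n<N. cmod (g n x) * norm (y n)) \<le> (\<Sum>n<N. 1 * norm (y n) powr p)"
      by (intro sum_mono mult_mono) (auto simp: True)
    then show ?thesis
      using y_sum[of N] by simp
  next
    case False
    let ?q = "p / (p - 1)"
    have q: "1 < ?q" "1 / ?q + 1 / p = 1"
      using p False by (auto simp: field_simps)
    have "point_eval U x \<in> unit_ball (dual (Hinf U))"
      by (simp add: unit_ball_def point_eval_dual)
    then have g_sum: "(\<Sum>n<N. cmod (g n x) powr ?q) \<le> A"
      using g False by (auto simp: weakly_bounded_def point_eval_apply conj_exponent_powr[OF p False A])
    have "(\<Sum>n<N. cmod (g n x) * norm (y n)) \<le> (\<Sum>n<N. cmod (g n x) powr ?q / ?q + norm (y n) powr p / p)"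
      using q p False by (intro sum_mono Youngs_inequality) auto
    also have "\<dots> = (\<Sum>n<N. cmod (g n x) powr ?q) / ?q + (\<Sum>n<N. norm (y n) powr p) / p"
      by (simp only: sum.distrib sum_divide_distrib)
    also have "\<dots> \<le> A / ?q + A / p"
      using q p by (intro add_mono divide_right_mono g_sum y_sum) auto
    also have "\<dots> = A * (1 / ?q + 1 / p)"
      by (simp add: distrib_left)
    finally show ?thesis
      using q by simp
  qed
  show ?thesis
  proof (rule Hinf_norm_le)
    fix x
    let ?R = "\<lambda>N. f - (\<Sum>n<N. tensor (g n) (y n))"
    have "norm (f x) \<le> nrm (Hinf U) (?R N) + A" for N
    proof -
      have "?R N \<in> carr (Hinf U)"
        using sums unfolding sums_in_def
        by (intro carr_diff[OF normed_space_Hinf] carr_sum[OF normed_space_Hinf]) auto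
      then have "norm (?R N x) \<le> nrm (Hinf U) (?R N)"
        by (rule Hinf_norm_bound)
      moreover have "norm (\<Sum>n<N. g n x *\<^sub>C y n) \<le> (\<Sum>n<N. cmod (g n x) * norm (y n))"
        by (rule order_trans[OF norm_sum]) (simp add: norm_scaleC)
      moreover have "f x = ?R N x + (\<Sum>n<N. g n x *\<^sub>C y n)"
        by (simp add: sum_fun_apply tensor_def)
      then have "norm (f x) \<le> norm (?R N x) + norm (\<Sum>n<N. g n x *\<^sub>C y n)"
        by (metis norm_triangle_ineq)
      ultimately show ?thesis
        using partial[where N = N and x = x] by linarith
    qed
    moreover have "(\<lambda>N. nrm (Hinf U) (?R N) + A) \<longlonglongrightarrow> 0 + A"
      using sums unfolding sums_in_def by (intro tendsto_add tendsto_const) auto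
    ultimately show "norm (f x) \<le> A"
      using LIMSEQ_le_const by fastforce
  qed (use A in simp)
qed

lemma balanced_rep_zero:
  fixes U :: "'e::complex_normed_vector set"
  assumes "0 < A"
  shows "balanced_rep p U (0 :: 'e \<Rightarrow> 'f::complex_normed_vector) A"
proof -
  have "sums_in (Hinf U) (\<lambda>n. tensor 0 0) (0 :: 'e \<Rightarrow> 'f)"
  proof -
    have "tensor 0 0 = (0 :: 'e \<Rightarrow> 'f)"
      by (simp add: tensor_def fun_eq_iff complex_vector.scale_zero_right)
    then show ?thesis
      by (simp add: sums_in_def carr_zero[OF normed_space_Hinf] nrm_zero[OF normed_space_Hinf])
  qed
  moreover have "\<phi> 0 = 0" if "\<phi> \<in> unit_ball (dual (Hinf U))" for \<phi> :: "('e \<Rightarrow> complex) \<Rightarrow> complex"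
    using that by (auto simp: unit_ball_def
        intro!: linear_on_zero[OF normed_space_subspace[OF normed_space_Hinf]] operator_linear)
  then have "(\<Sum>n<N. cmod (\<phi> 0) powr (p / (p - 1))) = 0"
    if "\<phi> \<in> unit_ball (dual (Hinf U))" for \<phi> :: "('e \<Rightarrow> complex) \<Rightarrow> complex" and N :: nat
    using that by simp
  then have "weakly_bounded p (Hinf U) (\<lambda>n. 0 :: 'e \<Rightarrow> complex) (A powr (1 - 1 / p))"
    by (auto simp del: sum_constant simp: weakly_bounded_def carr_zero[OF normed_space_Hinf] nrm_zero[OF normed_space_Hinf])
  moreover have "lp_bounded p (\<lambda>n. 0 :: 'f) (A powr (1 / p))"
    by (simp add: lp_bounded_def)
  ultimately show ?thesis
    unfolding balanced_rep_def using assms by (intro conjI exI[of _ "\<lambda>n. 0"]) simp_all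
qed

lemma balanced_rep_add:
  assumes p: "1 \<le> p" and f: "balanced_rep p U f A" and g: "balanced_rep p U g B"
  shows "balanced_rep p U (f + g) (A + B)"
proof -
  obtain a y where A: "0 < A" and f: "sums_in (Hinf U) (\<lambda>n. tensor (a n) (y n)) f"
    and a: "weakly_bounded p (Hinf U) a (A powr (1 - 1 / p))" and y: "lp_bounded p y (A powr (1 / p))"
    using f by (auto simp: balanced_rep_def)
  obtain b z where B: "0 < B" and g: "sums_in (Hinf U) (\<lambda>n. tensor (b n) (z n)) g"
    and b: "weakly_bounded p (Hinf U) b (B powr (1 - 1 / p))" and z: "lp_bounded p z (B powr (1 / p))"
    using g by (auto simp: balanced_rep_def)
  have "interleave (\<lambda>n. tensor (a n) (y n)) (\<lambda>n. tensor (b n) (z n))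
      = (\<lambda>n. tensor (interleave a b n) (interleave y z n))"
    by (simp add: interleave_def fun_eq_iff)
  then have "sums_in (Hinf U) (\<lambda>n. tensor (interleave a b n) (interleave y z n)) (f + g)"
    using sums_in_interleave[OF normed_space_Hinf f g] by simp
  then show ?thesis
    unfolding balanced_rep_def
    using weakly_bounded_interleave[OF p A B a b] lp_bounded_interleave[OF p A B y z] A B
    by (intro conjI exI[of _ "interleave a b"] exI[of _ "interleave y z"]) simp_all
qed

text \<open>
  To remain balanced, the scalar is split as \<open>c = a * b\<close> with \<open>cmod a = cmod c powr (1 - 1 / p)\<close> and
  \<open>cmod b = cmod c powr (1 / p)\<close>.
\<close>

lemma balanced_rep_scaleC:
  assumes c: "c \<noteq> 0" and f: "balanced_rep p U f A"
  shows "balanced_rep p U (c *\<^sub>C f) (cmod c * A)"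
proof -
  obtain g y where A: "0 < A" and sums: "sums_in (Hinf U) (\<lambda>n. tensor (g n) (y n)) f"
    and g: "weakly_bounded p (Hinf U) g (A powr (1 - 1 / p))" and y: "lp_bounded p y (A powr (1 / p))"
    using f by (auto simp: balanced_rep_def)
  define a where "a = complex_of_real (cmod c powr (1 - 1 / p))"
  define b where "b = c / a"
  have a: "cmod a = cmod c powr (1 - 1 / p)" "a \<noteq> 0"
    using c by (auto simp: a_def)
  have b: "cmod b = cmod c powr (1 / p)"
    using c by (simp add: b_def norm_divide a powr_diff)
  have "tensor (a *\<^sub>C g n) (b *\<^sub>C y n) = c *\<^sub>C tensor (g n) (y n)" for n
    using a by (simp add: tensor_def fun_eq_iff scaleC_complex_def scaleC_scaleC b_def)
  moreover have "sums_in (Hinf U) (\<lambda>n. c *\<^sub>C tensor (g n) (y n)) (c *\<^sub>C f)"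
  proof -
    have ac: "tensor (g n) (y n) \<in> carr (Hinf U)" and fc: "f \<in> carr (Hinf U)" for n
      using sums by (auto simp: sums_in_def)
    have "nrm (Hinf U) (c *\<^sub>C f - (\<Sum>n<N. c *\<^sub>C tensor (g n) (y n)))
        = cmod c * nrm (Hinf U) (f - (\<Sum>n<N. tensor (g n) (y n)))" for N
    proof -
      have "f - (\<Sum>n<N. tensor (g n) (y n)) \<in> carr (Hinf U)"
        by (intro carr_diff[OF normed_space_Hinf] carr_sum[OF normed_space_Hinf] ac fc)
      from nrm_scaleC[OF normed_space_Hinf this, of c] show ?thesis
        by (simp only: complex_vector.scale_right_diff_distrib complex_vector.scale_sum_right)
    qed
    then show ?thesis
      using sums by (auto simp: sums_in_def carr_scaleC[OF normed_space_Hinf] intro: tendsto_mult_right_zero)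
  qed
  ultimately have "sums_in (Hinf U) (\<lambda>n. tensor (a *\<^sub>C g n) (b *\<^sub>C y n)) (c *\<^sub>C f)"
    by simp
  moreover have "weakly_bounded p (Hinf U) (\<lambda>n. a *\<^sub>C g n) ((cmod c * A) powr (1 - 1 / p))"
    using weakly_bounded_scaleC[OF normed_space_Hinf g, of a] by (simp only: a powr_mult)
  moreover have "lp_bounded p (\<lambda>n. b *\<^sub>C y n) ((cmod c * A) powr (1 / p))"
    using lp_bounded_scaleC[OF y, of b] by (simp only: b powr_mult)
  ultimately show ?thesis
    unfolding balanced_rep_def using A c
    by (intro conjI exI[of _ "\<lambda>n. a *\<^sub>C g n"] exI[of _ "\<lambda>n. b *\<^sub>C y n"]) simp_all
qed

text \<open>
  Every norm axiom is read off from the balanced representations with bound \<open>hol_nuclear_norm p U f + e\<close>,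
  letting \<open>e\<close> tend to \<open>0\<close>.
\<close>

lemma normed_space_nuclear_hol_maps:
  fixes U :: "'e::complex_normed_vector set"
  assumes p: "1 \<le> p"
  shows "normed_space (nuclear_hol_maps p U :: ('e \<Rightarrow> 'f::complex_normed_vector) cnspace)"
proof -
  let ?R = "right_nuclear_hol p U :: ('e \<Rightarrow> 'f) \<Rightarrow> bool" and ?N = "hol_nuclear_norm p U :: ('e \<Rightarrow> 'f) \<Rightarrow> real"
  note rep = balanced_rep_if_norm_less[OF p] and nuc = balanced_rep_imp_nuclear[OF p]
  have obt: "balanced_rep p U f (?N f + 1)" if "?R f" for f
    by (rule rep[OF that]) simp
  have zero: "?R 0" "?N 0 = 0"
  proof -
    show R0: "?R 0"
      by (rule nuc(1)[OF balanced_rep_zero[of 1]]) simp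
    have "?N 0 \<le> 0 + e" if "0 < e" for e
      using nuc(2)[OF balanced_rep_zero[OF that]] by simp
    then have "?N 0 \<le> 0"
      by (rule field_le_epsilon)
    then show "?N 0 = 0"
      using hol_nuclear_norm_nonneg[OF p R0] by simp
  qed
  have add: "?R (f + g)" "?N (f + g) \<le> ?N f + ?N g" if fg: "?R f" "?R g" for f g
  proof -
    show "?R (f + g)"
      by (rule nuc(1)[OF balanced_rep_add[OF p obt[OF fg(1)] obt[OF fg(2)]]])
    show "?N (f + g) \<le> ?N f + ?N g"
    proof (rule field_le_epsilon)
      fix e :: real assume "0 < e"
      then have "balanced_rep p U (f + g) ((?N f + e / 2) + (?N g + e / 2))"
        by (intro balanced_rep_add[OF p] rep fg) auto
      from nuc(2)[OF this] show "?N (f + g) \<le> ?N f + ?N g + e"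
        by simp
    qed
  qed
  have scale: "?R (c *\<^sub>C f)" "?N (c *\<^sub>C f) \<le> cmod c * ?N f" if f: "?R f" and c: "c \<noteq> 0" for c f
  proof -
    show "?R (c *\<^sub>C f)"
      by (rule nuc(1)[OF balanced_rep_scaleC[OF c obt[OF f]]])
    show "?N (c *\<^sub>C f) \<le> cmod c * ?N f"
    proof (rule field_le_epsilon)
      fix e :: real assume "0 < e"
      then have "balanced_rep p U (c *\<^sub>C f) (cmod c * (?N f + e / cmod c))"
        using c by (intro balanced_rep_scaleC rep f) auto
      from nuc(2)[OF this] show "?N (c *\<^sub>C f) \<le> cmod c * ?N f + e"
        using c by (simp add: distrib_left)
    qed
  qed
  show ?thesis
    unfolding normed_space_def nuclear_hol_maps_def cnspace.simps mem_Collect_eq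
  proof (intro conjI ballI allI; (simp only: mem_Collect_eq)?)
    show "complex_vector.subspace {f. ?R f}"
    proof (rule complex_vector.subspaceI)
      show "c *\<^sub>C f \<in> {f. ?R f}" if "f \<in> {f. ?R f}" for c f
        using that scale(1) zero(1) by (cases "c = 0") (auto simp: complex_vector.scale_zero_left)
    qed (use zero add in auto)
  next
    fix f assume f: "?R f"
    show "?N f = 0 \<longleftrightarrow> f = 0"
    proof
      assume 0: "?N f = 0"
      have fc: "f \<in> carr (Hinf U)"
        using f by (simp add: right_nuclear_hol_def)
      have "nrm (Hinf U) f \<le> 0 + e" if "0 < e" for e
        using balanced_rep_norm_le[OF p rep[OF f, of e]] 0 that by simp
      then have "nrm (Hinf U) f \<le> 0"
        by (rule field_le_epsilon)
      then have "nrm (Hinf U) f = 0"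
        using Hinf_norm_nonneg[OF fc] by simp
      then show "f = 0"
        using nrm_eq_0_iff[OF normed_space_Hinf fc] by simp
    qed (simp add: zero)
  next
    fix f c assume f: "?R f"
    show "?N (c *\<^sub>C f) = cmod c * ?N f"
    proof (cases "c = 0")
      case True
      then show ?thesis
        by (simp add: complex_vector.scale_zero_left zero)
    next
      case False
      have "?N ((1 / c) *\<^sub>C (c *\<^sub>C f)) \<le> cmod (1 / c) * ?N (c *\<^sub>C f)"
        using False by (intro scale f) auto
      also have "(1 / c) *\<^sub>C (c *\<^sub>C f) = f"
        using False by (simp add: scaleC_scaleC scaleC_one)
      finally have "cmod c * ?N f \<le> cmod c * (cmod (1 / c) * ?N (c *\<^sub>C f))"
        by (rule mult_left_mono) simp
      also have "\<dots> = ?N (c *\<^sub>C f)"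
        using False by (simp add: norm_divide)
      finally have "cmod c * ?N f \<le> ?N (c *\<^sub>C f)" .
      then show ?thesis
        using scale(2)[OF f False] by (rule antisym[rotated])
    qed
  next
    fix f g assume "?R f" "?R g"
    then show "?N (f + g) \<le> ?N f + ?N g"
      by (rule add)
  qed
qed

section \<open>Transport along the linearisation\<close>

lemma linearisation_tensor:
  fixes y :: "'f::complex_banach"
  assumes g: "g \<in> carr (Hinf U)"
  shows "tensor g y \<in> carr (Hinf U)" "linearisation U (tensor g y) = tensor (linearisation U g) y"
proof -
  have lin: "linear_on UNIV (\<lambda>z::complex. z *\<^sub>C y)"
    by (simp add: linear_on_def scaleC_add_left scaleC_complex_def scaleC_scaleC)
  moreover have "bounded_linear (\<lambda>z::complex. z *\<^sub>C y)"
    by (rule bounded_linear_of_linear_on[OF lin, where K = "norm y"]) (simp add: norm_scaleC)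
  ultimately have "holomorphic_map U (tensor g y)"
    unfolding tensor_def by (rule holomorphic_map_compose_linear[OF Hinf_holomorphic[OF g]])
  then show "tensor g y \<in> carr (Hinf U)"
  proof (rule HinfI)
    fix x
    show "norm (tensor g y x) \<le> nrm (Hinf U) g * norm y"
      using Hinf_norm_bound[OF g, of x] by (simp add: tensor_def norm_scaleC mult_right_mono)
    show "tensor g y x = 0" if "x \<notin> U"
      using Hinf_outside[OF g that] by (simp add: tensor_def complex_vector.scale_zero_left)
  qed
  let ?T = "linearisation U g"
  note T = linearisation_bounded[OF g]
  show "linearisation U (tensor g y) = tensor ?T y"
  proof (rule linearisation_eqI)
    show "tensor ?T y \<in> carr (bounded_operators (Ginf U))"
    proof (rule bounded_operatorsI)
      show "linear_on (carr (Ginf U)) (tensor ?T y)"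
        using linear_onD[OF operator_linear[OF T]]
        by (simp add: linear_on_def tensor_def scaleC_add_left scaleC_complex_def scaleC_scaleC)
      show "norm (tensor ?T y \<xi>) \<le> (norm y * nrm (dual (Ginf U)) ?T) * nrm (Ginf U) \<xi>" if "\<xi> \<in> carr (Ginf U)" for \<xi>
        using mult_left_mono[OF operator_norm_bound[OF normed_space_Ginf T that], of "norm y"]
        by (simp add: tensor_def norm_scaleC mult_ac)
      show "tensor ?T y \<xi> = 0" if "\<xi> \<notin> carr (Ginf U)" for \<xi>
        using operator_outside[OF T that] by (simp add: tensor_def complex_vector.scale_zero_left)
    qed
    show "tensor ?T y (point_eval U x) = tensor g y x" if "x \<in> U" for x
      using linearisation_point_eval[OF g that] by (simp add: tensor_def)
  qed
qed

text \<open>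
  The linearisation is applied to \<open>f\<close> and to each scalar function \<open>g n\<close>. Norm convergence is preserved by the
  isometry on vector-valued maps, the weak norm by the one on scalar functions.
\<close>

lemma nuclear_rep_linearisation:
  fixes U :: "'e::complex_normed_vector set" and f :: "'e \<Rightarrow> 'f::complex_banach"
  assumes U: "open U" and rep: "hol_nuclear_rep p U f g y"
  shows "nuclear_rep p (Ginf U) (linearisation U f) (\<lambda>n. linearisation U (g n)) y"
    and "weak_norm (conj_exponent p) (dual (Ginf U)) (\<lambda>n. linearisation U (g n))
      = weak_norm (conj_exponent p) (Hinf U) g"
proof -
  note scalar = isometric_isomorphism_linearisation[OF U, where 'f = complex]
  note vector = isometric_isomorphism_linearisation[OF U, where 'f = 'f]
  have g: "g \<in> weak_seqs (conj_exponent p) (Hinf U)" and y: "y \<in> lp_seqs p"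
    and sums: "sums_in (Hinf U) (\<lambda>n. tensor (g n) (y n)) f"
    using rep by (auto simp: hol_nuclear_rep_def)
  have "g n \<in> carr (Hinf U)" for n
    using g by (auto simp: weak_seqs_def)
  then have "sums_in (bounded_operators (Ginf U)) (\<lambda>n. tensor (linearisation U (g n)) (y n)) (linearisation U f)"
    using sums_in_iso[OF vector sums] by (simp add: linearisation_tensor)
  moreover from sums_in_bounded_operators[OF normed_space_Ginf this]
  have "\<forall>\<xi>\<in>carr (Ginf U). (\<lambda>n. linearisation U (g n) \<xi> *\<^sub>C y n) sums linearisation U f \<xi>"
    by (simp add: tensor_def)
  ultimately show "nuclear_rep p (Ginf U) (linearisation U f) (\<lambda>n. linearisation U (g n)) y"
    using weak_seqs_iso_imp[OF scalar g] y by (simp add: nuclear_rep_def)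
  show "weak_norm (conj_exponent p) (dual (Ginf U)) (\<lambda>n. linearisation U (g n))
      = weak_norm (conj_exponent p) (Hinf U) g"
    by (rule weak_norm_iso[OF scalar g])
qed

text \<open>
  Every functional on the predual is the linearisation of a unique bounded holomorphic function, so every
  representation of the operator arises from one of \<open>f\<close>.
\<close>

lemma nuclear_rep_linearisation_cases:
  fixes U :: "'e::complex_normed_vector set" and f :: "'e \<Rightarrow> 'f::complex_banach"
  assumes U: "open U" and f: "f \<in> carr (Hinf U)"
    and rep: "nuclear_rep p (Ginf U) (linearisation U f) x' y"
  obtains g where "hol_nuclear_rep p U f g y" "x' = (\<lambda>n. linearisation U (g n))"
proof -
  note scalar = isometric_isomorphism_linearisation[OF U, where 'f = complex]
  note vector = isometric_isomorphism_linearisation[OF U, where 'f = 'f]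
  let ?g = "\<lambda>n. inv_into (carr (Hinf U)) (linearisation U) (x' n)"
  have x': "x' \<in> weak_seqs (conj_exponent p) (dual (Ginf U))" and y: "y \<in> lp_seqs p"
    and sums: "sums_in (bounded_operators (Ginf U)) (\<lambda>n. tensor (x' n) (y n)) (linearisation U f)"
    using rep by (auto simp: nuclear_rep_def)
  have x'c: "x' n \<in> carr (dual (Ginf U))" for n
    using x' by (auto simp: weak_seqs_def)
  have g: "?g n \<in> carr (Hinf U)" and lin_g: "linearisation U (?g n) = x' n" for n
    using iso_carr[OF isometric_isomorphism_inverse[OF scalar] x'c]
      isometric_isomorphism_inverse_simps(2)[OF scalar x'c] by auto
  have "inv_into (carr (Hinf U)) (linearisation U) (tensor (x' n) (y n)) = tensor (?g n) (y n)" for n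
    using isometric_isomorphism_inverse_simps(1)[OF vector linearisation_tensor(1)[OF g]]
    by (simp add: linearisation_tensor(2)[OF g] lin_g)
  then have "sums_in (Hinf U) (\<lambda>n. tensor (?g n) (y n)) f"
    using sums_in_iso[OF isometric_isomorphism_inverse[OF vector] sums]
      isometric_isomorphism_inverse_simps(1)[OF vector f] by simp
  then have "hol_nuclear_rep p U f ?g y"
    using weak_seqs_iso_imp[OF isometric_isomorphism_inverse[OF scalar] x'] y by (simp add: hol_nuclear_rep_def)
  then show thesis
    using that lin_g by (simp add: fun_eq_iff)
qed

lemma right_nuclear_linearisation_iff:
  fixes U :: "'e::complex_normed_vector set" and f :: "'e \<Rightarrow> 'f::complex_banach"
  assumes U: "open U" and f: "f \<in> carr (Hinf U)"
  shows "right_nuclear p (Ginf U) (linearisation U f) \<longleftrightarrow> right_nuclear_hol p U f"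
  using f linearisation_bounded[OF f] nuclear_rep_linearisation(1)[OF U] nuclear_rep_linearisation_cases[OF U f]
  unfolding right_nuclear_def right_nuclear_hol_def by metis

lemma nuclear_norm_linearisation:
  fixes U :: "'e::complex_normed_vector set" and f :: "'e \<Rightarrow> 'f::complex_banach"
  assumes U: "open U" and f: "f \<in> carr (Hinf U)"
  shows "nuclear_norm p (Ginf U) (linearisation U f) = hol_nuclear_norm p U f"
proof -
  let ?q = "conj_exponent p"
  have "{weak_norm ?q (dual (Ginf U)) x' * lp_norm p y | x' y. nuclear_rep p (Ginf U) (linearisation U f) x' y}
      = {weak_norm ?q (Hinf U) g * lp_norm p y | g y. hol_nuclear_rep p U f g y}" (is "?L = ?R")
  proof
    show "?R \<subseteq> ?L"
    proof clarify
      fix g y assume "hol_nuclear_rep p U f g y"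
      from nuclear_rep_linearisation[OF U this]
      show "\<exists>x' y'. weak_norm ?q (Hinf U) g * lp_norm p y = weak_norm ?q (dual (Ginf U)) x' * lp_norm p y' \<and>
          nuclear_rep p (Ginf U) (linearisation U f) x' y'"
        by metis
    qed
    show "?L \<subseteq> ?R"
    proof clarify
      fix x' y assume "nuclear_rep p (Ginf U) (linearisation U f) x' y"
      then obtain g where g: "hol_nuclear_rep p U f g y" "x' = (\<lambda>n. linearisation U (g n))"
        by (rule nuclear_rep_linearisation_cases[OF U f])
      then show "\<exists>g y'. weak_norm ?q (dual (Ginf U)) x' * lp_norm p y = weak_norm ?q (Hinf U) g * lp_norm p y' \<and>
          hol_nuclear_rep p U f g y'"
        using nuclear_rep_linearisation(2)[OF U g(1)] by metis
    qed
  qed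
  then show ?thesis
    unfolding nuclear_norm_def hol_nuclear_norm_def by (rule arg_cong)
qed

theorem theorem1p14:
  fixes U :: "'e::complex_banach set"
    and f :: "'e \<Rightarrow> 'f::complex_banach"
    and p :: real
  assumes "open U"
    and "1 \<le> p"
    and "f \<in> carr (Hinf U)"
  shows "(right_nuclear_hol p U f \<longleftrightarrow> right_nuclear p (Ginf U) (linearisation U f)) \<and>
    (right_nuclear_hol p U f \<longrightarrow>
       hol_nuclear_norm p U f = nuclear_norm p (Ginf U) (linearisation U f)) \<and>
    isometric_isomorphism
      (nuclear_hol_maps p U :: ('e \<Rightarrow> 'f) cnspace)
      (nuclear_operators p (Ginf U))
      (linearisation U)"
proof (intro conjI impI)
  note iso = isometric_isomorphism_linearisation[OF \<open>open U\<close>, where 'f = 'f]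
  note nuclear_iff = right_nuclear_linearisation_iff[OF \<open>open U\<close>, where 'f = 'f]
  note norm_eq = nuclear_norm_linearisation[OF \<open>open U\<close>, where 'f = 'f]
  show "right_nuclear_hol p U f \<longleftrightarrow> right_nuclear p (Ginf U) (linearisation U f)"
    by (simp add: nuclear_iff assms)
  show "hol_nuclear_norm p U f = nuclear_norm p (Ginf U) (linearisation U f)"
    by (simp add: norm_eq assms)
  let ?R = "{f :: 'e \<Rightarrow> 'f. right_nuclear_hol p U f}"
  have sub: "?R \<subseteq> carr (Hinf U)"
    by (auto simp: right_nuclear_hol_def)
  show "isometric_isomorphism (nuclear_hol_maps p U :: ('e \<Rightarrow> 'f) cnspace)
      (nuclear_operators p (Ginf U)) (linearisation U)"
  proof (rule isometric_isomorphismI[OF normed_space_nuclear_hol_maps[OF \<open>1 \<le> p\<close>]])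
    show "linear_on (carr (nuclear_hol_maps p U)) (linearisation U :: ('e \<Rightarrow> 'f) \<Rightarrow> _)"
      using linear_onD[OF iso_linear[OF iso]] subsetD[OF sub]
      unfolding linear_on_def nuclear_hol_maps_def by simp
    have "linearisation U ` ?R = {T. right_nuclear p (Ginf U) T}"
    proof (intro equalityI subsetI)
      fix T assume "T \<in> linearisation U ` ?R"
      then show "T \<in> {T. right_nuclear p (Ginf U) T}"
        using nuclear_iff sub by auto
    next
      fix T :: "_ \<Rightarrow> 'f" assume T: "T \<in> {T. right_nuclear p (Ginf U) T}"
      then have "T \<in> carr (bounded_operators (Ginf U))"
        by (simp add: right_nuclear_def)
      then obtain h where h: "h \<in> carr (Hinf U)" "T = linearisation U h"
        using iso_bij[OF iso] by (auto simp: bij_betw_def)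
      then have "h \<in> ?R"
        using T nuclear_iff by auto
      then show "T \<in> linearisation U ` ?R"
        using h by blast
    qed
    moreover have "inj_on (linearisation U) ?R"
      using iso_bij[OF iso] sub by (auto simp: bij_betw_def intro: inj_on_subset)
    ultimately show "bij_betw (linearisation U) (carr (nuclear_hol_maps p U :: ('e \<Rightarrow> 'f) cnspace))
        (carr (nuclear_operators p (Ginf U)))"
      by (simp add: nuclear_hol_maps_def nuclear_operators_def bij_betw_def)
    show "nrm (nuclear_operators p (Ginf U)) (linearisation U h) = nrm (nuclear_hol_maps p U) h"
      if "h \<in> carr (nuclear_hol_maps p U)" for h :: "'e \<Rightarrow> 'f"
      using that sub norm_eq by (auto simp: nuclear_hol_maps_def nuclear_operators_def)
  qed
qed

end
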